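(* Let $h$ be a densely defined multiplier of the CNP space $\mathcal H$, with Beurling pair $(A,B)$. The following are equivalent: (1) There is an invertible map $W:\mathcal H\to\mathcal H(B)$ such that for every $\varphi\in\mathrm{Mult}(\mathcal H)$, $M_\varphi^*|_{\mathcal H(B)}=WM_\varphi^*W^{-1}$. (2) There exists a representing pair $a,b$ for $h$ such that $a$ is outer and $\mathcal H(B)=\mathcal M(a^* )$. (3) There exists a representing pair $a,b$ for $h$ such that $a$ is outer and $a,b$ is a corona pair.
   Context: A CNP kernel on a set $X$ is a kernel of the form $k(x,y)=\frac{1}{1-\langle u(x),u(y)\rangle}$ where $u:X\to \ell^2(I)$ is injective ($I$ some index set) and $\|u(x)\|<1$ for all $x$. A CNP space on $X$ is the reproducing kernel Hilbert space $\mathcal H$ on $X$ with such a kernel. $\mathrm{Mult}(\mathcal H)$ is the algebra of functions $\varphi:X\to\mathbb C$ with $\varphi\mathcal H\subset\mathcal H$; $M_\varphi f=\varphi f$, and $M_\varphi^*$ is its adjoint on $\mathcal H$. A densely defined multiplier of $\mathcal H$ is a function $h:X\to\mathbb C$ for which $\mathrm{Dom}\,T=\{f\in\mathcal H: hf\in\mathcal H\}$ is dense in $\mathcal H$; $Tf=hf$ is then a closed densely defined operator with graph $G(T)\subset\mathcal H\oplus\mathcal H$ and adjoint $T^*$. For a Hilbert space $\mathcal E$, $\mathcal H\otimes\mathcal E$ is the $\mathcal E$-valued reproducing kernel Hilbert space with kernel $k(x,y)I_{\mathcal E}$. A Beurling pair for $h$ is a pair of functions $A,B:X\to\mathcal B(\mathcal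 E,\mathbb C)$ such that $F\mapsto(AF,BF)$ is a partial isometry from $\mathcal H\otimes\mathcal E$ to $\mathcal H\oplus\mathcal H$ with range exactly $G(T)$; such a pair exists, and one is fixed. $\mathcal H(B)$ is the reproducing kernel Hilbert space on $X$ with kernel $(1-B(x)B(y)^* )k(x,y)$; it coincides isometrically with $\mathrm{Dom}\,T^*$ equipped with the graph norm $\|f\|^2_{\mathcal H(B)}=\|f\|^2_{\mathcal H}+\|T^*f\|^2_{\mathcal H}$, and it is invariant under every $M_\varphi^*$. In (1), an invertible map is a bounded linear bijection (with bounded inverse); in (2), the equality is equality as sets (the norms are then automatically comparable). A representing pair for $h$ is a pair of (bounded) nonzero multipliers $a,b\in\mathrm{Mult}(\mathcal H)$ such that $b=ah$ on $X$ and the column $f\mapsto(af,bf)$ from $\mathcal H$ to $\mathcal H\oplus\mathcal H$ is contractive. A multiplier $a$ is outer (cyclic) if $a\mathcal H$ is dense in $\mathcal H$. $\mathcal M(a^* )$ is the range of $M_a^*:\mathcal H\to\mathcal H$, with the norm making $M_a^*$ a partial isometry onto it ($\|M_a^*g\|_{\mathcal M(a^* )}=\|g\|_{\mathcal H}$ for $g\perp\ker M_a^*$). A pair $a,b\in\mathrm{Mult}(\mathcal H)$ is a corona pair if there exist $u,v\in\mathrm{Mult}(\mathcal H)$ with $au+bv\equiv1$.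
   Formalization: In a representing pair, b is required to be nonzero only when h is nonzero; for h = 0 one has b = ah = 0, so with b required nonzero no representing pair would exist although (1) holds with H(B) = H and W the identity. *)

theory Defs
  imports "HOL-Analysis.Analysis" "HOL-Library.Function_Algebras"
begin

section \<open>Complex vector spaces\<close>

class complex_vector = ab_group_add +
  fixes scaleC :: "complex \<Rightarrow> 'a \<Rightarrow> 'a"  (infixr \<open>*\<^sub>C\<close> 75)
  assumes scaleC_add_right: "c *\<^sub>C (x + y) = c *\<^sub>C x + c *\<^sub>C y"
    and scaleC_add_left: "(c + d) *\<^sub>C x = c *\<^sub>C x + d *\<^sub>C x"
    and scaleC_scaleC: "c *\<^sub>C (d *\<^sub>C x) = (c * d) *\<^sub>C x"
    and scaleC_one: "1 *\<^sub>C x = x"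

global_interpretation complex_vector:
  vector_space "scaleC :: complex \<Rightarrow> 'a \<Rightarrow> 'a :: complex_vector"
  by unfold_locales
    (simp_all add: scaleC_add_right scaleC_add_left scaleC_scaleC scaleC_one)

instantiation complex :: complex_vector
begin
definition scaleC_complex where "c *\<^sub>C (z::complex) = c * z"
instance by standard (simp_all add: scaleC_complex_def algebra_simps)
end

instantiation "fun" :: (type, complex_vector) complex_vector
begin
definition scaleC_fun where "c *\<^sub>C f = (\<lambda>x. c *\<^sub>C f x)"
instance by standard
  (simp_all add: scaleC_fun_def fun_eq_iff scaleC_add_right scaleC_add_left scaleC_scaleC scaleC_one)
end

instantiation prod :: (complex_vector, complex_vector) complex_vector
begin
definition scaleC_prod where "c *\<^sub>C p = (c *\<^sub>C fst p, c *\<^sub>C snd p)"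
instance by standard
  (simp_all add: scaleC_prod_def prod_eq_iff scaleC_add_right scaleC_add_left scaleC_scaleC scaleC_one)
end


section \<open>Hilbert spaces and their operators\<close>

text \<open>A Hilbert space is a linear subspace of an ambient complex vector space (e.g. of the space of
  all functions on \<open>X\<close>) with a complete inner product of its own. The inner product is linear in the
  first argument, and its values are meaningful only on the carrier; likewise operators between
  Hilbert spaces are functions on the ambient types of which only the restriction to the carrier
  matters.\<close>

record 'v hilbert =
  hcarrier :: "'v set"
  hinner :: "'v \<Rightarrow> 'v \<Rightarrow> complex"

definition hnorm :: "'v hilbert \<Rightarrow> 'v \<Rightarrow> real" where
  "hnorm H f = sqrt (Re (hinner H f f))"

definition hilbert_space :: "'v::complex_vector hilbert \<Rightarrow> bool" where
  "hilbert_space H \<longleftrightarrow>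
     complex_vector.subspace (hcarrier H) \<and>
     (\<forall>f\<in>hcarrier H. \<forall>g\<in>hcarrier H. \<forall>l\<in>hcarrier H.
        hinner H (f + g) l = hinner H f l + hinner H g l) \<and>
     (\<forall>c. \<forall>f\<in>hcarrier H. \<forall>g\<in>hcarrier H. hinner H (c *\<^sub>C f) g = c * hinner H f g) \<and>
     (\<forall>f\<in>hcarrier H. \<forall>g\<in>hcarrier H. hinner H g f = cnj (hinner H f g)) \<and>
     (\<forall>f\<in>hcarrier H. 0 \<le> Re (hinner H f f)) \<and>
     (\<forall>f\<in>hcarrier H. hinner H f f = 0 \<longrightarrow> f = 0) \<and>
     (\<forall>s. (\<forall>n. s n \<in> hcarrier H) \<and>
          (\<forall>e>0. \<exists>N. \<forall>m\<ge>N. \<forall>n\<ge>N. hnorm H (s m - s n) < e) \<longrightarrow>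
        (\<exists>l\<in>hcarrier H. (\<lambda>n. hnorm H (s n - l)) \<longlonglongrightarrow> 0))"

definition hdense :: "'v::complex_vector hilbert \<Rightarrow> 'v set \<Rightarrow> bool" where
  "hdense H D \<longleftrightarrow> D \<subseteq> hcarrier H \<and> (\<forall>g\<in>hcarrier H. \<forall>e>0. \<exists>f\<in>D. hnorm H (g - f) < e)"

definition complex_hilbert :: "complex hilbert" where
  "complex_hilbert = \<lparr>hcarrier = UNIV, hinner = (\<lambda>z w. z * cnj w)\<rparr>"

definition ell2 :: "'i set \<Rightarrow> ('i \<Rightarrow> complex) hilbert" where
  "ell2 I = \<lparr>hcarrier = {v. (\<forall>i. i \<notin> I \<longrightarrow> v i = 0) \<and> (\<lambda>i. (cmod (v i))\<^sup>2) summable_on I},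
             hinner = (\<lambda>v w. \<Sum>\<^sub>\<infinity>i\<in>I. v i * cnj (w i))\<rparr>"

definition hsum :: "'v hilbert \<Rightarrow> 'w hilbert \<Rightarrow> ('v \<times> 'w) hilbert" where
  "hsum H K = \<lparr>hcarrier = hcarrier H \<times> hcarrier K,
               hinner = (\<lambda>p q. hinner H (fst p) (fst q) + hinner K (snd p) (snd q))\<rparr>"

definition bounded_op ::
    "'v::complex_vector hilbert \<Rightarrow> 'w::complex_vector hilbert \<Rightarrow> ('v \<Rightarrow> 'w) \<Rightarrow> bool" where
  "bounded_op H K T \<longleftrightarrow>
     (\<forall>f\<in>hcarrier H. T f \<in> hcarrier K) \<and>
     (\<forall>f\<in>hcarrier H. \<forall>g\<in>hcarrier H. T (f + g) = T f + T g) \<and>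
     (\<forall>c. \<forall>f\<in>hcarrier H. T (c *\<^sub>C f) = c *\<^sub>C T f) \<and>
     (\<exists>C. \<forall>f\<in>hcarrier H. hnorm K (T f) \<le> C * hnorm H f)"

definition invertible_op ::
    "'v::complex_vector hilbert \<Rightarrow> 'w::complex_vector hilbert \<Rightarrow> ('v \<Rightarrow> 'w) \<Rightarrow> bool" where
  "invertible_op H K W \<longleftrightarrow>
     bounded_op H K W \<and> bij_betw W (hcarrier H) (hcarrier K) \<and>
     bounded_op K H (inv_into (hcarrier H) W)"

definition hadjoint :: "'v hilbert \<Rightarrow> 'w hilbert \<Rightarrow> ('v \<Rightarrow> 'w) \<Rightarrow> 'w \<Rightarrow> 'v" where
  "hadjoint H K T g =
     (THE g'. g' \<in> hcarrier H \<and> (\<forall>f\<in>hcarrier H. hinner K (T f) g = hinner H f g'))"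

definition ker_perp :: "'v hilbert \<Rightarrow> ('v \<Rightarrow> 'w::zero) \<Rightarrow> 'v set" where
  "ker_perp H T = {f \<in> hcarrier H. \<forall>g\<in>hcarrier H. T g = 0 \<longrightarrow> hinner H f g = 0}"

definition partial_isometry ::
    "'v::complex_vector hilbert \<Rightarrow> 'w::complex_vector hilbert \<Rightarrow> ('v \<Rightarrow> 'w) \<Rightarrow> bool" where
  "partial_isometry H K V \<longleftrightarrow> bounded_op H K V \<and> (\<forall>f\<in>ker_perp H V. hnorm K (V f) = hnorm H f)"


section \<open>Reproducing kernel Hilbert spaces\<close>

text \<open>\<open>rkhs E K H\<close>: \<open>H\<close> is the Hilbert space of \<open>E\<close>-valued functions whose reproducing kernel is the
  operator-valued kernel \<open>K x y : E \<rightarrow> E\<close>. The space is determined by \<open>K\<close>, up to the meaningless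
  values of \<open>hinner H\<close> off the carrier.\<close>

definition rkhs :: "'e::complex_vector hilbert \<Rightarrow> ('x \<Rightarrow> 'x \<Rightarrow> 'e \<Rightarrow> 'e) \<Rightarrow> ('x \<Rightarrow> 'e) hilbert \<Rightarrow> bool" where
  "rkhs E K H \<longleftrightarrow>
     hilbert_space H \<and>
     (\<forall>F\<in>hcarrier H. \<forall>x. F x \<in> hcarrier E) \<and>
     (\<forall>y. \<forall>e\<in>hcarrier E. (\<lambda>x. K x y e) \<in> hcarrier H \<and>
        (\<forall>F\<in>hcarrier H. hinner H F (\<lambda>x. K x y e) = hinner E (F y) e))"

definition scalar_rkhs :: "('x \<Rightarrow> 'x \<Rightarrow> complex) \<Rightarrow> ('x \<Rightarrow> complex) hilbert \<Rightarrow> bool" where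
  "scalar_rkhs k H \<longleftrightarrow> rkhs complex_hilbert (\<lambda>x y c. k x y * c) H"

text \<open>The space \<open>H \<otimes> E\<close>, where \<open>k\<close> is the kernel of \<open>H\<close>.\<close>

definition tensor_rkhs ::
    "('x \<Rightarrow> 'x \<Rightarrow> complex) \<Rightarrow> 'e::complex_vector hilbert \<Rightarrow> ('x \<Rightarrow> 'e) hilbert \<Rightarrow> bool" where
  "tensor_rkhs k E HE \<longleftrightarrow> rkhs E (\<lambda>x y e. k x y *\<^sub>C e) HE"

definition cnp_map :: "'i set \<Rightarrow> ('x \<Rightarrow> 'i \<Rightarrow> complex) \<Rightarrow> bool" where
  "cnp_map I u \<longleftrightarrow> inj u \<and> (\<forall>x. u x \<in> hcarrier (ell2 I) \<and> hnorm (ell2 I) (u x) < 1)"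

definition cnp_kernel :: "'i set \<Rightarrow> ('x \<Rightarrow> 'i \<Rightarrow> complex) \<Rightarrow> 'x \<Rightarrow> 'x \<Rightarrow> complex" where
  "cnp_kernel I u x y = 1 / (1 - hinner (ell2 I) (u x) (u y))"


section \<open>Multipliers\<close>

definition mult_op :: "('x \<Rightarrow> complex) \<Rightarrow> ('x \<Rightarrow> complex) \<Rightarrow> 'x \<Rightarrow> complex" where
  "mult_op \<phi> f = (\<lambda>x. \<phi> x * f x)"

definition Mult :: "('x \<Rightarrow> complex) hilbert \<Rightarrow> ('x \<Rightarrow> complex) set" where
  "Mult H = {\<phi>. \<forall>f\<in>hcarrier H. mult_op \<phi> f \<in> hcarrier H}"

definition mult_adj :: "('x \<Rightarrow> complex) hilbert \<Rightarrow> ('x \<Rightarrow> complex) \<Rightarrow> ('x \<Rightarrow> complex) \<Rightarrow> 'x \<Rightarrow> complex" where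
  "mult_adj H \<phi> = hadjoint H H (mult_op \<phi>)"

definition mult_dom :: "('x \<Rightarrow> complex) hilbert \<Rightarrow> ('x \<Rightarrow> complex) \<Rightarrow> ('x \<Rightarrow> complex) set" where
  "mult_dom H h = {f \<in> hcarrier H. mult_op h f \<in> hcarrier H}"

definition densely_defined_multiplier :: "('x \<Rightarrow> complex) hilbert \<Rightarrow> ('x \<Rightarrow> complex) \<Rightarrow> bool" where
  "densely_defined_multiplier H h \<longleftrightarrow> hdense H (mult_dom H h)"

definition mult_graph ::
    "('x \<Rightarrow> complex) hilbert \<Rightarrow> ('x \<Rightarrow> complex) \<Rightarrow> (('x \<Rightarrow> complex) \<times> ('x \<Rightarrow> complex)) set" where
  "mult_graph H h = (\<lambda>f. (f, mult_op h f)) ` mult_dom H h"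

definition outer_mult :: "('x \<Rightarrow> complex) hilbert \<Rightarrow> ('x \<Rightarrow> complex) \<Rightarrow> bool" where
  "outer_mult H a \<longleftrightarrow> hdense H (mult_op a ` hcarrier H)"

definition corona_pair :: "('x \<Rightarrow> complex) hilbert \<Rightarrow> ('x \<Rightarrow> complex) \<Rightarrow> ('x \<Rightarrow> complex) \<Rightarrow> bool" where
  "corona_pair H a b \<longleftrightarrow>
     a \<in> Mult H \<and> b \<in> Mult H \<and> (\<exists>u\<in>Mult H. \<exists>v\<in>Mult H. \<forall>x. a x * u x + b x * v x = 1)"

text \<open>Both multipliers of a representing pair are nonzero, except that \<open>b = a h\<close> is of course allowed
  to vanish in the degenerate case \<open>h = 0\<close>, so that \<open>h = 0\<close> has the representing pair \<open>(1, 0)\<close>.\<close>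

definition representing_pair ::
    "('x \<Rightarrow> complex) hilbert \<Rightarrow> ('x \<Rightarrow> complex) \<Rightarrow> ('x \<Rightarrow> complex) \<Rightarrow> ('x \<Rightarrow> complex) \<Rightarrow> bool" where
  "representing_pair H h a b \<longleftrightarrow>
     a \<in> Mult H \<and> b \<in> Mult H \<and> a \<noteq> 0 \<and> (h \<noteq> 0 \<longrightarrow> b \<noteq> 0) \<and>
     (\<forall>x. b x = a x * h x) \<and>
     (\<forall>f\<in>hcarrier H. hnorm (hsum H H) (mult_op a f, mult_op b f) \<le> hnorm H f)"

text \<open>The space \<open>M(a\<^sup>*)\<close>: the range of the adjoint of \<open>M\<^sub>a\<close>, with the norm transported from the
  orthogonal complement of its kernel.\<close>

definition adj_range_space :: "('x \<Rightarrow> complex) hilbert \<Rightarrow> ('x \<Rightarrow> complex) \<Rightarrow> ('x \<Rightarrow> complex) hilbert" where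
  "adj_range_space H a =
     (let lift = (\<lambda>f. THE g. g \<in> ker_perp H (mult_adj H a) \<and> mult_adj H a g = f)
      in \<lparr>hcarrier = mult_adj H a ` hcarrier H,
          hinner = (\<lambda>f f'. hinner H (lift f) (lift f'))\<rparr>)"


section \<open>Beurling pairs\<close>

definition beurling_pair ::
    "('x \<Rightarrow> complex) hilbert \<Rightarrow> 'e::complex_vector hilbert \<Rightarrow> ('x \<Rightarrow> 'e) hilbert \<Rightarrow> ('x \<Rightarrow> complex) \<Rightarrow>
     ('x \<Rightarrow> 'e \<Rightarrow> complex) \<Rightarrow> ('x \<Rightarrow> 'e \<Rightarrow> complex) \<Rightarrow> bool" where
  "beurling_pair H E HE h A B \<longleftrightarrow>
     (\<forall>x. bounded_op E complex_hilbert (A x) \<and> bounded_op E complex_hilbert (B x)) \<and>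
     (let V = (\<lambda>F. ((\<lambda>x. A x (F x)), (\<lambda>x. B x (F x))))
      in partial_isometry HE (hsum H H) V \<and> V ` hcarrier HE = mult_graph H h)"

text \<open>The kernel \<open>(1 - B(x) B(y)\<^sup>*) k(x,y)\<close> of \<open>H(B)\<close>; the operator \<open>B(x) B(y)\<^sup>*\<close> on the complex
  numbers is identified with its value at \<open>1\<close>.\<close>

definition HB_kernel ::
    "'e hilbert \<Rightarrow> ('x \<Rightarrow> 'x \<Rightarrow> complex) \<Rightarrow> ('x \<Rightarrow> 'e \<Rightarrow> complex) \<Rightarrow> 'x \<Rightarrow> 'x \<Rightarrow> complex" where
  "HB_kernel E k B x y = (1 - B x (hadjoint E complex_hilbert (B y) 1)) * k x y"

end

(*
  A map W as in (1) permutes the joint eigenspaces of the adjoints M_phi^*.  In a CNP space these are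
  spanned by the kernel functions, so W is M_a^* for a multiplier a; since H(B) is the domain of T^*
  with the graph norm, T^* W is bounded and equals M_b^* with b = a h.  This gives (2), and (2) gives
  (1) with W = M_a^*, whose inverse is bounded because it has a formal adjoint on the dense range of
  M_a.  As T^* M_a^* = M_b^*, boundedness of that inverse says M_a M_a^* + M_b M_b^* >= delta^2, which by
  the Toeplitz corona theorem for CNP spaces is the corona condition (3).  The latter is a Pick
  interpolation problem for columns: by Zorn's lemma it suffices to prescribe one more value, and there
  a Hilbert space extension argument applies because compressing k to the complement of k_z multiplies
  it by a positive kernel.  Conversely, if a u + b v = 1, then g = M_a^* (M_u^* g + M_v^* T^* g) on the
  domain of T^*, so this domain is the range of M_a^*.
*)
theory Submission
  imports Defs
begin

section \<open>Semi-inner product spaces and Hilbert spaces\<close>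

text \<open>Pick kernels are only semidefinite, so the extension argument meets null vectors. It
  therefore runs on finitely supported weights, without quotient or completion: a minimising
  sequence inside the subspace stands for the representing vector, and limits of inner products
  stand for its values. A column has two unknown entries at each point. To keep every extension
  scalar, the data prescribe one linear functional \<open>(c, d)\<close> of the column at a time.
  Linearity in \<open>(c, d)\<close> is never imposed: a violation would produce a vector of
  negative square. A maximal set of data takes the place of weak compactness of the unit ball of
  multipliers. The positive factor in the compression of \<open>k\<close> is the Gram kernel of the
  automorphism of the ball that interchanges \<open>u z\<close> and 0, which is why
  \<open>defect z\<close> enters. That \<open>H(B)\<close> is the domain of the adjoint is proved
  through kernels. If \<open>V\<close> is the partial isometry of the Beurling pair,
  \<open>V V*\<close> projects onto the graph of T; applied to the pair of 0 and the kernel function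
  at \<open>y\<close>, it has second component \<open>B(x) B(y)* k x y\<close>, and the rest of the
  kernel function is the kernel of \<open>H(B)\<close>.\<close>

locale semi_hilbert =
  fixes H :: "'v::complex_vector hilbert"
  assumes subspace: "complex_vector.subspace (hcarrier H)"
    and inner_add_left: "\<lbrakk>f \<in> hcarrier H; g \<in> hcarrier H; l \<in> hcarrier H\<rbrakk>
      \<Longrightarrow> hinner H (f + g) l = hinner H f l + hinner H g l"
    and inner_scale_left: "\<lbrakk>f \<in> hcarrier H; g \<in> hcarrier H\<rbrakk>
      \<Longrightarrow> hinner H (c *\<^sub>C f) g = c * hinner H f g"
    and inner_commute: "\<lbrakk>f \<in> hcarrier H; g \<in> hcarrier H\<rbrakk> \<Longrightarrow> hinner H g f = cnj (hinner H f g)"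
    and inner_nonneg: "f \<in> hcarrier H \<Longrightarrow> 0 \<le> Re (hinner H f f)"
begin

lemma carrier_closed [simp, intro]:
  "0 \<in> hcarrier H"
  "\<lbrakk>f \<in> hcarrier H; g \<in> hcarrier H\<rbrakk> \<Longrightarrow> f + g \<in> hcarrier H"
  "\<lbrakk>f \<in> hcarrier H; g \<in> hcarrier H\<rbrakk> \<Longrightarrow> f - g \<in> hcarrier H"
  "f \<in> hcarrier H \<Longrightarrow> c *\<^sub>C f \<in> hcarrier H"
  "f \<in> hcarrier H \<Longrightarrow> - f \<in> hcarrier H"
  using subspace
  by (auto intro: complex_vector.subspace_0 complex_vector.subspace_add
      complex_vector.subspace_diff complex_vector.subspace_scale complex_vector.subspace_neg)

lemma inner_add_right:
  "\<lbrakk>f \<in> hcarrier H; g \<in> hcarrier H; l \<in> hcarrier H\<rbrakk>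
    \<Longrightarrow> hinner H l (f + g) = hinner H l f + hinner H l g"
  using inner_add_left[of f g l] inner_commute[of l "f + g"] inner_commute[of l f] inner_commute[of l g]
  by (metis carrier_closed(2) complex_cnj_add inner_commute)

lemma inner_scale_right:
  "\<lbrakk>f \<in> hcarrier H; g \<in> hcarrier H\<rbrakk> \<Longrightarrow> hinner H f (c *\<^sub>C g) = cnj c * hinner H f g"
  by (metis carrier_closed(4) complex_cnj_mult inner_commute inner_scale_left)

lemma inner_diff_left:
  "\<lbrakk>f \<in> hcarrier H; g \<in> hcarrier H; l \<in> hcarrier H\<rbrakk>
    \<Longrightarrow> hinner H (f - g) l = hinner H f l - hinner H g l"
  using inner_add_left[of "f - g" g l] by simp

lemma inner_diff_right:
  "\<lbrakk>f \<in> hcarrier H; g \<in> hcarrier H; l \<in> hcarrier H\<rbrakk>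
    \<Longrightarrow> hinner H l (f - g) = hinner H l f - hinner H l g"
  using inner_add_right[of "f - g" g l] by simp

lemma inner_minus_left:
  "\<lbrakk>f \<in> hcarrier H; g \<in> hcarrier H\<rbrakk> \<Longrightarrow> hinner H (- f) g = - hinner H f g"
  using inner_scale_left[of f g "-1"] by (simp add: complex_vector.scale_minus_left scaleC_one)

lemma inner_zero [simp]:
  "f \<in> hcarrier H \<Longrightarrow> hinner H 0 f = 0" "f \<in> hcarrier H \<Longrightarrow> hinner H f 0 = 0"
  using inner_diff_left[of f f f] inner_diff_right[of f f f] by simp_all

lemma inner_sum_left:
  "\<lbrakk>\<And>i. i \<in> A \<Longrightarrow> f i \<in> hcarrier H; g \<in> hcarrier H\<rbrakk>
    \<Longrightarrow> sum f A \<in> hcarrier H \<and> hinner H (sum f A) g = (\<Sum>i\<in>A. hinner H (f i) g)"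
  by (induction A rule: infinite_finite_induct) (auto simp: inner_add_left)

lemma inner_sum_right:
  "\<lbrakk>\<And>i. i \<in> A \<Longrightarrow> f i \<in> hcarrier H; g \<in> hcarrier H\<rbrakk>
    \<Longrightarrow> hinner H g (sum f A) = (\<Sum>i\<in>A. hinner H g (f i))"
  by (induction A rule: infinite_finite_induct)
    (auto simp: inner_add_right inner_sum_left)

lemmas inner_simps =
  inner_add_left inner_add_right inner_diff_left inner_diff_right
  inner_scale_left inner_scale_right inner_minus_left

lemma norm_nonneg [simp]: "f \<in> hcarrier H \<Longrightarrow> 0 \<le> hnorm H f"
  by (simp add: hnorm_def inner_nonneg)

lemma norm_sq: "f \<in> hcarrier H \<Longrightarrow> (hnorm H f)\<^sup>2 = Re (hinner H f f)"
  by (simp add: hnorm_def inner_nonneg)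

lemma inner_self: "f \<in> hcarrier H \<Longrightarrow> hinner H f f = complex_of_real ((hnorm H f)\<^sup>2)"
  using inner_commute[of f f] by (simp add: norm_sq complex_eq_iff)

lemma norm_zero [simp]: "hnorm H 0 = 0"
  by (simp add: hnorm_def)

lemma norm_scale: "f \<in> hcarrier H \<Longrightarrow> hnorm H (c *\<^sub>C f) = cmod c * hnorm H f"
proof -
  assume f: "f \<in> hcarrier H"
  have "(hnorm H (c *\<^sub>C f))\<^sup>2 = Re ((c * cnj c) * hinner H f f)"
    using f by (simp add: norm_sq inner_simps mult_ac)
  also have "\<dots> = (cmod c * hnorm H f)\<^sup>2"
    unfolding complex_norm_square[symmetric] using f
    by (simp add: norm_sq power_mult_distrib flip: of_real_power)
  finally show ?thesis
    using f by (simp add: power2_eq_iff_nonneg)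
qed

lemma norm_sq_diff:
  "\<lbrakk>f \<in> hcarrier H; g \<in> hcarrier H\<rbrakk> \<Longrightarrow>
    (hnorm H (f - g))\<^sup>2 = (hnorm H f)\<^sup>2 - 2 * Re (hinner H f g) + (hnorm H g)\<^sup>2"
  using inner_commute[of f g] by (simp add: norm_sq inner_simps)

lemma norm_sq_add:
  "\<lbrakk>f \<in> hcarrier H; g \<in> hcarrier H\<rbrakk> \<Longrightarrow>
    (hnorm H (f + g))\<^sup>2 = (hnorm H f)\<^sup>2 + 2 * Re (hinner H f g) + (hnorm H g)\<^sup>2"
  using inner_commute[of f g] by (simp add: norm_sq inner_simps)

lemma Cauchy_Schwarz:
  assumes f: "f \<in> hcarrier H" and g: "g \<in> hcarrier H"
  shows "cmod (hinner H f g) \<le> hnorm H f * hnorm H g"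
proof -
  define z where "z = hinner H f g"
  \<comment> \<open>Weighting the direction by \<open>z\<close> itself turns the cross term into a
    multiple of \<open>(cmod z)\<^sup>2\<close>, so only a real parameter remains to be
    chosen.\<close>
  have *: "0 \<le> (hnorm H f)\<^sup>2 - 2 * r * (cmod z)\<^sup>2 + r\<^sup>2 * (cmod z)\<^sup>2 * (hnorm H g)\<^sup>2" for r :: real
  proof -
    have "0 \<le> (hnorm H (f - (of_real r * z) *\<^sub>C g))\<^sup>2" by simp
    also have "\<dots> = (hnorm H f)\<^sup>2 - 2 * Re (cnj (of_real r * z) * z)
        + (cmod (of_real r * z) * hnorm H g)\<^sup>2"
      using f g by (simp add: norm_sq_diff inner_simps norm_scale z_def)
    also have "Re (cnj (of_real r * z) * z) = r * (cmod z)\<^sup>2"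
      unfolding cmod_power2 by (simp add: power2_eq_square algebra_simps)
    finally show ?thesis by (simp add: norm_mult power_mult_distrib)
  qed
  show ?thesis
  proof (cases "hnorm H g = 0")
    case True
    have "z = 0"
    proof (rule ccontr)
      assume "z \<noteq> 0"
      then have "(cmod z)\<^sup>2 > 0" by simp
      \<comment> \<open>\<open>g\<close> may be a nonzero null vector; the quadratic is then linear
        in \<open>r\<close>, and this \<open>r\<close> makes it equal to -1.\<close>
      with *[of "((hnorm H f)\<^sup>2 + 1) / (2 * (cmod z)\<^sup>2)"] True show False
        by (simp add: field_simps)
    qed
    then show ?thesis using f g z_def by simp
  next
    case False
    then have b: "(hnorm H g)\<^sup>2 > 0" by simp
    define B where "B = (hnorm H g)\<^sup>2"
    have "0 \<le> (hnorm H f)\<^sup>2 - (cmod z)\<^sup>2 / B"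
      using *[of "1 / B"] b unfolding B_def[symmetric] by (simp add: power2_eq_square)
    then have "(cmod z)\<^sup>2 \<le> (hnorm H f * hnorm H g)\<^sup>2"
      using b by (simp add: field_simps power_mult_distrib B_def)
    then show ?thesis
      unfolding z_def using f g by (auto intro: power2_le_imp_le)
  qed
qed

lemma norm_triangle:
  assumes f: "f \<in> hcarrier H" and g: "g \<in> hcarrier H"
  shows "hnorm H (f + g) \<le> hnorm H f + hnorm H g"
proof (rule power2_le_imp_le)
  have "Re (hinner H f g) \<le> hnorm H f * hnorm H g"
    using Cauchy_Schwarz[OF f g] complex_Re_le_cmod order_trans by blast
  then show "(hnorm H (f + g))\<^sup>2 \<le> (hnorm H f + hnorm H g)\<^sup>2"
    using f g by (simp add: norm_sq_add power2_sum)
qed (use f g in simp)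

lemma norm_minus_commute:
  "\<lbrakk>f \<in> hcarrier H; g \<in> hcarrier H\<rbrakk> \<Longrightarrow> hnorm H (f - g) = hnorm H (g - f)"
  using norm_scale[of "f - g" "-1"] by (simp add: complex_vector.scale_minus_left scaleC_one)

lemma norm_diff_le:
  assumes "f \<in> hcarrier H" "g \<in> hcarrier H"
  shows "\<bar>hnorm H f - hnorm H g\<bar> \<le> hnorm H (f - g)"
  using norm_triangle[of "f - g" g] norm_triangle[of "g - f" f] norm_minus_commute[of f g] assms
  by auto

section \<open>Representation of bounded functionals without completeness\<close>

text \<open>The approximate representers form a minimising sequence of \<open>\<parallel>w\<parallel>\<^sup>2 - 2 Re (l w)\<close>, which is Cauchy by
  the parallelogram law. Since they lie in \<open>M\<close>, the limit functional extends \<open>l\<close> to the whole space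
  with the same bound.\<close>

lemma riesz_approx:
  assumes M: "complex_vector.subspace M" "M \<subseteq> hcarrier H"
    and ladd: "\<And>x y. \<lbrakk>x \<in> M; y \<in> M\<rbrakk> \<Longrightarrow> l (x + y) = l x + l y"
    and lscale: "\<And>c x. x \<in> M \<Longrightarrow> l (c *\<^sub>C x) = c * l x"
    and bound: "\<And>x. x \<in> M \<Longrightarrow> cmod (l x) \<le> c * hnorm H x"
    and c: "0 \<le> c"
  obtains g :: "nat \<Rightarrow> 'v"
  where "\<And>n. g n \<in> M"
    and "\<forall>e>0. \<exists>N. \<forall>m\<ge>N. \<forall>n\<ge>N. hnorm H (g m - g n) < e"
    and "\<And>x. x \<in> M \<Longrightarrow> (\<lambda>n. hinner H x (g n)) \<longlonglongrightarrow> l x"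
    and "\<And>x. x \<in> hcarrier H \<Longrightarrow> \<exists>L. (\<lambda>n. hinner H x (g n)) \<longlonglongrightarrow> L \<and> cmod L \<le> c * hnorm H x"
proof -
  have Mc [simp]: "x \<in> M \<Longrightarrow> y \<in> M \<Longrightarrow> x + y \<in> M" "x \<in> M \<Longrightarrow> a *\<^sub>C x \<in> M" for x y a
    using M(1) by (auto intro: complex_vector.subspace_add complex_vector.subspace_scale)
  have MH [simp]: "x \<in> hcarrier H" if "x \<in> M" for x using M(2) that by auto
  define J where "J w = (hnorm H w)\<^sup>2 - 2 * Re (l w)" for w
  have J_ge: "- (c\<^sup>2) \<le> J w" if w: "w \<in> M" for w
  proof -
    have "Re (l w) \<le> c * hnorm H w"
      using bound[OF w] complex_Re_le_cmod order_trans by blast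
    moreover have "0 \<le> (hnorm H w - c)\<^sup>2" by simp
    ultimately show ?thesis unfolding J_def by (simp add: power2_diff algebra_simps)
  qed
  define i where "i = Inf (J ` M)"
  have bdd: "bdd_below (J ` M)" using J_ge by (auto intro!: bdd_belowI)
  have i_le: "i \<le> J w" if "w \<in> M" for w
    unfolding i_def using bdd that by (auto intro: cINF_lower)
  have ne: "M \<noteq> {}" using M(1) complex_vector.subspace_0 by auto
  have "\<exists>w\<in>M. J w < i + 1 / real (Suc n)" for n
    using cINF_less_iff[OF ne bdd, of "i + 1 / real (Suc n)"] unfolding i_def by auto
  then obtain g where g: "\<And>n. g n \<in> M" and Jg: "\<And>n. J (g n) < i + 1 / real (Suc n)"
    by metis
  \<comment> \<open>Parallelogram law with the midpoint \<open>y\<close>, at which \<open>J\<close>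
    is at least the infimum.\<close>
  have par: "(hnorm H (g m - g n))\<^sup>2 \<le> 2 / real (Suc m) + 2 / real (Suc n)" for m n
  proof -
    define y where "y = (1/2) *\<^sub>C (g m + g n)"
    have y: "y \<in> M" using g by (simp add: y_def)
    have "(hnorm H y)\<^sup>2 = (hnorm H (g m + g n))\<^sup>2 / 4"
      using g by (simp add: y_def norm_scale power_mult_distrib norm_divide power_divide)
    moreover have "Re (l y) = (Re (l (g m)) + Re (l (g n))) / 2"
      using g by (simp add: y_def lscale ladd)
    ultimately have "(hnorm H (g m - g n))\<^sup>2 = 2 * J (g m) + 2 * J (g n) - 4 * J y"
      using g unfolding J_def by (simp add: norm_sq_diff norm_sq_add algebra_simps)
    then show ?thesis using Jg[of m] Jg[of n] i_le[OF y] by simp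
  qed
  have small: "\<exists>N. \<forall>m\<ge>N. \<forall>n\<ge>N. 2 / real (Suc m) + 2 / real (Suc n) < e" if "e > 0" for e :: real
  proof -
    obtain N where N: "4 / e < real N" using reals_Archimedean2 by blast
    have "2 / real (Suc m) + 2 / real (Suc n) < e" if "m \<ge> N" "n \<ge> N" for m n
    proof -
      have "2 / real (Suc m) < e / 2" if "m \<ge> N" for m
      proof -
        have "4 / e < real (Suc m)" using N that by linarith
        then show ?thesis using \<open>e > 0\<close> by (simp add: field_simps)
      qed
      from this[OF that(1)] this[OF that(2)] show ?thesis by simp
    qed
    then show ?thesis by blast
  qed
  have cauchy: "\<forall>e>0. \<exists>N. \<forall>m\<ge>N. \<forall>n\<ge>N. hnorm H (g m - g n) < e"
  proof (intro allI impI)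
    fix e :: real assume e: "e > 0"
    obtain N where N: "\<forall>m\<ge>N. \<forall>n\<ge>N. 2 / real (Suc m) + 2 / real (Suc n) < e\<^sup>2"
      using small[of "e\<^sup>2"] e by auto
    have "hnorm H (g m - g n) < e" if "m \<ge> N" "n \<ge> N" for m n
      using par[of m n] N that e by (intro power2_less_imp_less[of _ e]) (auto intro: le_less_trans)
    then show "\<exists>N. \<forall>m\<ge>N. \<forall>n\<ge>N. hnorm H (g m - g n) < e" by blast
  qed
  have err: "(cmod (hinner H x (g n) - l x))\<^sup>2 \<le> (1 + (hnorm H x)\<^sup>2) / real (Suc n)"
    if x: "x \<in> M" for x n
  proof -
    define e where "e = hinner H x (g n) - l x"
    \<comment> \<open>The best step length would be the inverse of
      \<open>(hnorm H x)\<^sup>2\<close>; the summand 1 admits null vectors, and only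
      \<open>t * (hnorm H x)\<^sup>2 \<le> 1\<close> matters.\<close>
    define t where "t = 1 / (1 + (hnorm H x)\<^sup>2)"
    have t: "t > 0" "t * (hnorm H x)\<^sup>2 \<le> 1" unfolding t_def by (auto simp: add_pos_nonneg divide_le_eq_1)
    define s where "s = - of_real t * cnj e"
    have "i \<le> J (g n + s *\<^sub>C x)" using g x by (intro i_le) simp
    also have "J (g n + s *\<^sub>C x) = J (g n) + 2 * Re (s * e) + (cmod s)\<^sup>2 * (hnorm H x)\<^sup>2"
      unfolding J_def e_def using g x inner_commute[of x "g n"]
      by (simp add: norm_sq_add inner_simps ladd lscale norm_scale power_mult_distrib algebra_simps)
    also have "Re (s * e) = - t * (cmod e)\<^sup>2"
      unfolding s_def cmod_power2 by (simp add: power2_eq_square algebra_simps)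
    also have "(cmod s)\<^sup>2 = t\<^sup>2 * (cmod e)\<^sup>2"
      unfolding s_def using t by (simp add: norm_mult power_mult_distrib)
    finally have "0 \<le> 1 / real (Suc n) - 2 * t * (cmod e)\<^sup>2 + t\<^sup>2 * (cmod e)\<^sup>2 * (hnorm H x)\<^sup>2"
      using Jg[of n] by simp
    moreover have "t\<^sup>2 * (cmod e)\<^sup>2 * (hnorm H x)\<^sup>2 \<le> t * (cmod e)\<^sup>2"
    proof -
      have "t\<^sup>2 * (cmod e)\<^sup>2 * (hnorm H x)\<^sup>2 = (t * (cmod e)\<^sup>2) * (t * (hnorm H x)\<^sup>2)"
        by (simp add: power2_eq_square)
      also have "\<dots> \<le> (t * (cmod e)\<^sup>2) * 1" using t by (intro mult_left_mono) auto
      finally show ?thesis by simp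
    qed
    ultimately have "t * (cmod e)\<^sup>2 \<le> 1 / real (Suc n)" by simp
    then have "(cmod e)\<^sup>2 \<le> 1 / real (Suc n) / t"
      using t(1) by (subst pos_le_divide_eq) (simp_all only: mult.commute)
    then show ?thesis unfolding e_def t_def by simp
  qed
  have lim: "(\<lambda>n. hinner H x (g n)) \<longlonglongrightarrow> l x" if x: "x \<in> M" for x
  proof -
    have "(\<lambda>n. (1 + (hnorm H x)\<^sup>2) * inverse (real (Suc n))) \<longlonglongrightarrow> (1 + (hnorm H x)\<^sup>2) * 0"
      by (intro tendsto_intros LIMSEQ_inverse_real_of_nat)
    then have "(\<lambda>n. (1 + (hnorm H x)\<^sup>2) / real (Suc n)) \<longlonglongrightarrow> 0"
      by (simp add: divide_inverse)
    then have "(\<lambda>n. (cmod (hinner H x (g n) - l x))\<^sup>2) \<longlonglongrightarrow> 0"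
      by (rule Lim_null_comparison[rotated]) (use err[OF x] in simp)
    then have "(\<lambda>n. sqrt ((cmod (hinner H x (g n) - l x))\<^sup>2)) \<longlonglongrightarrow> sqrt 0"
      by (rule tendsto_real_sqrt)
    then show ?thesis by (simp add: tendsto_norm_zero_iff LIM_zero_iff)
  qed
  have "Cauchy (\<lambda>n. hnorm H (g n))"
  proof (rule metric_CauchyI)
    fix e :: real assume "e > 0"
    with cauchy obtain N where "\<forall>m\<ge>N. \<forall>n\<ge>N. hnorm H (g m - g n) < e" by blast
    then show "\<exists>N. \<forall>m\<ge>N. \<forall>n\<ge>N. dist (hnorm H (g m)) (hnorm H (g n)) < e"
      unfolding dist_real_def by (meson MH g le_less_trans norm_diff_le)
  qed
  then obtain r where r: "(\<lambda>n. hnorm H (g n)) \<longlonglongrightarrow> r"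
    using Cauchy_convergent convergent_def by blast
  have r0: "0 \<le> r" using g by (intro LIMSEQ_le_const[OF r]) auto
  \<comment> \<open>Along the sequence the squared norm of \<open>g n\<close> is almost
    \<open>l (g n)\<close>, hence almost at most \<open>c * hnorm H (g n)\<close>. In the limit this
    bounds \<open>r\<close> by \<open>c\<close>, so the extended functional keeps the constant
    \<open>c\<close>.\<close>
  have rc: "r \<le> c"
  proof -
    have bd: "(hnorm H (g n))\<^sup>2 \<le> c * hnorm H (g n) + sqrt ((1 + (hnorm H (g n))\<^sup>2) * inverse (real (Suc n)))"
      for n
    proof -
      have "(hnorm H (g n))\<^sup>2 = cmod (hinner H (g n) (g n))" using g by (simp add: inner_self norm_power)
      also have "\<dots> \<le> cmod (l (g n)) + cmod (hinner H (g n) (g n) - l (g n))"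
        by (metis add.commute diff_add_cancel norm_triangle_ineq)
      also have "cmod (hinner H (g n) (g n) - l (g n)) \<le> sqrt ((1 + (hnorm H (g n))\<^sup>2) * inverse (real (Suc n)))"
        using err[OF g, of n n] by (intro real_le_rsqrt) (simp add: divide_inverse)
      finally show ?thesis using bound[OF g, of n] by simp
    qed
    have "(\<lambda>n. c * hnorm H (g n) + sqrt ((1 + (hnorm H (g n))\<^sup>2) * inverse (real (Suc n))))
        \<longlonglongrightarrow> c * r + sqrt ((1 + r\<^sup>2) * 0)"
      by (intro tendsto_intros r LIMSEQ_inverse_real_of_nat)
    then have "r\<^sup>2 \<le> c * r + sqrt ((1 + r\<^sup>2) * 0)"
      by (rule LIMSEQ_le[OF tendsto_power[OF r]]) (use bd in blast)
    then have "r * r \<le> c * r" by (simp add: power2_eq_square)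
    then show ?thesis using r0 c by (cases "r = 0") auto
  qed
  have ext: "\<exists>L. (\<lambda>n. hinner H x (g n)) \<longlonglongrightarrow> L \<and> cmod L \<le> c * hnorm H x" if x: "x \<in> hcarrier H" for x
  proof -
    have "Cauchy (\<lambda>n. hinner H x (g n))"
    proof (rule metric_CauchyI)
      fix e :: real assume e: "e > 0"
      have p: "hnorm H x + 1 > 0" using x by (simp add: add_nonneg_pos)
      with cauchy e obtain N where N: "\<forall>m\<ge>N. \<forall>n\<ge>N. hnorm H (g m - g n) < e / (hnorm H x + 1)"
        by (meson divide_pos_pos)
      have "dist (hinner H x (g m)) (hinner H x (g n)) < e" if mn: "m \<ge> N" "n \<ge> N" for m n
      proof -
        have "dist (hinner H x (g m)) (hinner H x (g n)) = cmod (hinner H x (g m - g n))"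
          using x g by (simp add: inner_simps dist_norm)
        also have "\<dots> \<le> hnorm H x * hnorm H (g m - g n)"
          using x g by (intro Cauchy_Schwarz) auto
        also have "\<dots> \<le> (hnorm H x + 1) * hnorm H (g m - g n)"
          using g by (intro mult_right_mono) auto
        also have "\<dots> < e"
          using N mn p by (simp add: field_simps)
        finally show ?thesis .
      qed
      then show "\<exists>N. \<forall>m\<ge>N. \<forall>n\<ge>N. dist (hinner H x (g m)) (hinner H x (g n)) < e" by blast
    qed
    then obtain L where L: "(\<lambda>n. hinner H x (g n)) \<longlonglongrightarrow> L"
      using Cauchy_convergent convergent_def by blast
    have "cmod L \<le> hnorm H x * r"
      by (rule LIMSEQ_le[OF tendsto_norm[OF L] tendsto_mult[OF tendsto_const r]])
        (use Cauchy_Schwarz x g in auto)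
    also have "\<dots> \<le> hnorm H x * c" using rc x by (intro mult_left_mono) auto
    finally show ?thesis using L by (auto simp: mult.commute)
  qed
  show thesis by (rule that[OF g cauchy lim ext])
qed

end

section \<open>Complete spaces: representation, density, projection\<close>

locale hilbert = semi_hilbert +
  assumes definite: "\<lbrakk>f \<in> hcarrier H; hinner H f f = 0\<rbrakk> \<Longrightarrow> f = 0"
    and complete: "\<lbrakk>\<And>n. s n \<in> hcarrier H; \<forall>e>0. \<exists>N. \<forall>m\<ge>N. \<forall>n\<ge>N. hnorm H (s m - s n) < e\<rbrakk>
      \<Longrightarrow> \<exists>l\<in>hcarrier H. (\<lambda>n. hnorm H (s n - l)) \<longlonglongrightarrow> 0"

lemma hilbert_space_iff: "hilbert_space H \<longleftrightarrow> hilbert H"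
proof
  assume "hilbert_space H"
  note H = this[unfolded hilbert_space_def]
  note H1 = H[THEN conjunct2] note H2 = H1[THEN conjunct2] note H3 = H2[THEN conjunct2]
  note H4 = H3[THEN conjunct2] note H5 = H4[THEN conjunct2] note H6 = H5[THEN conjunct2]
  show "hilbert H"
    by unfold_locales
      (erule H[THEN conjunct1] H1[THEN conjunct1, rule_format] H2[THEN conjunct1, rule_format]
        H3[THEN conjunct1, rule_format] H4[THEN conjunct1, rule_format]
        H5[THEN conjunct1, rule_format] H6[rule_format, OF conjI] | rule H[THEN conjunct1] H6[rule_format, OF conjI] | assumption | simp)+
next
  assume "hilbert H"
  then interpret hilbert H .
  show "hilbert_space H"
    unfolding hilbert_space_def
    by (intro conjI ballI allI impI; (elim conjE)?;
        (rule subspace inner_add_left inner_scale_left inner_commute inner_nonneg definite complete; blast))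
qed

context hilbert
begin

lemma norm_eq_zero: "f \<in> hcarrier H \<Longrightarrow> hnorm H f = 0 \<longleftrightarrow> f = 0"
  using definite by (auto simp: inner_self)

lemma inner_eqI:
  assumes "f \<in> hcarrier H" "g \<in> hcarrier H" "\<And>x. x \<in> hcarrier H \<Longrightarrow> hinner H x f = hinner H x g"
  shows "f = g"
proof -
  have "hinner H (f - g) (f - g) = 0"
    using assms(1,2) assms(3)[of "f - g"] inner_diff_right[of f g "f - g"] by simp
  then show ?thesis using definite[of "f - g"] assms by simp
qed

lemma inner_tendsto:
  assumes "\<And>n. s n \<in> hcarrier H" "l \<in> hcarrier H" "(\<lambda>n. hnorm H (s n - l)) \<longlonglongrightarrow> 0" "x \<in> hcarrier H"
  shows "(\<lambda>n. hinner H x (s n)) \<longlonglongrightarrow> hinner H x l"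
proof -
  have "(\<lambda>n. hinner H x (s n) - hinner H x l) \<longlonglongrightarrow> 0"
  proof (rule Lim_null_comparison)
    show "\<forall>\<^sub>F n in sequentially. cmod (hinner H x (s n) - hinner H x l) \<le> hnorm H x * hnorm H (s n - l)"
      by (intro always_eventually allI, subst inner_diff_right[symmetric])
        (use assms in \<open>auto intro!: Cauchy_Schwarz\<close>)
    show "(\<lambda>n. hnorm H x * hnorm H (s n - l)) \<longlonglongrightarrow> 0"
      using tendsto_mult[OF tendsto_const assms(3), of "hnorm H x"] by simp
  qed
  then show ?thesis by (simp add: LIM_zero_iff)
qed

text \<open>\<open>M\<close> need not be closed, so the representer \<open>r\<close> is only a limit
  of elements of \<open>M\<close>. The approximating sequence is returned as well because density
  and projection arguments need it.\<close>

lemma riesz_subspace: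
  assumes M: "complex_vector.subspace M" "M \<subseteq> hcarrier H"
    and ladd: "\<And>x y. \<lbrakk>x \<in> M; y \<in> M\<rbrakk> \<Longrightarrow> l (x + y) = l x + l y"
    and lscale: "\<And>c x. x \<in> M \<Longrightarrow> l (c *\<^sub>C x) = c * l x"
    and bound: "\<And>x. x \<in> M \<Longrightarrow> cmod (l x) \<le> c * hnorm H x"
    and c: "0 \<le> c"
  obtains g r where "\<And>n. g n \<in> M" "r \<in> hcarrier H" "(\<lambda>n. hnorm H (g n - r)) \<longlonglongrightarrow> 0"
    "\<And>x. x \<in> M \<Longrightarrow> hinner H x r = l x"
proof -
  obtain g where g: "\<And>n. g n \<in> M" "\<forall>e>0. \<exists>N. \<forall>m\<ge>N. \<forall>n\<ge>N. hnorm H (g m - g n) < e"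
    "\<And>x. x \<in> M \<Longrightarrow> (\<lambda>n. hinner H x (g n)) \<longlonglongrightarrow> l x"
    by (rule riesz_approx[OF M ladd lscale bound c]) blast+
  have gH: "\<And>n. g n \<in> hcarrier H" using g(1) M(2) by auto
  obtain r where r: "r \<in> hcarrier H" "(\<lambda>n. hnorm H (g n - r)) \<longlonglongrightarrow> 0"
    using complete[OF gH g(2)] by blast
  have "hinner H x r = l x" if "x \<in> M" for x
    using LIMSEQ_unique[OF inner_tendsto[OF gH r] g(3)[OF that]] that M(2) by auto
  then show thesis using that g(1) r by blast
qed

lemma riesz:
  assumes ladd: "\<And>x y. \<lbrakk>x \<in> hcarrier H; y \<in> hcarrier H\<rbrakk> \<Longrightarrow> l (x + y) = l x + l y"
    and lscale: "\<And>c x. x \<in> hcarrier H \<Longrightarrow> l (c *\<^sub>C x) = c * l x"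
    and bound: "\<And>x. x \<in> hcarrier H \<Longrightarrow> cmod (l x) \<le> c * hnorm H x"
  shows "\<exists>r\<in>hcarrier H. \<forall>x\<in>hcarrier H. l x = hinner H x r"
proof -
  have "cmod (l x) \<le> \<bar>c\<bar> * hnorm H x" if "x \<in> hcarrier H" for x
    using bound[OF that] that by (smt (verit) mult_right_mono norm_nonneg)
  then show ?thesis
    using riesz_subspace[OF subspace order_refl ladd lscale, of "\<bar>c\<bar>" thesis for thesis]
    by (metis abs_ge_zero)
qed

text \<open>Riesz representation of \<open>x \<mapsto> hinner H x f\<close> restricted to
  \<open>M\<close>: the vector \<open>r\<close> is the orthogonal projection of \<open>f\<close>
  onto the closure of \<open>M\<close>.\<close>

lemma nearest_sequence:
  assumes M: "complex_vector.subspace M" "M \<subseteq> hcarrier H" and f: "f \<in> hcarrier H"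
  obtains g r where "\<And>n. g n \<in> M" "r \<in> hcarrier H" "(\<lambda>n. hnorm H (g n - r)) \<longlonglongrightarrow> 0"
    "\<And>x. x \<in> M \<Longrightarrow> hinner H x r = hinner H x f"
proof (rule riesz_subspace[OF M, of "\<lambda>x. hinner H x f" "hnorm H f"])
  show "cmod (hinner H x f) \<le> hnorm H f * hnorm H x" if "x \<in> M" for x
    using Cauchy_Schwarz[of x f] that M(2) f by (auto simp: mult.commute)
qed (use M(2) f that in \<open>auto simp: inner_add_left inner_scale_left subset_iff\<close>)

text \<open>The projection \<open>r\<close> of \<open>f\<close> onto the closure differs from
  \<open>f\<close> by a vector orthogonal to \<open>M\<close>, hence not at all.\<close>

lemma dense_if_perp_zero:
  assumes M: "complex_vector.subspace M" "M \<subseteq> hcarrier H"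
    and perp: "\<And>f. \<lbrakk>f \<in> hcarrier H; \<And>x. x \<in> M \<Longrightarrow> hinner H x f = 0\<rbrakk> \<Longrightarrow> f = 0"
  shows "hdense H M"
  unfolding hdense_def
proof (intro conjI ballI allI impI)
  fix f and e :: real assume f: "f \<in> hcarrier H" and e: "e > 0"
  obtain g r where g: "\<And>n. g n \<in> M" and r: "r \<in> hcarrier H" "(\<lambda>n. hnorm H (g n - r)) \<longlonglongrightarrow> 0"
    and eq: "\<And>x. x \<in> M \<Longrightarrow> hinner H x r = hinner H x f"
    using nearest_sequence[OF M f] by metis
  have "r - f = 0"
    using f r M(2) eq by (intro perp) (auto simp: inner_diff_right subset_iff)
  with r(2) have "(\<lambda>n. hnorm H (g n - f)) \<longlonglongrightarrow> 0" by simp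
  then obtain n where "\<bar>hnorm H (g n - f)\<bar> < e"
    using e by (auto simp: lim_sequentially dist_real_def)
  then show "\<exists>g\<in>M. hnorm H (f - g) < e"
    using g[of n] M(2) f norm_minus_commute[of f "g n"] by (intro bexI[of _ "g n"]) auto
qed (rule M(2))

lemma dense_perp_zero:
  assumes D: "hdense H D" and f: "f \<in> hcarrier H" and perp: "\<And>x. x \<in> D \<Longrightarrow> hinner H x f = 0"
  shows "f = 0"
proof (rule ccontr)
  assume "f \<noteq> 0"
  then have n: "hnorm H f > 0" using f norm_eq_zero norm_nonneg less_eq_real_def by metis
  then obtain d where d: "d \<in> D" "hnorm H (f - d) < hnorm H f"
    using D f unfolding hdense_def by meson
  have dH: "d \<in> hcarrier H" using D d unfolding hdense_def by auto
  have "(hnorm H f)\<^sup>2 = cmod (hinner H (f - d) f)"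
    using f dH perp[OF d(1)] by (simp add: inner_diff_left inner_self norm_power)
  also have "\<dots> \<le> hnorm H (f - d) * hnorm H f" using f dH by (intro Cauchy_Schwarz) auto
  also have "\<dots> < hnorm H f * hnorm H f" using d n by (intro mult_strict_right_mono)
  finally show False by (simp add: power2_eq_square)
qed

lemma projection:
  assumes M: "complex_vector.subspace M" "M \<subseteq> hcarrier H"
    and closed: "\<And>s l. \<lbrakk>\<And>n. s n \<in> M; l \<in> hcarrier H; (\<lambda>n. hnorm H (s n - l)) \<longlonglongrightarrow> 0\<rbrakk> \<Longrightarrow> l \<in> M"
    and f: "f \<in> hcarrier H"
  obtains r where "r \<in> M" "\<And>x. x \<in> M \<Longrightarrow> hinner H x r = hinner H x f"
proof -
  obtain g r where "\<And>n. g n \<in> M" "r \<in> hcarrier H" "(\<lambda>n. hnorm H (g n - r)) \<longlonglongrightarrow> 0"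
    "\<And>x. x \<in> M \<Longrightarrow> hinner H x r = hinner H x f"
    using nearest_sequence[OF M f] by metis
  then show thesis using that closed by blast
qed

section \<open>Uniform boundedness and automatic continuity\<close>

text \<open>Sokal's gliding hump argument, with steps \<open>3\<^sup>-\<^sup>n\<close> against functionals of norm at least \<open>4\<^sup>n\<close>.\<close>

lemma uniform_boundedness:
  assumes Z: "Z \<subseteq> hcarrier H"
    and pw: "\<And>f. f \<in> hcarrier H \<Longrightarrow> \<exists>c. \<forall>z\<in>Z. cmod (hinner H f z) \<le> c"
  shows "\<exists>C\<ge>0. \<forall>z\<in>Z. hnorm H z \<le> C"
proof (rule ccontr)
  assume no: "\<not> ?thesis"
  have "\<exists>z\<in>Z. hnorm H z \<ge> 4 ^ n" for n
  proof (rule ccontr)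
    assume "\<not> (\<exists>z\<in>Z. hnorm H z \<ge> 4 ^ n)"
    then have "\<forall>z\<in>Z. hnorm H z \<le> 4 ^ n" by auto
    with no show False by (metis zero_le_numeral zero_le_power)
  qed
  then obtain z where z: "\<And>n. z n \<in> Z" and zn: "\<And>n. hnorm H (z n) \<ge> 4 ^ n" by metis
  have zH: "\<And>n. z n \<in> hcarrier H" using z Z by auto
  \<comment> \<open>The values at \<open>x + v\<close> and \<open>x - v\<close> differ by twice the
    value at \<open>v\<close>, so one of them is at least as large as the value at \<open>v\<close>.
    This replaces a category argument.\<close>
  have step: "\<exists>x'. x' \<in> hcarrier H \<and> hnorm H (x' - x) \<le> r \<and> r * hnorm H y \<le> cmod (hinner H x' y)"
    if x: "x \<in> hcarrier H" and y: "y \<in> hcarrier H" "hnorm H y > 0" and r: "r > 0" for x y and r :: real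
  proof -
    define v where "v = of_real (r / hnorm H y) *\<^sub>C y"
    have v: "v \<in> hcarrier H" using y by (simp add: v_def)
    have nv: "hnorm H v = r" using y r by (simp add: v_def norm_scale norm_divide)
    have iv: "hinner H v y = of_real (r * hnorm H y)"
      using y by (simp add: v_def inner_scale_left inner_self power2_eq_square)
    have "2 * (r * hnorm H y) = cmod (hinner H (x + v) y - hinner H (x - v) y)"
      using x y v r iv by (simp add: inner_simps norm_mult flip: of_real_mult)
    also have "\<dots> \<le> cmod (hinner H (x + v) y) + cmod (hinner H (x - v) y)"
      by (rule norm_triangle_ineq4)
    finally consider "r * hnorm H y \<le> cmod (hinner H (x + v) y)" | "r * hnorm H y \<le> cmod (hinner H (x - v) y)"
      by linarith
    then show ?thesis
    proof cases
      case 1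
      then show ?thesis using x v nv by (intro exI[of _ "x + v"]) simp
    next
      case 2
      moreover have "hnorm H (x - v - x) = r"
        using norm_minus_commute[OF v, of 0] x v nv by simp
      ultimately show ?thesis using x v by (intro exI[of _ "x - v"]) simp
    qed
  qed
  have zpos: "hnorm H (z n) > 0" for n using zn[of n] by (smt (verit) zero_less_power)
  define P where "P n x x' \<longleftrightarrow> hnorm H (x' - x) \<le> (1/3) ^ Suc n \<and>
      (1/3) ^ Suc n * hnorm H (z n) \<le> cmod (hinner H x' (z n))" for n x x'
  have "\<exists>x. \<forall>n. x n \<in> hcarrier H \<and> P n (x n) (x (Suc n))"
  proof (rule dependent_nat_choice)
    show "\<exists>x. x \<in> hcarrier H" using carrier_closed(1) by blast
    show "\<exists>y. y \<in> hcarrier H \<and> P n x y" if "x \<in> hcarrier H" for x n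
      unfolding P_def by (rule step[OF that zH zpos]) simp
  qed
  then obtain x where x: "\<And>n. x n \<in> hcarrier H" and xP: "\<And>n. P n (x n) (x (Suc n))" by auto
  have near: "hnorm H (x (n + j) - x n) \<le> ((1/3) ^ n - (1/3) ^ (n + j)) / 2" for n j
  proof (induction j)
    case (Suc j)
    have "hnorm H (x (n + Suc j) - x n) \<le> hnorm H (x (Suc (n + j)) - x (n + j)) + hnorm H (x (n + j) - x n)"
      using norm_triangle[of "x (Suc (n + j)) - x (n + j)" "x (n + j) - x n"] x by simp
    also have "\<dots> \<le> (1/3) ^ Suc (n + j) + ((1/3) ^ n - (1/3) ^ (n + j)) / 2"
      by (rule add_mono[OF xP[of "n + j", unfolded P_def, THEN conjunct1] Suc])
    also have "\<dots> = ((1/3) ^ n - (1/3) ^ (n + Suc j)) / 2" by (simp add: field_simps)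
    finally show ?case .
  qed simp
  have near': "hnorm H (x m - x n) \<le> (1/3) ^ n / 2" if "m \<ge> n" for m n
  proof -
    have "hnorm H (x m - x n) \<le> ((1/3) ^ n - (1/3) ^ m) / 2"
      using near[of n "m - n"] that by simp
    also have "\<dots> \<le> (1/3) ^ n / 2" by simp
    finally show ?thesis .
  qed
  have "\<forall>e>0. \<exists>N. \<forall>m\<ge>N. \<forall>n\<ge>N. hnorm H (x m - x n) < e"
  proof (intro allI impI)
    fix e :: real assume "e > 0"
    then obtain N where N: "(1/3) ^ N < e" using real_arch_pow_inv[of e "1/3"] by auto
    have "hnorm H (x m - x n) < e" if "m \<ge> N" "n \<ge> N" for m n
    proof -
      have "hnorm H (x m - x n) \<le> hnorm H (x m - x N) + hnorm H (x N - x n)"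
        using norm_triangle[of "x m - x N" "x N - x n"] x by simp
      also have "\<dots> \<le> (1/3) ^ N"
        using near'[OF that(1)] near'[OF that(2)] norm_minus_commute[OF x x, of N n] by simp
      finally show ?thesis using N by simp
    qed
    then show "\<exists>N. \<forall>m\<ge>N. \<forall>n\<ge>N. hnorm H (x m - x n) < e" by blast
  qed
  then obtain l where l: "l \<in> hcarrier H" "(\<lambda>n. hnorm H (x n - l)) \<longlonglongrightarrow> 0"
    using complete[of x] x by blast
  have lx: "hnorm H (l - x n) \<le> (1/3) ^ n / 2" for n
  proof -
    have "hnorm H (l - x n) \<le> hnorm H (x m - l) + (1/3) ^ n / 2" if "m \<ge> n" for m
      using norm_triangle[of "l - x m" "x m - x n"] near'[OF that] norm_minus_commute[of l "x m"] l x
      by simp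
    then have "hnorm H (l - x n) \<le> 0 + (1/3) ^ n / 2"
      by (intro LIMSEQ_le_const[OF tendsto_add[OF l(2) tendsto_const]]) auto
    then show ?thesis by simp
  qed
  \<comment> \<open>After the step of length \<open>(1/3) ^ Suc n\<close> the sequence moves by at
    most half that length in total, so half of the lower bound for \<open>z n\<close> survives;
    together with the extra third this is the factor 6.\<close>
  have big: "(4/3) ^ n / 6 \<le> cmod (hinner H l (z n))" for n
  proof -
    have "(1/3) ^ Suc n * hnorm H (z n) \<le> cmod (hinner H (x (Suc n)) (z n))"
      using xP[of n] unfolding P_def by blast
    also have "hinner H (x (Suc n)) (z n) = hinner H l (z n) - hinner H (l - x (Suc n)) (z n)"
      using l x zH by (simp add: inner_diff_left)
    also have "cmod \<dots> \<le> cmod (hinner H l (z n)) + cmod (hinner H (l - x (Suc n)) (z n))"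
      by (rule norm_triangle_ineq4)
    also have "cmod (hinner H (l - x (Suc n)) (z n)) \<le> hnorm H (l - x (Suc n)) * hnorm H (z n)"
      using l x zH by (intro Cauchy_Schwarz) auto
    also have "\<dots> \<le> (1/3) ^ Suc n / 2 * hnorm H (z n)"
      using zH by (intro mult_right_mono lx) auto
    finally have "(1/3) ^ n * hnorm H (z n) / 6 \<le> cmod (hinner H l (z n))"
      by (simp add: field_simps)
    moreover have "(1/3) ^ n * (4::real) ^ n \<le> (1/3) ^ n * hnorm H (z n)"
      by (intro mult_left_mono zn) simp
    ultimately show ?thesis by (simp add: power_divide)
  qed
  obtain c where c: "\<And>n. cmod (hinner H l (z n)) \<le> c" using pw[OF l(1)] z by blast
  obtain n where "6 * c < (4/3::real) ^ n" using real_arch_pow[of "4/3" "6 * c"] by auto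
  with big[of n] c[of n] show False by simp
qed

end

text \<open>This replaces both the closed graph theorem and the bounded inverse theorem.\<close>

lemma bounded_if_adjoint_dense:
  assumes "hilbert K" "hilbert H"
    and T: "\<And>g. g \<in> hcarrier K \<Longrightarrow> T g \<in> hcarrier H"
    and D: "hdense H D"
    and adj: "\<And>d. d \<in> D \<Longrightarrow> \<exists>s\<in>hcarrier K. \<forall>g\<in>hcarrier K. hinner H (T g) d = hinner K g s"
  shows "\<exists>C\<ge>0. \<forall>g\<in>hcarrier K. hnorm H (T g) \<le> C * hnorm K g"
proof -
  interpret K: hilbert K by fact
  interpret H: hilbert H by fact
  have DH: "d \<in> hcarrier H" if "d \<in> D" for d using D that unfolding hdense_def by auto
  obtain S where S: "\<And>d. d \<in> D \<Longrightarrow> S d \<in> hcarrier K"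
    "\<And>d g. \<lbrakk>d \<in> D; g \<in> hcarrier K\<rbrakk> \<Longrightarrow> hinner H (T g) d = hinner K g (S d)"
    using adj by metis
  \<comment> \<open>These are the images of normalised elements of \<open>D\<close> under the formal
    adjoint. If \<open>d\<close> has norm zero the quotient is 0 by convention and contributes the
    zero vector; that case is treated separately in \<open>bd\<close>.\<close>
  define Z where "Z = (\<lambda>d. of_real (1 / hnorm H d) *\<^sub>C S d) ` D"
  have "\<exists>C\<ge>0. \<forall>z\<in>Z. hnorm K z \<le> C"
  proof (rule K.uniform_boundedness)
    show "Z \<subseteq> hcarrier K" using S by (auto simp: Z_def)
    fix f assume f: "f \<in> hcarrier K"
    have "cmod (hinner K f (of_real (1 / hnorm H d) *\<^sub>C S d)) \<le> hnorm H (T f)" if d: "d \<in> D" for d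
    proof -
      have "cmod (hinner K f (of_real (1 / hnorm H d) *\<^sub>C S d)) = cmod (hinner H (T f) d) / hnorm H d"
        using d f S DH by (simp add: K.inner_scale_right norm_mult norm_divide)
      also have "\<dots> \<le> hnorm H (T f) * hnorm H d / hnorm H d"
        using H.Cauchy_Schwarz[OF T[OF f] DH[OF d]] DH[OF d] by (intro divide_right_mono) auto
      also have "\<dots> \<le> hnorm H (T f)" using T f by simp
      finally show ?thesis .
    qed
    then show "\<exists>c. \<forall>z\<in>Z. cmod (hinner K f z) \<le> c" unfolding Z_def by blast
  qed
  then obtain C where C: "C \<ge> 0" "\<And>z. z \<in> Z \<Longrightarrow> hnorm K z \<le> C" by blast
  have bd: "cmod (hinner H (T g) d) \<le> C * hnorm K g * hnorm H d" if g: "g \<in> hcarrier K" and d: "d \<in> D" for g d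
  proof (cases "hnorm H d = 0")
    case True
    then show ?thesis using H.Cauchy_Schwarz[OF T[OF g] DH[OF d]] by simp
  next
    case False
    have "hnorm K (S d) / hnorm H d \<le> C"
      using C(2)[of "of_real (1 / hnorm H d) *\<^sub>C S d"] d S DH by (simp add: Z_def K.norm_scale norm_divide)
    then have "hnorm K (S d) \<le> C * hnorm H d"
      using False DH[OF d] by (simp add: field_simps less_le)
    then have "hnorm K g * hnorm K (S d) \<le> hnorm K g * (C * hnorm H d)"
      using g by (intro mult_left_mono) auto
    then show ?thesis
      using K.Cauchy_Schwarz[OF g S(1)[OF d]] S(2)[OF d g] by (simp add: mult_ac)
  qed
  have "hnorm H (T g) \<le> C * hnorm K g" if g: "g \<in> hcarrier K" for g
  proof -
    \<comment> \<open>The bound is known only when testing against \<open>D\<close>, so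
      \<open>T g\<close> is approximated by some \<open>d\<close> in \<open>D\<close> within
      \<open>e\<close>, and then \<open>e\<close> tends to 0.\<close>
    have le: "(hnorm H (T g))\<^sup>2 \<le> C * hnorm K g * hnorm H (T g) + e * (hnorm H (T g) + C * hnorm K g)"
      if e: "e > 0" for e :: real
    proof -
      obtain d where d: "d \<in> D" "hnorm H (T g - d) < e" using D T[OF g] e unfolding hdense_def by blast
      have "(hnorm H (T g))\<^sup>2 = cmod (hinner H (T g) (T g - d) + hinner H (T g) d)"
        using T g DH d by (simp add: H.inner_diff_right H.inner_self norm_power)
      also have "\<dots> \<le> cmod (hinner H (T g) (T g - d)) + cmod (hinner H (T g) d)"
        by (rule norm_triangle_ineq)
      also have "cmod (hinner H (T g) (T g - d)) \<le> hnorm H (T g) * e"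
      proof -
        have "cmod (hinner H (T g) (T g - d)) \<le> hnorm H (T g) * hnorm H (T g - d)"
          using T g DH d by (intro H.Cauchy_Schwarz) auto
        also have "\<dots> \<le> hnorm H (T g) * e" using d T g by (intro mult_left_mono) auto
        finally show ?thesis .
      qed
      also have "cmod (hinner H (T g) d) \<le> C * hnorm K g * hnorm H d" by (rule bd[OF g d(1)])
      also have "C * hnorm K g * hnorm H d \<le> C * hnorm K g * (hnorm H (T g) + e)"
        using H.norm_diff_le[of "T g" d] T g DH d C(1) by (intro mult_left_mono) auto
      finally show ?thesis by (simp add: algebra_simps)
    qed
    have "((\<lambda>e. C * hnorm K g * hnorm H (T g) + e * (hnorm H (T g) + C * hnorm K g)) \<longlongrightarrow>
        C * hnorm K g * hnorm H (T g) + 0 * (hnorm H (T g) + C * hnorm K g)) (at_right 0)"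
      by (intro tendsto_intros)
    then have "(hnorm H (T g))\<^sup>2 \<le> C * hnorm K g * hnorm H (T g) + 0 * (hnorm H (T g) + C * hnorm K g)"
      by (rule tendsto_lowerbound)
        (auto simp: eventually_at_right_less le intro: eventually_mono[OF eventually_at_right_less])
    then have "hnorm H (T g) * hnorm H (T g) \<le> (C * hnorm K g) * hnorm H (T g)"
      by (simp add: power2_eq_square)
    then show ?thesis
      using T[OF g] C(1) g by (cases "hnorm H (T g) = 0") (auto simp: less_le)
  qed
  then show ?thesis using C(1) by blast
qed

section \<open>Adjoints of bounded operators\<close>

lemma hadjoint_eqI:
  assumes "hilbert H" "g' \<in> hcarrier H" "\<And>f. f \<in> hcarrier H \<Longrightarrow> hinner K (T f) g = hinner H f g'"
  shows "hadjoint H K T g = g'"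
proof -
  interpret hilbert H by fact
  show ?thesis
    unfolding hadjoint_def using assms by (intro the_equality) (auto intro: inner_eqI)
qed

lemma hadjoint_bounded:
  assumes "hilbert H" "hilbert K" "bounded_op H K T" "g \<in> hcarrier K"
  shows "hadjoint H K T g \<in> hcarrier H"
    and "\<And>f. f \<in> hcarrier H \<Longrightarrow> hinner K (T f) g = hinner H f (hadjoint H K T g)"
proof -
  interpret H: hilbert H by fact
  interpret K: hilbert K by fact
  obtain C where C: "\<And>f. f \<in> hcarrier H \<Longrightarrow> hnorm K (T f) \<le> C * hnorm H f"
    and T: "\<And>f. f \<in> hcarrier H \<Longrightarrow> T f \<in> hcarrier K"
      "\<And>f f'. \<lbrakk>f \<in> hcarrier H; f' \<in> hcarrier H\<rbrakk> \<Longrightarrow> T (f + f') = T f + T f'"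
      "\<And>c f. f \<in> hcarrier H \<Longrightarrow> T (c *\<^sub>C f) = c *\<^sub>C T f"
    using assms(3) unfolding bounded_op_def by blast
  have "\<exists>r\<in>hcarrier H. \<forall>f\<in>hcarrier H. hinner K (T f) g = hinner H f r"
  proof (rule H.riesz[where c = "C * hnorm K g"])
    fix f assume f: "f \<in> hcarrier H"
    have "cmod (hinner K (T f) g) \<le> hnorm K (T f) * hnorm K g"
      using f T assms(4) by (intro K.Cauchy_Schwarz) auto
    also have "\<dots> \<le> C * hnorm H f * hnorm K g"
      using C[OF f] assms(4) by (intro mult_right_mono) auto
    finally show "cmod (hinner K (T f) g) \<le> C * hnorm K g * hnorm H f" by (simp add: mult_ac)
  qed (use T assms(4) in \<open>simp_all add: K.inner_simps\<close>)
  then obtain r where r: "r \<in> hcarrier H" "\<And>f. f \<in> hcarrier H \<Longrightarrow> hinner K (T f) g = hinner H f r"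
    by blast
  have "hadjoint H K T g = r" by (rule hadjoint_eqI[OF assms(1) r])
  then show "hadjoint H K T g \<in> hcarrier H"
    "\<And>f. f \<in> hcarrier H \<Longrightarrow> hinner K (T f) g = hinner H f (hadjoint H K T g)" using r by auto
qed

section \<open>Positive semidefinite kernels\<close>

text \<open>Only real parts are tested; Hermitian symmetry is a separate hypothesis wherever an
  inner product is built. The set \<open>S\<close> is explicit because interpolation nodes will be
  added to it one at a time.\<close>

definition psd :: "'p set \<Rightarrow> ('p \<Rightarrow> 'p \<Rightarrow> complex) \<Rightarrow> bool" where
  "psd S K \<longleftrightarrow> (\<forall>F w. finite F \<longrightarrow> F \<subseteq> S \<longrightarrow> 0 \<le> Re (\<Sum>p\<in>F. \<Sum>q\<in>F. w p * cnj (w q) * K p q))"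

lemma psdI:
  assumes "\<And>F w. \<lbrakk>finite F; F \<subseteq> S\<rbrakk> \<Longrightarrow> 0 \<le> Re (\<Sum>p\<in>F. \<Sum>q\<in>F. w p * cnj (w q) * K p q)"
  shows "psd S K"
  using assms unfolding psd_def by blast

lemma psdD:
  assumes "psd S K" "finite F" "F \<subseteq> S"
  shows "0 \<le> Re (\<Sum>p\<in>F. \<Sum>q\<in>F. w p * cnj (w q) * K p q)"
  using assms unfolding psd_def by blast

lemma psd_cong:
  assumes "psd S K" "\<And>p q. \<lbrakk>p \<in> S; q \<in> S\<rbrakk> \<Longrightarrow> K' p q = K p q"
  shows "psd S K'"
proof (rule psdI)
  fix F w assume F: "finite F" "F \<subseteq> S"
  have "(\<Sum>p\<in>F. \<Sum>q\<in>F. w p * cnj (w q) * K' p q) = (\<Sum>p\<in>F. \<Sum>q\<in>F. w p * cnj (w q) * K p q)"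
    using F assms(2) by (intro sum.cong refl) auto
  with psdD[OF assms(1) F, of w] show "0 \<le> Re (\<Sum>p\<in>F. \<Sum>q\<in>F. w p * cnj (w q) * K' p q)" by simp
qed

lemma psd_mono: "psd T K \<Longrightarrow> S \<subseteq> T \<Longrightarrow> psd S K"
  unfolding psd_def by blast

lemma psd_insert_zero:
  assumes "psd S K" "\<And>p. K p v = 0" "\<And>p. K v p = 0"
  shows "psd (insert v S) K"
proof (rule psdI)
  fix F w assume F: "finite F" "F \<subseteq> insert v S"
  have "(\<Sum>p\<in>F. \<Sum>q\<in>F. w p * cnj (w q) * K p q) = (\<Sum>p\<in>F - {v}. \<Sum>q\<in>F - {v}. w p * cnj (w q) * K p q)"
  proof -
    have "(\<Sum>q\<in>F. w p * cnj (w q) * K p q) = (\<Sum>q\<in>F - {v}. w p * cnj (w q) * K p q)" for p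
      using F assms(2) by (intro sum.mono_neutral_right) auto
    moreover have "(\<Sum>p\<in>F. \<Sum>q\<in>F. w p * cnj (w q) * K p q) = (\<Sum>p\<in>F - {v}. \<Sum>q\<in>F. w p * cnj (w q) * K p q)"
      using F assms(3) by (intro sum.mono_neutral_right) (auto intro: sum.neutral)
    ultimately show ?thesis by simp
  qed
  then show "0 \<le> Re (\<Sum>p\<in>F. \<Sum>q\<in>F. w p * cnj (w q) * K p q)"
    using psdD[OF assms(1), of "F - {v}" w] F by auto
qed

lemma psd_add:
  assumes "psd S K" "psd S L"
  shows "psd S (\<lambda>p q. K p q + L p q)"
proof (rule psdI)
  fix F w assume F: "finite F" "F \<subseteq> S"
  show "0 \<le> Re (\<Sum>p\<in>F. \<Sum>q\<in>F. w p * cnj (w q) * (K p q + L p q))"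
    using psdD[OF assms(1) F, of w] psdD[OF assms(2) F, of w]
    by (simp add: distrib_left sum.distrib)
qed

lemma psd_rescale:
  assumes "psd S K"
  shows "psd S (\<lambda>p q. g p * cnj (g q) * K p q)"
proof (rule psdI)
  fix F w assume F: "finite F" "F \<subseteq> S"
  show "0 \<le> Re (\<Sum>p\<in>F. \<Sum>q\<in>F. w p * cnj (w q) * (g p * cnj (g q) * K p q))"
    using psdD[OF assms(1) F, of "\<lambda>p. w p * g p"] by (simp add: mult_ac)
qed

lemma sum_sum_rank_one:
  "(\<Sum>p\<in>F. \<Sum>q\<in>F. w p * cnj (w q) * (g p * cnj (g q))) = of_real ((cmod (\<Sum>p\<in>F. w p * g p))\<^sup>2)"
proof -
  have "(\<Sum>p\<in>F. \<Sum>q\<in>F. w p * cnj (w q) * (g p * cnj (g q))) = (\<Sum>p\<in>F. w p * g p) * cnj (\<Sum>p\<in>F. w p * g p)"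
    by (simp add: sum_product mult_ac)
  then show ?thesis by (simp only: complex_norm_square)
qed

lemma psd_rank_one: "psd S (\<lambda>p q. g p * cnj (g q))"
  by (rule psdI) (simp only: sum_sum_rank_one Re_complex_of_real zero_le_power2)

text \<open>\<open>\<pi>\<close> may identify points; every finite set of images is the injective
  image of a finite set of chosen preimages. This lets nodes be replaced without checking that they
  stay distinct.\<close>

lemma psd_image:
  assumes "psd S (\<lambda>p q. K (\<pi> p) (\<pi> q))"
  shows "psd (\<pi> ` S) K"
proof (rule psdI)
  fix F w assume F: "finite F" "F \<subseteq> \<pi> ` S"
  then obtain G where G: "G \<subseteq> S" "finite G" "F = \<pi> ` G" "inj_on \<pi> G"
    by (metis finite_image_iff subset_image_inj)
  have "(\<Sum>p\<in>F. \<Sum>q\<in>F. w p * cnj (w q) * K p q) =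
      (\<Sum>p\<in>G. \<Sum>q\<in>G. w (\<pi> p) * cnj (w (\<pi> q)) * K (\<pi> p) (\<pi> q))"
    unfolding G(3) by (simp add: sum.reindex[OF G(4)])
  then show "0 \<le> Re (\<Sum>p\<in>F. \<Sum>q\<in>F. w p * cnj (w q) * K p q)"
    using psdD[OF assms G(2,1), of "\<lambda>p. w (\<pi> p)"] by simp
qed

lemma psd_vimage:
  assumes "psd (\<pi> ` S) K" "inj_on \<pi> S"
  shows "psd S (\<lambda>p q. K (\<pi> p) (\<pi> q))"
proof (rule psdI)
  fix F w assume F: "finite F" "F \<subseteq> S"
  have inj: "inj_on \<pi> F" using F assms(2) by (rule_tac inj_on_subset)
  have "0 \<le> Re (\<Sum>p\<in>\<pi> ` F. \<Sum>q\<in>\<pi> ` F. w (inv_into F \<pi> p) * cnj (w (inv_into F \<pi> q)) * K p q)"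
    using F by (intro psdD[OF assms(1)]) auto
  also have "(\<Sum>p\<in>\<pi> ` F. \<Sum>q\<in>\<pi> ` F. w (inv_into F \<pi> p) * cnj (w (inv_into F \<pi> q)) * K p q) =
      (\<Sum>p\<in>F. \<Sum>q\<in>F. w p * cnj (w q) * K (\<pi> p) (\<pi> q))"
    by (simp add: sum.reindex[OF inj] inv_into_f_f[OF inj])
  finally show "0 \<le> Re (\<Sum>p\<in>F. \<Sum>q\<in>F. w p * cnj (w q) * K (\<pi> p) (\<pi> q))" .
qed

text \<open>Positivity involves finitely many points at a time, and these already lie in one member
  of the chain. This is what Zorn's lemma needs for sets of nodes.\<close>

lemma psd_Union_chain:
  assumes "\<C> \<noteq> {}" "subset.chain \<A> \<C>" "\<And>S. S \<in> \<C> \<Longrightarrow> psd S K"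
  shows "psd (\<Union>\<C>) K"
proof (rule psdI)
  fix F and w :: "'a \<Rightarrow> complex" assume F: "finite F" "F \<subseteq> \<Union>\<C>"
  obtain S where "S \<in> \<C>" "F \<subseteq> S" using finite_subset_Union_chain[OF F assms(1,2)] .
  then show "0 \<le> Re (\<Sum>p\<in>F. \<Sum>q\<in>F. w p * cnj (w q) * K p q)"
    using psdD[OF assms(3) F(1)] by blast
qed

text \<open>The arguments are swapped to match the convention of reproducing kernels:
  \<open>k x y\<close> is the inner product of the kernel function at \<open>y\<close> with the one
  at \<open>x\<close>.\<close>

lemma (in semi_hilbert) psd_gram:
  assumes "\<And>p. p \<in> S \<Longrightarrow> g p \<in> hcarrier H"
  shows "psd S (\<lambda>p q. hinner H (g q) (g p))"
proof (rule psdI)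
  fix F w assume F: "finite F" "F \<subseteq> S"
  define x where "x = (\<Sum>p\<in>F. cnj (w p) *\<^sub>C g p)"
  have mem: "\<And>p. p \<in> F \<Longrightarrow> cnj (w p) *\<^sub>C g p \<in> hcarrier H" using F assms by auto
  have x: "x \<in> hcarrier H" unfolding x_def by (rule inner_sum_left[OF mem carrier_closed(1), THEN conjunct1])
  have "hinner H x x = (\<Sum>q\<in>F. hinner H (cnj (w q) *\<^sub>C g q) x)"
    by (subst (1) x_def) (rule inner_sum_left[OF mem x, THEN conjunct2])
  also have "\<dots> = (\<Sum>q\<in>F. \<Sum>p\<in>F. hinner H (cnj (w q) *\<^sub>C g q) (cnj (w p) *\<^sub>C g p))"
    unfolding x_def by (intro sum.cong refl inner_sum_right mem)
  also have "\<dots> = (\<Sum>q\<in>F. \<Sum>p\<in>F. w p * cnj (w q) * hinner H (g q) (g p))"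
    using F assms by (intro sum.cong refl) (auto simp: inner_simps subset_iff mult_ac)
  also have "\<dots> = (\<Sum>p\<in>F. \<Sum>q\<in>F. w p * cnj (w q) * hinner H (g q) (g p))"
    by (rule sum.swap)
  finally show "0 \<le> Re (\<Sum>p\<in>F. \<Sum>q\<in>F. w p * cnj (w q) * hinner H (g q) (g p))"
    using inner_nonneg[OF x] by simp
qed

subsection \<open>Finitely supported weights\<close>

definition weights :: "'p set \<Rightarrow> ('p \<Rightarrow> complex) set" where
  "weights S = {w. finite {p. w p \<noteq> 0} \<and> {p. w p \<noteq> 0} \<subseteq> S}"

definition pairing :: "('p \<Rightarrow> complex) \<Rightarrow> ('p \<Rightarrow> complex) \<Rightarrow> complex" where
  "pairing f w = (\<Sum>p | w p \<noteq> 0. w p * f p)"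

definition kernel_form :: "('p \<Rightarrow> 'p \<Rightarrow> complex) \<Rightarrow> ('p \<Rightarrow> complex) \<Rightarrow> ('p \<Rightarrow> complex) \<Rightarrow> complex" where
  "kernel_form K w w' = (\<Sum>p | w p \<noteq> 0. \<Sum>q | w' q \<noteq> 0. w p * cnj (w' q) * K p q)"

definition point_mass :: "'p \<Rightarrow> 'p \<Rightarrow> complex" where
  "point_mass p = (\<lambda>q. if q = p then 1 else 0)"

lemma weights_mono: "S \<subseteq> T \<Longrightarrow> weights S \<subseteq> weights T"
  by (auto simp: weights_def)

lemma weights_subspace: "complex_vector.subspace (weights S)"
proof (rule complex_vector.subspaceI)
  show "0 \<in> weights S" by (simp add: weights_def)
  show "x + y \<in> weights S" if "x \<in> weights S" "y \<in> weights S" for x y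
  proof -
    have "{p. (x + y) p \<noteq> 0} \<subseteq> {p. x p \<noteq> 0} \<union> {p. y p \<noteq> 0}" by auto
    with that show ?thesis unfolding weights_def by (auto intro: finite_subset)
  qed
  show "c *\<^sub>C x \<in> weights S" if "x \<in> weights S" for x c
  proof -
    have "{p. (c *\<^sub>C x) p \<noteq> 0} \<subseteq> {p. x p \<noteq> 0}" by (auto simp: scaleC_fun_def scaleC_complex_def)
    with that show ?thesis unfolding weights_def by (auto intro: finite_subset)
  qed
qed

lemma point_mass_weights: "p \<in> S \<Longrightarrow> point_mass p \<in> weights S"
  by (auto simp: weights_def point_mass_def)

lemma pairing_eq:
  assumes "finite F" "{p. w p \<noteq> 0} \<subseteq> F"
  shows "pairing f w = (\<Sum>p\<in>F. w p * f p)"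
  unfolding pairing_def using assms by (intro sum.mono_neutral_left) auto

lemma kernel_form_eq:
  assumes F: "finite F" "{p. w p \<noteq> 0} \<subseteq> F" "{p. w' p \<noteq> 0} \<subseteq> F"
  shows "kernel_form K w w' = (\<Sum>p\<in>F. \<Sum>q\<in>F. w p * cnj (w' q) * K p q)"
proof -
  have "kernel_form K w w' = (\<Sum>p | w p \<noteq> 0. \<Sum>q\<in>F. w p * cnj (w' q) * K p q)"
    unfolding kernel_form_def using F by (intro sum.cong refl sum.mono_neutral_left) auto
  also have "\<dots> = (\<Sum>p\<in>F. \<Sum>q\<in>F. w p * cnj (w' q) * K p q)"
    using F by (intro sum.mono_neutral_left) (auto intro: sum.neutral)
  finally show ?thesis .
qed

lemma pairing_add: "\<lbrakk>w \<in> weights S; w' \<in> weights S\<rbrakk> \<Longrightarrow> pairing f (w + w') = pairing f w + pairing f w'"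
proof -
  assume w: "w \<in> weights S" "w' \<in> weights S"
  let ?F = "{p. w p \<noteq> 0} \<union> {p. w' p \<noteq> 0}"
  have F: "finite ?F" using w by (auto simp: weights_def)
  have "pairing f (w + w') = (\<Sum>p\<in>?F. (w + w') p * f p)" by (rule pairing_eq[OF F]) auto
  also have "\<dots> = (\<Sum>p\<in>?F. w p * f p) + (\<Sum>p\<in>?F. w' p * f p)"
    by (simp add: sum.distrib distrib_right)
  also have "(\<Sum>p\<in>?F. w p * f p) = pairing f w" by (rule pairing_eq[OF F, symmetric]) auto
  also have "(\<Sum>p\<in>?F. w' p * f p) = pairing f w'" by (rule pairing_eq[OF F, symmetric]) auto
  finally show ?thesis .
qed

lemma pairing_scale: "w \<in> weights S \<Longrightarrow> pairing f (c *\<^sub>C w) = c * pairing f w"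
proof -
  assume w: "w \<in> weights S"
  let ?F = "{p. w p \<noteq> 0}"
  have "finite ?F" using w by (auto simp: weights_def)
  then show ?thesis
    using pairing_eq[of ?F w f] pairing_eq[of ?F "c *\<^sub>C w" f]
    by (auto simp: sum_distrib_left mult_ac scaleC_fun_def scaleC_complex_def)
qed

lemma pairing_point_mass [simp]: "pairing f (point_mass p) = f p"
  by (simp add: pairing_def point_mass_def)

lemma kernel_form_point_mass: "kernel_form K (point_mass p) w = (\<Sum>q | w q \<noteq> 0. cnj (w q) * K p q)"
  by (simp add: kernel_form_def point_mass_def)

lemma kernel_form_rank_one_diff:
  "kernel_form (\<lambda>p q. K p q - f p * cnj (f q)) w w = kernel_form K w w - of_real ((cmod (pairing f w))\<^sup>2)"
  unfolding kernel_form_def pairing_def sum_sum_rank_one[symmetric]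
  by (simp add: algebra_simps sum_subtractf)

text \<open>Formal finite combinations of points, in which two point masses have inner product
  \<open>K p q\<close>. For a reproducing kernel this is the span of the kernel functions up to
  complex conjugation, with null vectors left in place.\<close>

abbreviation kernel_space :: "'p set \<Rightarrow> ('p \<Rightarrow> 'p \<Rightarrow> complex) \<Rightarrow> ('p \<Rightarrow> complex) hilbert" where
  "kernel_space S K \<equiv> \<lparr>hcarrier = weights S, hinner = kernel_form K\<rparr>"

lemma psd_kernel_form: "psd S K \<Longrightarrow> w \<in> weights S \<Longrightarrow> 0 \<le> Re (kernel_form K w w)"
  unfolding kernel_form_def by (rule psdD) (auto simp: weights_def)

lemma kernel_space_semi_hilbert:
  assumes psd: "psd S K" and herm: "\<And>p q. \<lbrakk>p \<in> S; q \<in> S\<rbrakk> \<Longrightarrow> K q p = cnj (K p q)"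
  shows "semi_hilbert (kernel_space S K)"
proof
  show "complex_vector.subspace (hcarrier (kernel_space S K))" by (simp add: weights_subspace)
next
  fix w w' v assume "w \<in> hcarrier (kernel_space S K)" "w' \<in> hcarrier (kernel_space S K)" "v \<in> hcarrier (kernel_space S K)"
  then have w: "w \<in> weights S" "w' \<in> weights S" "v \<in> weights S" by auto
  let ?F = "{p. w p \<noteq> 0} \<union> {p. w' p \<noteq> 0} \<union> {p. v p \<noteq> 0}"
  have F: "finite ?F" using w by (auto simp: weights_def)
  have "kernel_form K (w + w') v = (\<Sum>p\<in>?F. \<Sum>q\<in>?F. (w + w') p * cnj (v q) * K p q)"
    by (rule kernel_form_eq[OF F]) auto
  also have "\<dots> = (\<Sum>p\<in>?F. \<Sum>q\<in>?F. w p * cnj (v q) * K p q) + (\<Sum>p\<in>?F. \<Sum>q\<in>?F. w' p * cnj (v q) * K p q)"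
    by (simp add: distrib_right sum.distrib)
  also have "(\<Sum>p\<in>?F. \<Sum>q\<in>?F. w p * cnj (v q) * K p q) = kernel_form K w v"
    by (rule kernel_form_eq[OF F, symmetric]) auto
  also have "(\<Sum>p\<in>?F. \<Sum>q\<in>?F. w' p * cnj (v q) * K p q) = kernel_form K w' v"
    by (rule kernel_form_eq[OF F, symmetric]) auto
  finally show "hinner (kernel_space S K) (w + w') v = hinner (kernel_space S K) w v + hinner (kernel_space S K) w' v"
    by (simp only: hilbert.select_convs)
next
  fix w v c assume "w \<in> hcarrier (kernel_space S K)" "v \<in> hcarrier (kernel_space S K)"
  then have w: "w \<in> weights S" "v \<in> weights S" by auto
  let ?F = "{p. w p \<noteq> 0} \<union> {p. v p \<noteq> 0}"
  have F: "finite ?F" using w by (auto simp: weights_def)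
  have "kernel_form K (c *\<^sub>C w) v = (\<Sum>p\<in>?F. \<Sum>q\<in>?F. (c *\<^sub>C w) p * cnj (v q) * K p q)"
    by (rule kernel_form_eq[OF F]) (auto simp: scaleC_fun_def scaleC_complex_def)
  also have "\<dots> = c * (\<Sum>p\<in>?F. \<Sum>q\<in>?F. w p * cnj (v q) * K p q)"
    by (simp add: scaleC_fun_def scaleC_complex_def sum_distrib_left mult_ac)
  also have "(\<Sum>p\<in>?F. \<Sum>q\<in>?F. w p * cnj (v q) * K p q) = kernel_form K w v"
    by (rule kernel_form_eq[OF F, symmetric]) auto
  finally show "hinner (kernel_space S K) (c *\<^sub>C w) v = c * hinner (kernel_space S K) w v"
    by (simp only: hilbert.select_convs)
next
  fix w v assume "w \<in> hcarrier (kernel_space S K)" "v \<in> hcarrier (kernel_space S K)"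
  then have w: "w \<in> weights S" "v \<in> weights S" by auto
  have "cnj (kernel_form K w v) = (\<Sum>p | w p \<noteq> 0. \<Sum>q | v q \<noteq> 0. v q * cnj (w p) * K q p)"
    unfolding kernel_form_def cnj_sum complex_cnj_mult complex_cnj_cnj
    using w by (intro sum.cong refl) (simp add: weights_def subset_iff herm[symmetric] mult_ac)
  also have "\<dots> = kernel_form K v w" unfolding kernel_form_def by (rule sum.swap)
  finally show "hinner (kernel_space S K) v w = cnj (hinner (kernel_space S K) w v)" by simp
next
  fix w assume "w \<in> hcarrier (kernel_space S K)"
  then show "0 \<le> Re (hinner (kernel_space S K) w w)" using psd_kernel_form[OF psd] by simp
qed

text \<open>The form of the rank-one kernel of \<open>f\<close> at \<open>w\<close> is the squared
  modulus of \<open>pairing f w\<close>; positivity of the difference is thus a norm bound for the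
  functional \<open>pairing f\<close>.\<close>

lemma pairing_le_kernel_norm:
  assumes "psd S (\<lambda>p q. of_real (c\<^sup>2) * K p q - f p * cnj (f q))" "w \<in> weights S" "0 \<le> c"
  shows "cmod (pairing f w) \<le> c * hnorm (kernel_space S K) w"
proof -
  have "0 \<le> Re (kernel_form (\<lambda>p q. of_real (c\<^sup>2) * K p q - f p * cnj (f q)) w w)"
    by (rule psd_kernel_form[OF assms(1,2)])
  also have "kernel_form (\<lambda>p q. of_real (c\<^sup>2) * K p q - f p * cnj (f q)) w w =
      of_real (c\<^sup>2) * kernel_form K w w - of_real ((cmod (pairing f w))\<^sup>2)"
    unfolding kernel_form_rank_one_diff
    by (simp add: kernel_form_def sum_distrib_left mult_ac)
  finally have "(cmod (pairing f w))\<^sup>2 \<le> c\<^sup>2 * Re (kernel_form K w w)"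
    by (simp flip: of_real_power)
  then have "sqrt ((cmod (pairing f w))\<^sup>2) \<le> sqrt (c\<^sup>2 * Re (kernel_form K w w))"
    by (rule real_sqrt_le_mono)
  then show ?thesis using assms(3) by (simp add: hnorm_def real_sqrt_mult)
qed

text \<open>The functions in the unit ball of the space with kernel \<open>K\<close> extend from \<open>S\<close> to an additional point
  without leaving the unit ball.\<close>

lemma psd_extend:
  assumes psd: "psd (insert v S) K" and herm: "\<And>p q. K q p = cnj (K p q)"
    and f: "psd S (\<lambda>p q. K p q - f p * cnj (f q))" and v: "v \<notin> S"
  obtains \<tau> where "psd (insert v S) (\<lambda>p q. K p q - (f(v := \<tau>)) p * cnj ((f(v := \<tau>)) q))"
proof -
  interpret semi_hilbert "kernel_space (insert v S) K"
    by (rule kernel_space_semi_hilbert[OF psd herm])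
  let ?H = "kernel_space (insert v S) K"
  have sub: "weights S \<subseteq> hcarrier ?H" by (simp add: weights_mono subset_insertI)
  have bound: "cmod (pairing f w) \<le> 1 * hnorm ?H w" if "w \<in> weights S" for w
    using pairing_le_kernel_norm[of S 1 K f w] f that by (simp add: hnorm_def)
  obtain g where g: "\<And>w. w \<in> weights S \<Longrightarrow> (\<lambda>n. kernel_form K w (g n)) \<longlonglongrightarrow> pairing f w"
    "\<And>w. w \<in> weights (insert v S) \<Longrightarrow>
      \<exists>L. (\<lambda>n. kernel_form K w (g n)) \<longlonglongrightarrow> L \<and> cmod L \<le> 1 * hnorm ?H w"
    and gS: "\<And>n. g n \<in> weights S"
    by (rule riesz_approx[OF weights_subspace sub pairing_add pairing_scale bound]) auto
  have v_in: "point_mass v \<in> weights (insert v S)" by (simp add: point_mass_weights)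
  \<comment> \<open>In the limit \<open>g\<close> represents a functional on all weights over
    \<open>insert v S\<close> that extends \<open>pairing f\<close> with the same bound. Its value
    at the new point mass is the value to assign at \<open>v\<close>.\<close>
  obtain \<tau> where \<tau>: "(\<lambda>n. kernel_form K (point_mass v) (g n)) \<longlonglongrightarrow> \<tau>" using g(2)[OF v_in] by blast
  let ?f = "f(v := \<tau>)"
  have gH: "g n \<in> hcarrier ?H" for n using gS sub by auto
  have main: "(cmod (pairing ?f w))\<^sup>2 \<le> Re (kernel_form K w w)" if w: "w \<in> weights (insert v S)" for w
  proof -
    let ?w = "w(v := 0)"
    have "{p. ?w p \<noteq> 0} \<subseteq> {p. w p \<noteq> 0}" by auto
    then have w0: "?w \<in> weights S" using w unfolding weights_def by (auto intro: finite_subset)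
    then have w1: "?w \<in> weights (insert v S)" using sub by auto
    have split: "w = ?w + w v *\<^sub>C point_mass v"
      by (auto simp: fun_eq_iff scaleC_fun_def scaleC_complex_def point_mass_def)
    have v1: "w v *\<^sub>C point_mass v \<in> weights (insert v S)"
      using carrier_closed(4)[of "point_mass v"] v_in by simp
    have form: "kernel_form K w (g n) = kernel_form K ?w (g n) + w v * kernel_form K (point_mass v) (g n)" for n
      using inner_add_left[of ?w "w v *\<^sub>C point_mass v" "g n"] inner_scale_left[of "point_mass v" "g n" "w v"]
        w1 v_in v1 gH[of n] by (subst split) simp
    have pair: "pairing ?f w = pairing f ?w + w v * \<tau>"
    proof -
      have "pairing ?f w = pairing ?f ?w + w v * pairing ?f (point_mass v)"
        using pairing_add[OF w1, of "w v *\<^sub>C point_mass v" ?f] pairing_scale[OF v_in, of ?f "w v"] v1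
        by (subst split) simp
      moreover have "pairing ?f ?w = pairing f ?w" unfolding pairing_def by (rule sum.cong) auto
      ultimately show ?thesis by simp
    qed
    have "(\<lambda>n. kernel_form K w (g n)) \<longlonglongrightarrow> pairing ?f w"
      unfolding form pair by (intro tendsto_intros g(1)[OF w0] \<tau>)
    then have "cmod (pairing ?f w) \<le> hnorm ?H w"
      using g(2)[OF w] LIMSEQ_unique by fastforce
    then have "(cmod (pairing ?f w))\<^sup>2 \<le> (hnorm ?H w)\<^sup>2" by (intro power_mono) auto
    then show ?thesis using norm_sq[of w] w by simp
  qed
  have "psd (insert v S) (\<lambda>p q. K p q - ?f p * cnj (?f q))"
  proof (rule psdI)
    fix F and w :: "'a \<Rightarrow> complex" assume F: "finite F" "F \<subseteq> insert v S"
    define w' where "w' p = (if p \<in> F then w p else 0)" for p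
    have supp: "{p. w' p \<noteq> 0} \<subseteq> F" by (auto simp: w'_def)
    then have w': "w' \<in> weights (insert v S)" using F unfolding weights_def by (auto intro: finite_subset)
    have "(\<Sum>p\<in>F. \<Sum>q\<in>F. w p * cnj (w q) * (K p q - ?f p * cnj (?f q))) =
        kernel_form (\<lambda>p q. K p q - ?f p * cnj (?f q)) w' w'"
      unfolding kernel_form_eq[OF F(1) supp supp] by (intro sum.cong refl) (auto simp: w'_def)
    also have "\<dots> = kernel_form K w' w' - of_real ((cmod (pairing ?f w'))\<^sup>2)"
      by (rule kernel_form_rank_one_diff)
    finally show "0 \<le> Re (\<Sum>p\<in>F. \<Sum>q\<in>F. w p * cnj (w q) * (K p q - ?f p * cnj (?f q)))"
      using main[OF w'] by (simp flip: of_real_power)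
  qed
  then show thesis by (rule that)
qed

subsection \<open>Schur products with Gram kernels\<close>

lemma ell2_summable:
  assumes "v \<in> hcarrier (ell2 I)" "w \<in> hcarrier (ell2 I)"
  shows "(\<lambda>i. v i * cnj (w i)) summable_on I"
proof -
  have "(\<lambda>i. (cmod (v i))\<^sup>2 + (cmod (w i))\<^sup>2) summable_on I"
    using assms by (intro summable_on_add) (auto simp: ell2_def)
  then have "(\<lambda>i. norm (v i * cnj (w i))) summable_on I"
  proof (rule summable_on_comparison_test)
    fix i show "norm (v i * cnj (w i)) \<le> (cmod (v i))\<^sup>2 + (cmod (w i))\<^sup>2"
      using sum_squares_bound[of "cmod (v i)" "cmod (w i)"]
        mult_nonneg_nonneg[OF norm_ge_zero norm_ge_zero, of "v i" "w i"]
      by (simp add: norm_mult del: mult_nonneg_nonneg zero_le_mult_iff)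
  qed simp
  then show ?thesis by (rule abs_summable_summable)
qed

lemma ell2_semi_hilbert: "semi_hilbert (ell2 I)"
proof
  show "complex_vector.subspace (hcarrier (ell2 I))"
  proof (rule complex_vector.subspaceI)
    show "0 \<in> hcarrier (ell2 I)" by (simp add: ell2_def)
    show "c *\<^sub>C v \<in> hcarrier (ell2 I)" if "v \<in> hcarrier (ell2 I)" for c v
      using that by (auto simp: ell2_def scaleC_fun_def scaleC_complex_def norm_mult power_mult_distrib
          intro: summable_on_cmult_right)
    show "v + w \<in> hcarrier (ell2 I)" if "v \<in> hcarrier (ell2 I)" "w \<in> hcarrier (ell2 I)" for v w
    proof -
      have "(\<lambda>i. 2 * (cmod (v i))\<^sup>2 + 2 * (cmod (w i))\<^sup>2) summable_on I"
        using that by (intro summable_on_add summable_on_cmult_right) (auto simp: ell2_def)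
      then have "(\<lambda>i. (cmod ((v + w) i))\<^sup>2) summable_on I"
      proof (rule summable_on_comparison_test)
        fix i
        have "(cmod (v i + w i))\<^sup>2 \<le> (cmod (v i) + cmod (w i))\<^sup>2"
          by (intro power_mono norm_triangle_ineq) auto
        also have "\<dots> \<le> 2 * (cmod (v i))\<^sup>2 + 2 * (cmod (w i))\<^sup>2"
          using sum_squares_bound[of "cmod (v i)" "cmod (w i)"] by (simp add: power2_sum)
        finally show "(cmod ((v + w) i))\<^sup>2 \<le> 2 * (cmod (v i))\<^sup>2 + 2 * (cmod (w i))\<^sup>2" by simp
      qed simp
      then show ?thesis using that by (simp add: ell2_def)
    qed
  qed
next
  fix f g l assume "f \<in> hcarrier (ell2 I)" "g \<in> hcarrier (ell2 I)" "l \<in> hcarrier (ell2 I)"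
  then show "hinner (ell2 I) (f + g) l = hinner (ell2 I) f l + hinner (ell2 I) g l"
    using infsum_add[OF ell2_summable ell2_summable, of f I l g l]
    by (simp add: ell2_def distrib_right)
next
  fix f g :: "'a \<Rightarrow> complex" and c
  show "hinner (ell2 I) (c *\<^sub>C f) g = c * hinner (ell2 I) f g"
    by (simp add: ell2_def scaleC_fun_def scaleC_complex_def mult.assoc infsum_cmult_right')
  show "hinner (ell2 I) g f = cnj (hinner (ell2 I) f g)"
    by (simp add: ell2_def mult.commute flip: infsum_cnj)
next
  fix f assume f: "f \<in> hcarrier (ell2 I)"
  have "Re (hinner (ell2 I) f f) = (\<Sum>\<^sub>\<infinity>i\<in>I. Re (f i * cnj (f i)))"
    unfolding ell2_def hilbert.select_convs
    using f by (intro infsum_Re[symmetric] ell2_summable)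
  also have "\<dots> \<ge> 0" by (intro infsum_nonneg) simp
  finally show "0 \<le> Re (hinner (ell2 I) f f)" .
qed

lemma has_sum_finite_sum:
  fixes f :: "'p \<Rightarrow> 'i \<Rightarrow> complex"
  assumes "finite F" "\<And>p. p \<in> F \<Longrightarrow> (f p has_sum a p) I"
  shows "((\<lambda>i. \<Sum>p\<in>F. f p i) has_sum (\<Sum>p\<in>F. a p)) I"
  using assms by (induction F rule: finite_induct) (auto intro: has_sum_add)

text \<open>Expanding the Gram kernel over the coordinates turns the form of the product into a sum
  over \<open>i\<close> of forms of \<open>K\<close> with weights \<open>w p * f p i\<close>, each
  with nonnegative real part.\<close>

lemma psd_schur_ell2:
  assumes psd: "psd S K" and f: "\<And>p. p \<in> S \<Longrightarrow> f p \<in> hcarrier (ell2 I)"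
  shows "psd S (\<lambda>p q. K p q * hinner (ell2 I) (f p) (f q))"
proof (rule psdI)
  fix F w assume F: "finite F" "F \<subseteq> S"
  define G where "G i = (\<Sum>p\<in>F. \<Sum>q\<in>F. (w p * f p i) * cnj (w q * f q i) * K p q)" for i
  have sm: "((\<lambda>i. (w p * f p i) * cnj (w q * f q i) * K p q) has_sum
      w p * cnj (w q) * (K p q * hinner (ell2 I) (f p) (f q))) I" if "p \<in> F" "q \<in> F" for p q
  proof -
    have "((\<lambda>i. f p i * cnj (f q i)) has_sum hinner (ell2 I) (f p) (f q)) I"
      using has_sum_infsum[OF ell2_summable[of "f p" I "f q"]] F f that
      by (auto simp: ell2_def)
    from has_sum_cmult_right[OF this, of "w p * cnj (w q) * K p q"] show ?thesis
      by (simp add: mult_ac)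
  qed
  have "(G has_sum (\<Sum>p\<in>F. \<Sum>q\<in>F. w p * cnj (w q) * (K p q * hinner (ell2 I) (f p) (f q)))) I"
    unfolding G_def using F by (intro has_sum_finite_sum sm)
  then have "((\<lambda>i. Re (G i)) has_sum
      Re (\<Sum>p\<in>F. \<Sum>q\<in>F. w p * cnj (w q) * (K p q * hinner (ell2 I) (f p) (f q)))) I"
    by (rule has_sum_Re)
  moreover have "0 \<le> Re (G i)" for i
    unfolding G_def by (rule psdD[OF psd F])
  ultimately show "0 \<le> Re (\<Sum>p\<in>F. \<Sum>q\<in>F. w p * cnj (w q) * (K p q * hinner (ell2 I) (f p) (f q)))"
    by (rule has_sum_nonneg)
qed

section \<open>Reproducing kernel Hilbert spaces and their multipliers\<close>

locale rkh_space =
  fixes k :: "'x \<Rightarrow> 'x \<Rightarrow> complex" and H :: "('x \<Rightarrow> complex) hilbert"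
  assumes scalar_rkhs: "scalar_rkhs k H"
begin

sublocale hilbert H
  using scalar_rkhs unfolding scalar_rkhs_def rkhs_def hilbert_space_iff by blast

abbreviation kernel_at :: "'x \<Rightarrow> 'x \<Rightarrow> complex" where
  "kernel_at y \<equiv> (\<lambda>x. k x y)"

lemma kernel_in [simp]: "kernel_at y \<in> hcarrier H"
  and reproducing: "f \<in> hcarrier H \<Longrightarrow> hinner H f (kernel_at y) = f y"
proof -
  have *: "\<forall>y. \<forall>e\<in>hcarrier complex_hilbert. (\<lambda>x. k x y * e) \<in> hcarrier H \<and>
      (\<forall>F\<in>hcarrier H. hinner H F (\<lambda>x. k x y * e) = hinner complex_hilbert (F y) e)"
    using scalar_rkhs unfolding scalar_rkhs_def rkhs_def by blast
  have "1 \<in> hcarrier complex_hilbert" by (simp add: complex_hilbert_def)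
  from bspec[OF spec[OF *] this, of y]
  show "kernel_at y \<in> hcarrier H" "f \<in> hcarrier H \<Longrightarrow> hinner H f (kernel_at y) = f y"
    by (simp_all add: complex_hilbert_def)
qed

lemma reproducing': "f \<in> hcarrier H \<Longrightarrow> hinner H (kernel_at y) f = cnj (f y)"
  using inner_commute[of f "kernel_at y"] reproducing by simp

lemma kernel_commute: "k y x = cnj (k x y)"
  using inner_commute[of "kernel_at y" "kernel_at x"] by (simp add: reproducing)

lemma kernel_psd: "psd S k"
  using psd_gram[of S kernel_at] by (simp add: reproducing)

lemma eval_tendsto:
  assumes "\<And>n. s n \<in> hcarrier H" "l \<in> hcarrier H" "(\<lambda>n. hnorm H (s n - l)) \<longlonglongrightarrow> 0"
  shows "(\<lambda>n. s n x) \<longlonglongrightarrow> l x"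
  using tendsto_cnj[OF inner_tendsto[OF assms kernel_in, of x]] assms(1,2) by (simp add: reproducing')

section \<open>Kernel sums and the description of balls by the kernel\<close>

definition kernel_sum :: "'x set \<Rightarrow> ('x \<Rightarrow> complex) \<Rightarrow> 'x \<Rightarrow> complex" where
  "kernel_sum F w = (\<Sum>p\<in>F. cnj (w p) *\<^sub>C kernel_at p)"

lemma kernel_sum_in [simp]: "kernel_sum F w \<in> hcarrier H"
  unfolding kernel_sum_def by (rule inner_sum_left[THEN conjunct1, of _ _ 0]) auto

lemma inner_kernel_sum: "f \<in> hcarrier H \<Longrightarrow> hinner H f (kernel_sum F w) = (\<Sum>p\<in>F. w p * f p)"
  unfolding kernel_sum_def
  by (subst inner_sum_right) (auto simp: inner_scale_right reproducing)

lemma kernel_sum_apply: "kernel_sum F w x = (\<Sum>p\<in>F. cnj (w p) * k x p)"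
proof -
  have "kernel_sum F w x = hinner H (kernel_sum F w) (kernel_at x)"
    by (rule reproducing[OF kernel_sum_in, symmetric])
  also have "\<dots> = (\<Sum>p\<in>F. hinner H (cnj (w p) *\<^sub>C kernel_at p) (kernel_at x))"
    unfolding kernel_sum_def by (rule inner_sum_left[THEN conjunct2]) auto
  also have "\<dots> = (\<Sum>p\<in>F. cnj (w p) * k x p)"
    by (simp only: inner_scale_left kernel_in reproducing)
  finally show ?thesis .
qed

lemma inner_kernel_sums:
  "hinner H (kernel_sum G v) (kernel_sum F w) = (\<Sum>p\<in>F. \<Sum>q\<in>G. w p * cnj (v q) * k p q)"
  by (simp add: inner_kernel_sum kernel_sum_apply sum_distrib_left mult.assoc)

lemma psd_of_mem:
  assumes "f \<in> hcarrier H" "hnorm H f \<le> c"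
  shows "psd S (\<lambda>x y. of_real (c\<^sup>2) * k x y - f x * cnj (f y))"
proof (rule psdI)
  fix F w assume F: "finite F" "F \<subseteq> S"
  let ?x = "kernel_sum F w"
  have "cmod (\<Sum>p\<in>F. w p * f p) \<le> hnorm H f * hnorm H ?x"
    using Cauchy_Schwarz[OF assms(1), of ?x] assms(1) by (simp add: inner_kernel_sum)
  also have "\<dots> \<le> c * hnorm H ?x" using assms by (intro mult_right_mono) auto
  finally have "(cmod (\<Sum>p\<in>F. w p * f p))\<^sup>2 \<le> (c * hnorm H ?x)\<^sup>2" by (intro power_mono) auto
  also have "\<dots> = c\<^sup>2 * Re (\<Sum>p\<in>F. \<Sum>q\<in>F. w p * cnj (w q) * k p q)"
    by (simp add: power_mult_distrib norm_sq inner_kernel_sums)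
  finally have *: "(cmod (\<Sum>p\<in>F. w p * f p))\<^sup>2 \<le> c\<^sup>2 * Re (\<Sum>p\<in>F. \<Sum>q\<in>F. w p * cnj (w q) * k p q)" .
  have "(\<Sum>p\<in>F. \<Sum>q\<in>F. w p * cnj (w q) * (of_real (c\<^sup>2) * k p q - f p * cnj (f q))) =
      of_real (c\<^sup>2) * (\<Sum>p\<in>F. \<Sum>q\<in>F. w p * cnj (w q) * k p q) - of_real ((cmod (\<Sum>p\<in>F. w p * f p))\<^sup>2)"
    unfolding sum_sum_rank_one[symmetric] by (simp add: algebra_simps sum_subtractf sum_distrib_left)
  then show "0 \<le> Re (\<Sum>p\<in>F. \<Sum>q\<in>F. w p * cnj (w q) * (of_real (c\<^sup>2) * k p q - f p * cnj (f q)))"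
    using * by (simp flip: of_real_power)
qed

text \<open>Converse of \<open>psd_of_mem\<close>: balls of \<open>H\<close> are determined by the
  kernel alone. By hypothesis \<open>pairing f\<close> is a bounded functional on weights; its
  approximate representers are carried into \<open>H\<close>, converge there by completeness, and
  evaluation at points identifies the limit with \<open>f\<close>.\<close>

lemma mem_of_psd:
  assumes psd: "psd UNIV (\<lambda>x y. of_real (c\<^sup>2) * k x y - f x * cnj (f y))" and c: "0 \<le> c"
  shows "f \<in> hcarrier H" "hnorm H f \<le> c"
proof -
  let ?K = "kernel_space UNIV k"
  interpret K: semi_hilbert ?K
    using kernel_space_semi_hilbert[OF kernel_psd] kernel_commute by blast
  have bound: "cmod (pairing f w) \<le> c * hnorm ?K w" if "w \<in> weights UNIV" for w
    by (rule pairing_le_kernel_norm[OF psd that c])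
  obtain g where gw: "\<And>n. g n \<in> weights UNIV"
    and cauchy: "\<forall>e>0. \<exists>N. \<forall>m\<ge>N. \<forall>n\<ge>N. hnorm ?K (g m - g n) < e"
    and lim: "\<And>w. w \<in> weights UNIV \<Longrightarrow> (\<lambda>n. kernel_form k w (g n)) \<longlonglongrightarrow> pairing f w"
    by (rule K.riesz_approx[OF weights_subspace _ pairing_add pairing_scale bound c]) auto
  \<comment> \<open>This map is conjugate-linear, so \<open>inner_\<Psi>\<close> exchanges its two
    arguments; distances are still preserved.\<close>
  define \<Psi> where "\<Psi> w = kernel_sum {p. w p \<noteq> 0} w" for w
  have inner_\<Psi>: "hinner H (\<Psi> v) (\<Psi> w) = kernel_form k w v" for v w
    by (simp add: \<Psi>_def inner_kernel_sums kernel_form_def)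
  have \<Psi>_in: "\<Psi> w \<in> hcarrier H" for w by (simp add: \<Psi>_def)
  have dist: "hnorm H (\<Psi> v - \<Psi> w) = hnorm ?K (v - w)" if "v \<in> weights UNIV" "w \<in> weights UNIV" for v w
  proof -
    have "(hnorm H (\<Psi> v - \<Psi> w))\<^sup>2 = (hnorm ?K (v - w))\<^sup>2"
      using that K.norm_sq_diff[of v w] K.norm_sq[of v] K.norm_sq[of w] K.inner_commute[of w v]
      by (simp add: norm_sq_diff \<Psi>_in) (simp add: norm_sq inner_\<Psi> \<Psi>_in)
    then show ?thesis using that K.norm_nonneg[of "v - w"] K.carrier_closed(3)[of v w]
      by (simp add: power2_eq_iff_nonneg \<Psi>_in)
  qed
  have "\<forall>e>0. \<exists>N. \<forall>m\<ge>N. \<forall>n\<ge>N. hnorm H (\<Psi> (g m) - \<Psi> (g n)) < e"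
    using cauchy gw by (simp add: dist)
  then obtain l where l: "l \<in> hcarrier H" "(\<lambda>n. hnorm H (\<Psi> (g n) - l)) \<longlonglongrightarrow> 0"
    using complete[of "\<lambda>n. \<Psi> (g n)"] \<Psi>_in by blast
  have "l x = f x" for x
  proof (rule LIMSEQ_unique)
    show "(\<lambda>n. \<Psi> (g n) x) \<longlonglongrightarrow> l x" using eval_tendsto[OF \<Psi>_in l] .
    show "(\<lambda>n. \<Psi> (g n) x) \<longlonglongrightarrow> f x"
      using lim[of "point_mass x"] by (simp add: point_mass_weights kernel_form_point_mass \<Psi>_def kernel_sum_apply)
  qed
  then have lf: "l = f" by auto
  then show f: "f \<in> hcarrier H" using l by simp
  \<comment> \<open>The norm bound comes from testing \<open>f\<close> against approximations of
    \<open>f\<close> itself: in the limit the squared norm of \<open>f\<close> is at most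
    \<open>c\<close> times its norm.\<close>
  have "cmod (hinner H f (\<Psi> (g n))) \<le> c * hnorm H (\<Psi> (g n))" for n
  proof -
    have "hnorm ?K (g n) = hnorm H (\<Psi> (g n))" by (simp add: hnorm_def inner_\<Psi>)
    then show ?thesis
      using bound[OF gw, of n] f by (simp add: \<Psi>_def inner_kernel_sum pairing_def)
  qed
  moreover have "(\<lambda>n. hnorm H (\<Psi> (g n))) \<longlonglongrightarrow> hnorm H f"
  proof (rule LIM_zero_cancel, rule Lim_null_comparison)
    show "\<forall>\<^sub>F n in sequentially. norm (hnorm H (\<Psi> (g n)) - hnorm H f) \<le> hnorm H (\<Psi> (g n) - l)"
      using norm_diff_le[OF \<Psi>_in f] lf by simp
  qed (rule l(2))
  ultimately have "cmod (hinner H f f) \<le> c * hnorm H f"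
    using inner_tendsto[OF \<Psi>_in l f] unfolding lf
    by (intro LIMSEQ_le[OF tendsto_norm tendsto_mult[OF tendsto_const]]) auto
  then have "hnorm H f * hnorm H f \<le> c * hnorm H f"
    using f by (simp add: inner_self norm_power flip: power2_eq_square)
  then show "hnorm H f \<le> c" using f c by (cases "hnorm H f = 0") (auto simp: less_le)
qed

lemma kernel_span_dense: "hdense H (complex_vector.span (range kernel_at))"
proof (rule dense_if_perp_zero)
  show "complex_vector.span (range kernel_at) \<subseteq> hcarrier H"
    by (rule complex_vector.span_minimal[OF _ subspace]) auto
  show "f = 0" if "f \<in> hcarrier H" "\<And>x. x \<in> complex_vector.span (range kernel_at) \<Longrightarrow> hinner H x f = 0" for f
    using that(1) that(2)[OF complex_vector.span_base, of "kernel_at _"]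
    by (auto simp: fun_eq_iff reproducing')
qed (rule complex_vector.subspace_span)

text \<open>Closed graph theorem for maps into a function space: continuity of all evaluations of
  \<open>T g\<close> provides a formal adjoint on the kernel functions, hence on their dense
  span.\<close>

lemma bounded_if_evaluations:
  assumes K: "hilbert K" and T: "\<And>g. g \<in> hcarrier K \<Longrightarrow> T g \<in> hcarrier H"
    and eval: "\<And>y. \<exists>s\<in>hcarrier K. \<forall>g\<in>hcarrier K. T g y = hinner K g s"
  shows "\<exists>C\<ge>0. \<forall>g\<in>hcarrier K. hnorm H (T g) \<le> C * hnorm K g"
proof (rule bounded_if_adjoint_dense[OF K hilbert_axioms T kernel_span_dense])
  interpret K: hilbert K by fact
  fix d assume "d \<in> complex_vector.span (range kernel_at)"
  then have "d \<in> hcarrier H \<and> (\<exists>s\<in>hcarrier K. \<forall>g\<in>hcarrier K. hinner H (T g) d = hinner K g s)"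
  proof (induction rule: complex_vector.span_induct_alt)
    case base
    show ?case
      using T by (intro conjI carrier_closed(1) bexI[of _ 0] ballI K.carrier_closed(1))
        (simp only: inner_zero K.inner_zero)
  next
    case (step c x y)
    then obtain z where z: "x = kernel_at z" by auto
    obtain s where s: "s \<in> hcarrier K" "\<forall>g\<in>hcarrier K. T g z = hinner K g s" using eval by blast
    obtain s' where s': "s' \<in> hcarrier K" "\<forall>g\<in>hcarrier K. hinner H (T g) y = hinner K g s'"
      and y: "y \<in> hcarrier H" using step by blast
    have "hinner H (T g) (c *\<^sub>C x + y) = hinner K g (c *\<^sub>C s + s')" if "g \<in> hcarrier K" for g
      using that s s' y T z by (simp add: inner_simps K.inner_simps reproducing)
    moreover have "c *\<^sub>C s + s' \<in> hcarrier K" using s s' by auto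
    moreover have "c *\<^sub>C x + y \<in> hcarrier H" unfolding z by (intro carrier_closed kernel_in y)
    ultimately show ?case unfolding z by blast
  qed
  then show "\<exists>s\<in>hcarrier K. \<forall>g\<in>hcarrier K. hinner H (T g) d = hinner K g s" by blast
qed

section \<open>Multipliers and their adjoints\<close>

lemma mult_op_in: "\<lbrakk>\<phi> \<in> Mult H; f \<in> hcarrier H\<rbrakk> \<Longrightarrow> mult_op \<phi> f \<in> hcarrier H"
  by (simp add: Mult_def)

lemma mult_op_add: "mult_op \<phi> (f + g) = mult_op \<phi> f + mult_op \<phi> g"
  by (simp add: mult_op_def fun_eq_iff distrib_left)

lemma mult_op_scale: "mult_op \<phi> (c *\<^sub>C f) = c *\<^sub>C mult_op \<phi> f"
  by (simp add: mult_op_def fun_eq_iff scaleC_fun_def scaleC_complex_def)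

lemma Mult_cmult: "\<phi> \<in> Mult H \<Longrightarrow> (\<lambda>x. c * \<phi> x) \<in> Mult H"
proof -
  assume \<phi>: "\<phi> \<in> Mult H"
  have "mult_op (\<lambda>x. c * \<phi> x) f = c *\<^sub>C mult_op \<phi> f" for f
    by (simp add: mult_op_def fun_eq_iff scaleC_fun_def scaleC_complex_def)
  then show ?thesis using \<phi> by (simp add: Mult_def)
qed

lemma Mult_one_minus: "\<phi> \<in> Mult H \<Longrightarrow> (\<lambda>x. 1 - \<phi> x) \<in> Mult H"
proof -
  assume \<phi>: "\<phi> \<in> Mult H"
  have "mult_op (\<lambda>x. 1 - \<phi> x) f = f - mult_op \<phi> f" for f
    by (simp add: mult_op_def fun_eq_iff algebra_simps)
  then show ?thesis using \<phi> by (simp add: Mult_def)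
qed

lemma Mult_bounded:
  assumes \<phi>: "\<phi> \<in> Mult H"
  obtains C where "C \<ge> 0" "\<And>f. f \<in> hcarrier H \<Longrightarrow> hnorm H (mult_op \<phi> f) \<le> C * hnorm H f"
proof -
  have "\<exists>C\<ge>0. \<forall>f\<in>hcarrier H. hnorm H (mult_op \<phi> f) \<le> C * hnorm H f"
  proof (rule bounded_if_evaluations[OF hilbert_axioms])
    fix y
    show "\<exists>s\<in>hcarrier H. \<forall>g\<in>hcarrier H. mult_op \<phi> g y = hinner H g s"
      by (intro bexI[of _ "cnj (\<phi> y) *\<^sub>C kernel_at y"])
        (auto simp: inner_scale_right reproducing mult_op_def)
  qed (use \<phi> in \<open>simp add: mult_op_in\<close>)
  then show thesis using that by blast
qed

lemma mult_bounded_op: "\<phi> \<in> Mult H \<Longrightarrow> bounded_op H H (mult_op \<phi>)"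
  unfolding bounded_op_def by (metis Mult_bounded mult_op_add mult_op_in mult_op_scale)

lemma mult_adj_in: "\<lbrakk>\<phi> \<in> Mult H; g \<in> hcarrier H\<rbrakk> \<Longrightarrow> mult_adj H \<phi> g \<in> hcarrier H"
  unfolding mult_adj_def by (rule hadjoint_bounded(1)[OF hilbert_axioms hilbert_axioms mult_bounded_op])

lemma mult_adj_inner:
  "\<lbrakk>\<phi> \<in> Mult H; g \<in> hcarrier H; f \<in> hcarrier H\<rbrakk>
    \<Longrightarrow> hinner H (mult_op \<phi> f) g = hinner H f (mult_adj H \<phi> g)"
  unfolding mult_adj_def by (rule hadjoint_bounded(2)[OF hilbert_axioms hilbert_axioms mult_bounded_op])

lemma mult_adj_eqI:
  assumes "g' \<in> hcarrier H" "\<And>f. f \<in> hcarrier H \<Longrightarrow> hinner H (mult_op \<phi> f) g = hinner H f g'"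
  shows "mult_adj H \<phi> g = g'"
  unfolding mult_adj_def by (rule hadjoint_eqI[OF hilbert_axioms assms])

lemma mult_adj_add:
  assumes "\<phi> \<in> Mult H" "f \<in> hcarrier H" "g \<in> hcarrier H"
  shows "mult_adj H \<phi> (f + g) = mult_adj H \<phi> f + mult_adj H \<phi> g"
  using assms by (intro mult_adj_eqI) (simp_all add: mult_adj_in mult_op_in inner_add_right mult_adj_inner)

lemma mult_adj_scale:
  assumes "\<phi> \<in> Mult H" "f \<in> hcarrier H"
  shows "mult_adj H \<phi> (c *\<^sub>C f) = c *\<^sub>C mult_adj H \<phi> f"
  using assms by (intro mult_adj_eqI) (simp_all add: mult_adj_in mult_op_in inner_scale_right mult_adj_inner)

lemma mult_adj_commute:
  assumes "\<phi> \<in> Mult H" "\<psi> \<in> Mult H" "f \<in> hcarrier H"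
  shows "mult_adj H \<phi> (mult_adj H \<psi> f) = mult_adj H \<psi> (mult_adj H \<phi> f)"
proof (rule mult_adj_eqI)
  fix g assume g: "g \<in> hcarrier H"
  have "mult_op \<psi> (mult_op \<phi> g) = mult_op \<phi> (mult_op \<psi> g)"
    by (simp add: mult_op_def mult.left_commute)
  then show "hinner H (mult_op \<phi> g) (mult_adj H \<psi> f) = hinner H g (mult_adj H \<psi> (mult_adj H \<phi> f))"
    using assms g by (simp add: mult_adj_in mult_op_in flip: mult_adj_inner)
qed (use assms in \<open>simp add: mult_adj_in\<close>)

lemma mult_adj_kernel: "\<phi> \<in> Mult H \<Longrightarrow> mult_adj H \<phi> (kernel_at y) = cnj (\<phi> y) *\<^sub>C kernel_at y"
  by (rule mult_adj_eqI) (simp_all add: mult_op_in inner_scale_right reproducing, simp add: mult_op_def)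

text \<open>For \<open>f\<close> of norm \<open>c\<close>, the kernel \<open>c\<^sup>2 k\<close>
  minus the rank-one kernel of \<open>\<phi> f\<close> is the sum of the corresponding kernel of
  \<open>f\<close> rescaled by \<open>\<phi>\<close> and \<open>c\<^sup>2\<close> times the
  hypothesis; \<open>mem_of_psd\<close> then applies.\<close>

lemma Mult_of_psd:
  assumes "psd UNIV (\<lambda>x y. (1 - \<phi> x * cnj (\<phi> y)) * k x y)"
  shows "\<phi> \<in> Mult H"
proof -
  have "mult_op \<phi> f \<in> hcarrier H" if f: "f \<in> hcarrier H" for f
  proof (rule mem_of_psd(1))
    let ?c = "hnorm H f"
    have "psd UNIV (\<lambda>x y. \<phi> x * cnj (\<phi> y) * (of_real (?c\<^sup>2) * k x y - f x * cnj (f y)) +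
        of_real ?c * cnj (of_real ?c) * ((1 - \<phi> x * cnj (\<phi> y)) * k x y))"
      using f by (intro psd_add psd_rescale psd_of_mem assms) auto
    then show "psd UNIV (\<lambda>x y. of_real (?c\<^sup>2) * k x y - mult_op \<phi> f x * cnj (mult_op \<phi> f y))"
      by (rule psd_cong) (simp add: mult_op_def algebra_simps power2_eq_square)
  qed (use f in simp)
  then show ?thesis by (simp add: Mult_def)
qed

lemma outer_iff_adj_injective:
  assumes a: "a \<in> Mult H"
  shows "outer_mult H a \<longleftrightarrow> (\<forall>w\<in>hcarrier H. mult_adj H a w = 0 \<longrightarrow> w = 0)"
proof
  assume o: "outer_mult H a"
  show "\<forall>w\<in>hcarrier H. mult_adj H a w = 0 \<longrightarrow> w = 0"
  proof (intro ballI impI)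
    fix w assume w: "w \<in> hcarrier H" "mult_adj H a w = 0"
    show "w = 0"
    proof (rule dense_perp_zero[OF o[unfolded outer_mult_def] w(1)])
      fix x assume "x \<in> mult_op a ` hcarrier H"
      then show "hinner H x w = 0" using a w by (auto simp: mult_adj_inner)
    qed
  qed
next
  assume inj: "\<forall>w\<in>hcarrier H. mult_adj H a w = 0 \<longrightarrow> w = 0"
  show "outer_mult H a"
    unfolding outer_mult_def
  proof (rule dense_if_perp_zero)
    show "complex_vector.subspace (mult_op a ` hcarrier H)"
    proof (rule complex_vector.subspaceI)
      show "0 \<in> mult_op a ` hcarrier H" by (rule image_eqI[of _ _ 0]) (auto simp: mult_op_def)
      show "x + y \<in> mult_op a ` hcarrier H" if "x \<in> mult_op a ` hcarrier H" "y \<in> mult_op a ` hcarrier H" for x y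
        using that by (auto simp flip: mult_op_add)
      show "c *\<^sub>C x \<in> mult_op a ` hcarrier H" if "x \<in> mult_op a ` hcarrier H" for c x
        using that by (auto simp flip: mult_op_scale)
    qed
    show "mult_op a ` hcarrier H \<subseteq> hcarrier H" using a by (auto simp: mult_op_in)
    show "f = 0" if f: "f \<in> hcarrier H" and "\<And>x. x \<in> mult_op a ` hcarrier H \<Longrightarrow> hinner H x f = 0" for f
    proof -
      have "mult_adj H a f = 0" using that by (intro mult_adj_eqI) auto
      then show ?thesis using inj f by blast
    qed
  qed
qed

end

section \<open>Complete Nevanlinna-Pick spaces\<close>

locale cnp_space =
  fixes I :: "'i set" and u :: "'x \<Rightarrow> 'i \<Rightarrow> complex" and H :: "('x \<Rightarrow> complex) hilbert"
  assumes cnp_map: "cnp_map I u"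
    and rkhs: "scalar_rkhs (cnp_kernel I u) H"
begin

abbreviation k where "k \<equiv> cnp_kernel I u"

sublocale rkh_space k H
  by unfold_locales (rule rkhs)

sublocale L: semi_hilbert "ell2 I"
  by (rule ell2_semi_hilbert)

abbreviation U :: "'x \<Rightarrow> 'x \<Rightarrow> complex" where
  "U x y \<equiv> hinner (ell2 I) (u x) (u y)"

lemma u_in [simp]: "u x \<in> hcarrier (ell2 I)"
  using cnp_map by (simp add: cnp_map_def)

lemma u_norm: "hnorm (ell2 I) (u x) < 1"
  using cnp_map by (simp add: cnp_map_def)

lemma U_commute: "cnj (U x y) = U y x"
  by (rule L.inner_commute[symmetric]) auto

lemma U_less: "cmod (U x y) < 1"
proof -
  have "cmod (U x y) \<le> hnorm (ell2 I) (u x) * hnorm (ell2 I) (u y)" by (rule L.Cauchy_Schwarz) auto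
  also have "\<dots> \<le> hnorm (ell2 I) (u x) * 1" using u_norm[of y] by (intro mult_left_mono) auto
  also have "\<dots> < 1" using u_norm[of x] by simp
  finally show ?thesis .
qed

lemma U_ne: "1 - U x y \<noteq> 0"
  using U_less[of x y] by (metis eq_iff_diff_eq_0 less_irrefl norm_one)

lemma k_eq: "k x y = 1 / (1 - U x y)"
  by (simp add: cnp_kernel_def)

section \<open>Coordinate multipliers and joint eigenvectors\<close>

definition defect :: "'x \<Rightarrow> real" where
  "defect z = sqrt (1 - (hnorm (ell2 I) (u z))\<^sup>2)"

lemma defect_pos: "defect z > 0"
  unfolding defect_def using u_norm[of z] by (simp add: power_less_one_iff)

lemma U_self: "U z z = 1 - of_real (defect z) * of_real (defect z)"
proof -
  have "(hnorm (ell2 I) (u z))\<^sup>2 \<le> 1" using u_norm[of z] by (simp add: power_le_one)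
  then have "1 - defect z * defect z = (hnorm (ell2 I) (u z))\<^sup>2"
    unfolding defect_def by (simp flip: power2_eq_square)
  then have "1 - of_real (defect z) * of_real (defect z) = complex_of_real ((hnorm (ell2 I) (u z))\<^sup>2)"
    by (metis of_real_1 of_real_diff of_real_mult)
  then show ?thesis by (simp only: L.inner_self u_in)
qed

lemma one_plus_defect_ne: "(1::complex) + of_real (defect z) \<noteq> 0"
  using defect_pos[of z] by (auto simp: complex_eq_iff)

text \<open>The kernel to be shown positive equals 1 plus \<open>k x y\<close> times
  \<open>U x y - U x z * U z y\<close>, and the latter is a Gram kernel: from \<open>u x\<close> a
  multiple of its component along \<open>u z\<close> is subtracted. The factor
  \<open>?\<kappa>\<close> solves \<open>2 * ?\<kappa> - ?\<kappa>\<^sup>2 * U z z = 1\<close>; of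
  the two roots this one also makes sense when \<open>u z = 0\<close>.\<close>

lemma coordinate_Mult: "(\<lambda>x. U x z) \<in> Mult H"
proof (rule Mult_of_psd)
  let ?\<kappa> = "1 / (1 + of_real (defect z)) :: complex"
  define f where "f x = u x - (?\<kappa> * U x z) *\<^sub>C u z" for x
  have f: "f x \<in> hcarrier (ell2 I)" for x by (simp add: f_def)
  have "cnj ?\<kappa> = ?\<kappa>" by simp
  have inner_f: "hinner (ell2 I) (f x) (f y) = U x y - U x z * U z y" for x y
  proof -
    have "hinner (ell2 I) (f x) (f y) = U x y - U x z * U z y * (2 * ?\<kappa> - ?\<kappa> * ?\<kappa> * U z z)"
      unfolding f_def
      by (simp only: L.inner_simps L.carrier_closed u_in complex_cnj_mult U_commute \<open>cnj ?\<kappa> = ?\<kappa>\<close>)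
        (simp add: algebra_simps)
    also have "2 * ?\<kappa> - ?\<kappa> * ?\<kappa> * U z z = 1"
    proof -
      have "?\<kappa> * (1 + of_real (defect z)) = 1" using one_plus_defect_ne[of z] by simp
      then show ?thesis unfolding U_self by algebra
    qed
    finally show ?thesis by simp
  qed
  have "psd UNIV (\<lambda>x y. 1 * cnj 1 + k x y * hinner (ell2 I) (f x) (f y))"
    by (intro psd_add psd_rank_one psd_schur_ell2 kernel_psd f)
  then show "psd UNIV (\<lambda>x y. (1 - U x z * cnj (U y z)) * k x y)"
    by (rule psd_cong) (use U_ne in \<open>simp add: inner_f k_eq U_commute field_simps\<close>)
qed

text \<open>The multiplier \<open>?\<psi>\<close> is the reciprocal of the kernel function at
  \<open>z\<close>, so it maps that function to the constant 1. Moving it to the other side, where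
  it acts as a scalar, expresses \<open>f z\<close> through the single number
  \<open>hinner H ?one f\<close>.\<close>

lemma joint_eigenvector:
  assumes f: "f \<in> hcarrier H"
    and eig: "\<And>\<phi>. \<phi> \<in> Mult H \<Longrightarrow> mult_adj H \<phi> f = cnj (\<phi> y) *\<^sub>C f"
  obtains c where "f = c *\<^sub>C kernel_at y"
proof -
  let ?one = "\<lambda>x. 1 :: complex"
  have "f z = cnj (hinner H ?one f) * k z y" for z
  proof -
    let ?\<psi> = "\<lambda>x. 1 - U x z"
    have \<psi>: "?\<psi> \<in> Mult H" by (rule Mult_one_minus[OF coordinate_Mult])
    have "mult_op ?\<psi> (kernel_at z) = ?one" using U_ne by (simp add: mult_op_def k_eq)
    then have "hinner H ?one f = hinner H (kernel_at z) (mult_adj H ?\<psi> f)"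
      using mult_adj_inner[OF \<psi> f kernel_in, of z] by simp
    also have "\<dots> = ?\<psi> y * cnj (f z)"
      unfolding eig[OF \<psi>] using f by (subst inner_scale_right) (simp_all add: reproducing')
    finally have "cnj (hinner H ?one f) = (1 - U z y) * f z" by (simp add: U_commute)
    then show ?thesis using U_ne[of z y] by (simp add: k_eq)
  qed
  then have "f = cnj (hinner H ?one f) *\<^sub>C kernel_at y"
    by (simp add: fun_eq_iff scaleC_fun_def scaleC_complex_def)
  then show thesis by (rule that)
qed

text \<open>This is the automorphism of the unit ball interchanging \<open>0\<close> and \<open>u z\<close>.\<close>

definition moebius :: "'x \<Rightarrow> 'x \<Rightarrow> 'i \<Rightarrow> complex" where
  "moebius z x = (1 / (1 - U x z)) *\<^sub>C
     ((1 - U x z / (1 + of_real (defect z))) *\<^sub>C u z - of_real (defect z) *\<^sub>C u x)"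

lemma moebius_in [simp]: "moebius z x \<in> hcarrier (ell2 I)"
  by (simp add: moebius_def)

text \<open>The classical identity for ball automorphisms. In terms of the kernel, the quotient on
  the right is \<open>k x z * k z y / (k x y * k z z)\<close>.\<close>

lemma inner_moebius:
  "hinner (ell2 I) (moebius z x) (moebius z y) =
    1 - (1 - U x y) * (1 - U z z) / ((1 - U x z) * (1 - U z y))"
proof -
  define s where "s = complex_of_real (defect z)"
  define \<kappa> where "\<kappa> = 1 / (1 + s)"
  have \<kappa>: "\<kappa> * (1 + s) = 1" using one_plus_defect_ne[of z] by (simp add: \<kappa>_def s_def)
  have cnj [simp]: "cnj s = s" "cnj \<kappa> = \<kappa>" by (simp_all add: s_def \<kappa>_def)
  have self: "U z z = 1 - s * s" by (simp add: U_self s_def)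
  let ?n = "\<lambda>x. (1 - U x z * \<kappa>) *\<^sub>C u z - s *\<^sub>C u x"
  have moebius: "moebius z x = (1 / (1 - U x z)) *\<^sub>C ?n x" for x
    by (simp add: moebius_def s_def \<kappa>_def)
  have "hinner (ell2 I) (?n x) (?n y) =
      (1 - U x z * \<kappa>) * (1 - U z y * \<kappa>) * U z z
      - s * (1 - U x z * \<kappa>) * U z y - s * U x z * (1 - U z y * \<kappa>) + s * s * U x y"
    by (simp add: L.inner_simps U_commute) (simp add: algebra_simps)
  also have "\<dots> = (1 - U x z) * (1 - U z y) - (1 - U x y) * (1 - U z z)"
    unfolding self using \<kappa> by algebra
  finally have "hinner (ell2 I) (?n x) (?n y) = (1 - U x z) * (1 - U z y) - (1 - U x y) * (1 - U z z)" .
  then have "hinner (ell2 I) (moebius z x) (moebius z y) =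
      (1 / (1 - U x z)) * ((1 / (1 - U z y)) * ((1 - U x z) * (1 - U z y) - (1 - U x y) * (1 - U z z)))"
    unfolding moebius by (simp add: L.inner_scale_left L.inner_scale_right U_commute)
  moreover have "(1 / a) * ((1 / b) * (a * b - n)) = 1 - n / (a * b)" if "a \<noteq> 0" "b \<noteq> 0" for a b n :: complex
    using that by (simp add: field_simps)
  ultimately show ?thesis using U_ne by metis
qed

end

section \<open>The Toeplitz corona theorem\<close>

text \<open>A node \<open>(x, c, d, t)\<close> prescribes the value \<open>c u(x) + d v(x) = t\<close> of a column multiplier \<open>(u, v)\<close>; the
  Pick kernel of a set of nodes is positive semidefinite iff the data have a solution of norm at most
  one.\<close>

type_synonym 'x node = "'x \<times> complex \<times> complex \<times> complex"

fun pick :: "('x \<Rightarrow> 'x \<Rightarrow> complex) \<Rightarrow> 'x node \<Rightarrow> 'x node \<Rightarrow> complex" where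
  "pick k (x, c, d, t) (y, c', d', t') = (c * cnj c' + d * cnj d' - t * cnj t') * k x y"

context cnp_space
begin

lemma pick_commute: "pick k q p = cnj (pick k p q)"
  by (cases p; cases q, simp only: pick.simps complex_cnj_mult, subst kernel_commute) (simp add: mult_ac)

lemma k_self_pos: "Re (k z z) > 0" and k_self_real: "k z z = of_real (Re (k z z))"
proof -
  have d: "k z z = of_real (1 / (defect z * defect z))"
    by (simp add: k_eq U_self)
  then show "Re (k z z) > 0" using defect_pos[of z] by simp
  show "k z z = of_real (Re (k z z))" by (subst (1 2) d) simp
qed

text \<open>The right-hand side is the reproducing kernel of the functions in \<open>H\<close> that
  vanish at \<open>z\<close>; the left-hand side exhibits its quotient by \<open>k\<close> as a Gram
  kernel, so \<open>psd_schur_ell2\<close> can be applied to it.\<close>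

lemma k_compress:
  "k x y * hinner (ell2 I) (moebius z x) (moebius z y) = k x y - k x z * k z y / k z z"
  using U_ne[of x z] U_ne[of z y] U_ne[of z z] U_ne[of x y]
  by (simp add: inner_moebius k_eq) (simp add: field_simps)

text \<open>One-step extension: prescribing a value at a further node \<open>(z, c, d)\<close> amounts to extending a
  function from \<open>\<Lambda>\<close> to an additional point in the unit ball of the space whose kernel is \<open>K\<close> below,
  obtained from the Pick kernel by compressing to the orthogonal complement of \<open>k\<^sub>z\<close> in the values.\<close>

lemma pick_extend:
  assumes \<Lambda>: "psd \<Lambda> (pick k)"
  shows "\<exists>t. psd (insert (z, c, d, t) \<Lambda>) (pick k)"
proof (cases "(z, c, d, 0) \<in> \<Lambda>")
  case True
  then show ?thesis using \<Lambda> by (metis insert_absorb)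
next
  case False
  \<comment> \<open>A placeholder whose value 0 is provisional. The kernel \<open>K\<close> below
    does not depend on the value stored at a node over \<open>z\<close>, because
    \<open>k * M\<close> vanishes there.\<close>
  let ?v = "(z, c, d, 0) :: 'x node"
  define s where "s = complex_of_real (sqrt (Re (k z z)))"
  have s: "s \<noteq> 0" "cnj s = s" "s * s = k z z"
    using k_self_pos[of z] k_self_real[of z] by (auto simp: s_def simp flip: of_real_mult)
  \<comment> \<open>The normalised kernel function at \<open>z\<close>: its rank-one kernel is
    exactly the part of \<open>k\<close> removed by the compression.\<close>
  define g where "g x = k x z / s" for x
  have gg: "g x * cnj (g y) = k x z * k z y / k z z" for x y
    using s kernel_commute[of z y] by (simp add: g_def)
  have gz: "g z = s" using s by (simp add: g_def field_simps)
  define t where "t p = snd (snd (snd p))" for p :: "'x node"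
  define \<gamma> where "\<gamma> p = g (fst p)" for p :: "'x node"
  define c1 where "c1 p = fst (snd p)" for p :: "'x node"
  define c2 where "c2 p = fst (snd (snd p))" for p :: "'x node"
  define M where "M p q = hinner (ell2 I) (moebius z (fst p)) (moebius z (fst q))" for p q :: "'x node"
  have pick: "pick k p q = (c1 p * cnj (c1 q) + c2 p * cnj (c2 q) - t p * cnj (t q)) * k (fst p) (fst q)" for p q
    by (cases p; cases q) (simp add: c1_def c2_def t_def)
  have compress: "k (fst p) (fst q) * M p q = k (fst p) (fst q) - \<gamma> p * cnj (\<gamma> q)" for p q
    by (simp add: M_def \<gamma>_def k_compress gg)
  have M_commute: "M q p = cnj (M p q)" for p q
    unfolding M_def by (rule L.inner_commute) auto
  have moebius_self: "k x z * hinner (ell2 I) (moebius z x) (moebius z z) = 0"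
    "k z x * hinner (ell2 I) (moebius z z) (moebius z x) = 0" for x
    using s(1,3) by (auto simp: k_compress)
  have kM_zero: "k (fst p) (fst q) * M p q = 0" if "fst p = z \<or> fst q = z" for p q
    using that moebius_self by (auto simp: M_def)
  \<comment> \<open>Split \<open>k\<close> into \<open>k * M\<close> and the rank-one part. On
    \<open>\<Lambda>\<close> the Pick kernel is then \<open>K\<close> minus the rank-one kernel of
    \<open>f\<close>, so the Pick condition says that \<open>f\<close> lies in the unit ball for
    \<open>K\<close>.\<close>
  define K where "K p q = pick k p q * M p q +
      ((c1 p * \<gamma> p) * cnj (c1 q * \<gamma> q) + (c2 p * \<gamma> p) * cnj (c2 q * \<gamma> q))" for p q
  define f where "f p = t p * \<gamma> p" for p
  have K_eq: "K p q = (c1 p * cnj (c1 q) + c2 p * cnj (c2 q) - t p * cnj (t q)) * (k (fst p) (fst q) * M p q) +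
      (c1 p * cnj (c1 q) + c2 p * cnj (c2 q)) * (\<gamma> p * cnj (\<gamma> q))" for p q
    by (simp add: K_def pick algebra_simps)
  have "psd (insert ?v \<Lambda>) (\<lambda>p q. pick k p q * M p q)"
  proof (rule psd_insert_zero)
    show "psd \<Lambda> (\<lambda>p q. pick k p q * M p q)"
      unfolding M_def by (rule psd_schur_ell2[OF \<Lambda>]) auto
    show "pick k p ?v * M p ?v = 0" "pick k ?v p * M ?v p = 0" for p
      using kM_zero[of p ?v] kM_zero[of ?v p] by (simp_all add: pick del: pick.simps)
  qed
  then have K_psd: "psd (insert ?v \<Lambda>) K"
    unfolding K_def by (intro psd_add psd_rank_one)
  have K_commute: "K q p = cnj (K p q)" for p q
    by (simp add: K_def pick_commute[of q p] M_commute[of q p])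
  have f_psd: "psd \<Lambda> (\<lambda>p q. K p q - f p * cnj (f q))"
  proof (rule psd_cong[OF \<Lambda>])
    fix p q
    have "K p q - f p * cnj (f q) = (c1 p * cnj (c1 q) + c2 p * cnj (c2 q) - t p * cnj (t q)) *
        (k (fst p) (fst q) * M p q + \<gamma> p * cnj (\<gamma> q))"
      unfolding K_eq f_def by (simp add: algebra_simps)
    then show "K p q - f p * cnj (f q) = pick k p q" unfolding pick compress by simp
  qed
  obtain \<tau> where \<tau>: "psd (insert ?v \<Lambda>) (\<lambda>p q. K p q - (f(?v := \<tau>)) p * cnj ((f(?v := \<tau>)) q))"
    using psd_extend[OF K_psd K_commute f_psd False] .
  \<comment> \<open>At a node over \<open>z\<close> the function \<open>f\<close> stores the
    prescribed value times \<open>g z = s\<close>, hence the division.\<close>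
  define w where "w = (z, c, d, \<tau> / s)"
  define \<pi> where "\<pi> p = (if p = ?v then w else p)" for p
  have "psd (insert ?v \<Lambda>) (\<lambda>p q. pick k (\<pi> p) (\<pi> q))"
  proof (rule psd_cong[OF \<tau>])
    fix p q
    have \<pi>: "fst (\<pi> p) = fst p" "c1 (\<pi> p) = c1 p" "c2 (\<pi> p) = c2 p" for p
      by (auto simp: \<pi>_def w_def c1_def c2_def)
    have f': "(f(?v := \<tau>)) p = t (\<pi> p) * \<gamma> p" for p
      using s by (auto simp: f_def \<pi>_def w_def t_def \<gamma>_def gz)
    have "(t p * cnj (t q)) * (k (fst p) (fst q) * M p q) = (t (\<pi> p) * cnj (t (\<pi> q))) * (k (fst p) (fst q) * M p q)"
      using kM_zero[of p q] by (auto simp: \<pi>_def)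
    moreover have "K p q = (c1 p * cnj (c1 q) + c2 p * cnj (c2 q)) * (k (fst p) (fst q) * M p q) -
        (t p * cnj (t q)) * (k (fst p) (fst q) * M p q) +
        (c1 p * cnj (c1 q) + c2 p * cnj (c2 q)) * (\<gamma> p * cnj (\<gamma> q))"
      unfolding K_eq by (simp only: left_diff_distrib)
    ultimately have "K p q - (t (\<pi> p) * \<gamma> p) * cnj (t (\<pi> q) * \<gamma> q) =
      (c1 p * cnj (c1 q) + c2 p * cnj (c2 q) - t (\<pi> p) * cnj (t (\<pi> q))) * (k (fst p) (fst q) * M p q + \<gamma> p * cnj (\<gamma> q))"
      by (simp only:) (simp add: algebra_simps)
    then show "pick k (\<pi> p) (\<pi> q) = K p q - (f(?v := \<tau>)) p * cnj ((f(?v := \<tau>)) q)"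
      unfolding f' pick \<pi> compress by simp
  qed
  then have "psd (\<pi> ` insert ?v \<Lambda>) (pick k)" by (rule psd_image)
  \<comment> \<open>Nodes of \<open>\<Lambda>\<close> are fixed by \<open>\<pi>\<close> because the
    placeholder is not among them.\<close>
  moreover have "insert w \<Lambda> \<subseteq> \<pi> ` insert ?v \<Lambda>"
    using False by (force simp: \<pi>_def)
  ultimately have "psd (insert w \<Lambda>) (pick k)" by (rule psd_mono)
  then show ?thesis unfolding w_def by blast
qed

text \<open>A maximal positive set of nodes answers every query \<open>(z, c, d)\<close>, since
  otherwise \<open>pick_extend\<close> would enlarge it.\<close>

lemma pick_maximal:
  assumes "psd \<Lambda> (pick k)"
  obtains M where "\<Lambda> \<subseteq> M" "psd M (pick k)" "\<And>z c d. \<exists>t. (z, c, d, t) \<in> M"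
proof -
  define \<A> where "\<A> = {M. \<Lambda> \<subseteq> M \<and> psd M (pick k)}"
  have "\<exists>M\<in>\<A>. \<forall>X\<in>\<A>. M \<subseteq> X \<longrightarrow> X = M"
  proof (rule subset_Zorn_nonempty)
    show "\<A> \<noteq> {}" using assms by (auto simp: \<A>_def)
    fix \<C> assume C: "\<C> \<noteq> {}" "subset.chain \<A> \<C>"
    then have "\<C> \<subseteq> \<A>" by (simp add: subset.chain_def)
    then show "\<Union>\<C> \<in> \<A>"
      using C(1) psd_Union_chain[OF C] by (auto simp: \<A>_def)
  qed
  then obtain M where M: "M \<in> \<A>" "\<And>X. \<lbrakk>X \<in> \<A>; M \<subseteq> X\<rbrakk> \<Longrightarrow> X = M" by blast
  have "\<exists>t. (z, c, d, t) \<in> M" for z c d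
  proof -
    obtain t where "psd (insert (z, c, d, t) M) (pick k)"
      using pick_extend[of M z c d] M(1) by (auto simp: \<A>_def)
    then have "insert (z, c, d, t) M = M" using M by (intro M(2)) (auto simp: \<A>_def)
    then show ?thesis by blast
  qed
  then show thesis using that M(1) by (auto simp: \<A>_def)
qed

text \<open>The hypothesis is the Pick condition for the nodes prescribing
  \<open>a x * F x + b x * G x = \<delta>\<close>. In a maximal extension the values at the
  functionals \<open>(1, 0)\<close> and \<open>(0, 1)\<close> give contractive multipliers
  \<open>F\<close> and \<open>G\<close>; dividing by \<open>\<delta>\<close> solves the corona
  equation.\<close>

lemma toeplitz_corona:
  fixes \<delta> :: real
  assumes \<delta>: "\<delta> > 0"
    and psd: "psd UNIV (\<lambda>x y. (a x * cnj (a y) + b x * cnj (b y) - of_real (\<delta>\<^sup>2)) * k x y)"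
  obtains \<phi> \<psi> where "\<phi> \<in> Mult H" "\<psi> \<in> Mult H" "\<And>x. a x * \<phi> x + b x * \<psi> x = 1"
proof -
  let ?\<delta> = "complex_of_real \<delta>"
  let ?\<pi> = "\<lambda>x. (x, a x, b x, ?\<delta>)"
  have "psd (range ?\<pi>) (pick k)"
    by (rule psd_image, rule psd_cong[OF psd]) (simp add: power2_eq_square)
  then obtain M where M: "range ?\<pi> \<subseteq> M" "psd M (pick k)" "\<And>z c d. \<exists>t. (z, c, d, t) \<in> M"
    using pick_maximal by blast
  obtain F G where F: "\<And>x. (x, 1, 0, F x) \<in> M" and G: "\<And>x. (x, 0, 1, G x) \<in> M"
  proof -
    have "\<forall>x. \<exists>t. (x, 1, 0, t) \<in> M" "\<forall>x. \<exists>t. (x, 0, 1, t) \<in> M" using M(3) by blast+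
    then show thesis using that by metis
  qed
  have "psd UNIV (\<lambda>x y. pick k (x, 1, 0, F x) (y, 1, 0, F y))"
    by (rule psd_vimage, rule psd_mono[OF M(2)]) (use F in \<open>auto simp: inj_on_def\<close>)
  then have F_Mult: "F \<in> Mult H" by (intro Mult_of_psd) simp
  have "psd UNIV (\<lambda>x y. pick k (x, 0, 1, G x) (y, 0, 1, G y))"
    by (rule psd_vimage, rule psd_mono[OF M(2)]) (use G in \<open>auto simp: inj_on_def\<close>)
  then have G_Mult: "G \<in> Mult H" by (intro Mult_of_psd) simp
  interpret P: semi_hilbert "kernel_space M (pick k)"
    by (rule kernel_space_semi_hilbert[OF M(2) pick_commute])
  have solves: "a x * F x + b x * G x = ?\<delta>" for x
  proof -
    let ?p = "?\<pi> x" and ?q = "(x, 1, 0, F x)" and ?r = "(x, 0, 1, G x)"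
    define e where "e = ?\<delta> - a x * F x - b x * G x"
    have in_M: "point_mass ?p \<in> weights M" "point_mass ?q \<in> weights M" "point_mass ?r \<in> weights M"
      using M(1) F G by (auto intro: point_mass_weights)
    \<comment> \<open>The coefficients cancel the \<open>c\<close> and \<open>d\<close> entries of
      the three nodes over \<open>x\<close> and leave only the value \<open>e\<close>, which enters
      the Pick kernel with a negative sign.\<close>
    define w where "w = point_mass ?p - a x *\<^sub>C point_mass ?q - b x *\<^sub>C point_mass ?r"
    have pm: "kernel_form (pick k) (point_mass p) (point_mass q) = pick k p q" for p q :: "'x node"
      by (simp add: kernel_form_def point_mass_def)
    note inner = P.inner_diff_left P.inner_diff_right P.inner_scale_left P.inner_scale_right
    have "w \<in> hcarrier (kernel_space M (pick k))"
      unfolding w_def using in_M by (intro P.carrier_closed) simp_all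
    then have "0 \<le> Re (hinner (kernel_space M (pick k)) w w)" by (rule P.inner_nonneg)
    also have "hinner (kernel_space M (pick k)) w w = - (e * cnj e) * k x x"
    proof -
      have p: "?p \<in> M" using M(1) by auto
      have "point_mass p \<in> hcarrier (kernel_space M (pick k))" if "p \<in> M" for p
        using point_mass_weights[OF that] by simp
      note mem = this[OF p] this[OF F, of x] this[OF G, of x]
      have "hinner (kernel_space M (pick k)) (point_mass p) (point_mass q) = pick k p q" for p q
        by (simp add: pm)
      note inner = inner this
      show ?thesis unfolding w_def e_def
        by (simp only: inner P.carrier_closed mem) (simp add: algebra_simps)
    qed
    also have "Re (- (e * cnj e) * k x x) = - (cmod e)\<^sup>2 * Re (k x x)"
      by (subst k_self_real, subst complex_norm_square[symmetric]) simp
    finally have "(cmod e)\<^sup>2 * Re (k x x) \<le> 0" by simp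
    then have "e = 0" using k_self_pos[of x] by (simp add: mult_le_0_iff not_le)
    then show ?thesis by (simp add: e_def diff_diff_eq)
  qed
  show thesis
  proof (rule that[of "\<lambda>x. (1 / ?\<delta>) * F x" "\<lambda>x. (1 / ?\<delta>) * G x"])
    fix x
    have "a x * ((1 / ?\<delta>) * F x) + b x * ((1 / ?\<delta>) * G x) = (a x * F x + b x * G x) / ?\<delta>"
      by (simp add: add_divide_distrib)
    then show "a x * ((1 / ?\<delta>) * F x) + b x * ((1 / ?\<delta>) * G x) = 1"
      using \<delta> by (simp add: solves)
  qed (intro Mult_cmult F_Mult G_Mult)+
qed

end

section \<open>Adjoints of densely defined multipliers\<close>

text \<open>Membership and norm bounds are read off the kernel in one space and turned back into
  membership in the other; used in both directions this gives equality.\<close>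

lemma rkh_space_unique:
  assumes "rkh_space K H\<^sub>1" "rkh_space K H\<^sub>2" "f \<in> hcarrier H\<^sub>1"
  shows "f \<in> hcarrier H\<^sub>2" "hnorm H\<^sub>2 f \<le> hnorm H\<^sub>1 f"
proof -
  interpret H1: rkh_space K H\<^sub>1 by fact
  interpret H2: rkh_space K H\<^sub>2 by fact
  have "psd UNIV (\<lambda>x y. of_real ((hnorm H\<^sub>1 f)\<^sup>2) * K x y - f x * cnj (f y))"
    using assms(3) by (intro H1.psd_of_mem) auto
  from H2.mem_of_psd[OF this] assms(3) show "f \<in> hcarrier H\<^sub>2" "hnorm H\<^sub>2 f \<le> hnorm H\<^sub>1 f" by auto
qed

context rkh_space
begin

text \<open>The graph of the adjoint of multiplication by \<open>h\<close>, kept as a relation since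
  it is single-valued only when the domain of \<open>h\<close> is dense.\<close>

definition adjoint_rel :: "('x \<Rightarrow> complex) \<Rightarrow> ('x \<Rightarrow> complex) \<Rightarrow> ('x \<Rightarrow> complex) \<Rightarrow> bool" where
  "adjoint_rel h g f \<longleftrightarrow> g \<in> hcarrier H \<and> f \<in> hcarrier H \<and>
     (\<forall>m\<in>mult_dom H h. hinner H (mult_op h m) g = hinner H m f)"

lemma adjoint_relD:
  "adjoint_rel h g f \<Longrightarrow> g \<in> hcarrier H" "adjoint_rel h g f \<Longrightarrow> f \<in> hcarrier H"
  "\<lbrakk>adjoint_rel h g f; m \<in> mult_dom H h\<rbrakk> \<Longrightarrow> hinner H (mult_op h m) g = hinner H m f"
  by (auto simp: adjoint_rel_def)

lemma mult_domD: "m \<in> mult_dom H h \<Longrightarrow> m \<in> hcarrier H" "m \<in> mult_dom H h \<Longrightarrow> mult_op h m \<in> hcarrier H"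
  by (auto simp: mult_dom_def)

lemma adjoint_rel_add:
  assumes "adjoint_rel h g f" "adjoint_rel h g' f'"
  shows "adjoint_rel h (g + g') (f + f')"
  unfolding adjoint_rel_def
proof (intro conjI ballI carrier_closed)
  fix m assume m: "m \<in> mult_dom H h"
  show "hinner H (mult_op h m) (g + g') = hinner H m (f + f')"
    using adjoint_relD[OF assms(1)] adjoint_relD[OF assms(2)] mult_domD[OF m] m
    by (subst (1 2) inner_add_right) simp_all
qed (use assms in \<open>simp_all add: adjoint_relD\<close>)

lemma adjoint_rel_scale:
  assumes "adjoint_rel h g f"
  shows "adjoint_rel h (c *\<^sub>C g) (c *\<^sub>C f)"
  unfolding adjoint_rel_def
proof (intro conjI ballI carrier_closed)
  fix m assume m: "m \<in> mult_dom H h"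
  show "hinner H (mult_op h m) (c *\<^sub>C g) = hinner H m (c *\<^sub>C f)"
    using adjoint_relD[OF assms] mult_domD[OF m] m by (subst (1 2) inner_scale_right) simp_all
qed (use assms in \<open>simp_all add: adjoint_relD\<close>)

lemma adjoint_rel_kernel: "adjoint_rel h (kernel_at y) (cnj (h y) *\<^sub>C kernel_at y)"
  unfolding adjoint_rel_def
  by (auto simp: inner_scale_right reproducing mult_dom_def) (simp add: mult_op_def)

text \<open>Closedness of the adjoint, which makes its domain complete in the graph norm.\<close>

lemma adjoint_rel_limit:
  assumes rel: "\<And>n. adjoint_rel h (s n) (t n)"
    and "g \<in> hcarrier H" "(\<lambda>n. hnorm H (s n - g)) \<longlonglongrightarrow> 0"
    and "f \<in> hcarrier H" "(\<lambda>n. hnorm H (t n - f)) \<longlonglongrightarrow> 0"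
  shows "adjoint_rel h g f"
  unfolding adjoint_rel_def
proof (intro conjI ballI assms)
  fix m assume m: "m \<in> mult_dom H h"
  have "(\<lambda>n. hinner H (mult_op h m) (s n)) \<longlonglongrightarrow> hinner H (mult_op h m) g"
    using assms m by (intro inner_tendsto) (auto dest: mult_domD adjoint_relD)
  moreover have "(\<lambda>n. hinner H m (t n)) \<longlonglongrightarrow> hinner H m f"
    using assms m by (intro inner_tendsto) (auto dest: mult_domD adjoint_relD)
  ultimately show "hinner H (mult_op h m) g = hinner H m f"
    using adjoint_relD(3)[OF rel m] LIMSEQ_unique by simp
qed

end

locale dense_multiplier = rkh_space k H
  for k :: "'x \<Rightarrow> 'x \<Rightarrow> complex" and H +
  fixes h :: "'x \<Rightarrow> complex"
  assumes dense: "densely_defined_multiplier H h"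
begin

lemma adjoint_rel_unique: "\<lbrakk>adjoint_rel h g f; adjoint_rel h g f'\<rbrakk> \<Longrightarrow> f = f'"
proof -
  assume r: "adjoint_rel h g f" "adjoint_rel h g f'"
  have "f - f' = 0"
  proof (rule dense_perp_zero[OF dense[unfolded densely_defined_multiplier_def]])
    show "f - f' \<in> hcarrier H" using r by (auto dest: adjoint_relD)
    fix m assume m: "m \<in> mult_dom H h"
    show "hinner H m (f - f') = 0"
      using adjoint_relD(3)[OF r(1) m] adjoint_relD(3)[OF r(2) m] adjoint_relD(2)[OF r(1)]
        adjoint_relD(2)[OF r(2)] mult_domD(1)[OF m] by (simp add: inner_diff_right)
  qed
  then show ?thesis by simp
qed

definition adj :: "('x \<Rightarrow> complex) \<Rightarrow> 'x \<Rightarrow> complex" where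
  "adj g = (THE f. adjoint_rel h g f)"

lemma adj_eq: "adjoint_rel h g f \<Longrightarrow> adj g = f"
  unfolding adj_def using adjoint_rel_unique by blast

definition adj_dom :: "('x \<Rightarrow> complex) set" where
  "adj_dom = {g. \<exists>f. adjoint_rel h g f}"

lemma adj_domD: "g \<in> adj_dom \<Longrightarrow> adjoint_rel h g (adj g)"
  using adj_eq by (auto simp: adj_dom_def)

lemma adj_dom_closed:
  "0 \<in> adj_dom"
  "\<lbrakk>g \<in> adj_dom; g' \<in> adj_dom\<rbrakk> \<Longrightarrow> g + g' \<in> adj_dom"
  "g \<in> adj_dom \<Longrightarrow> c *\<^sub>C g \<in> adj_dom"
proof -
  have "adjoint_rel h 0 0" unfolding adjoint_rel_def
    by (intro conjI ballI carrier_closed) (simp only: inner_zero mult_domD)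
  then show "0 \<in> adj_dom" unfolding adj_dom_def by blast
  show "g + g' \<in> adj_dom" if "g \<in> adj_dom" "g' \<in> adj_dom"
    using adjoint_rel_add[OF adj_domD[OF that(1)] adj_domD[OF that(2)]] unfolding adj_dom_def by blast
  show "c *\<^sub>C g \<in> adj_dom" if "g \<in> adj_dom"
    using adjoint_rel_scale[OF adj_domD[OF that]] unfolding adj_dom_def by blast
qed

lemma adj_add: "\<lbrakk>g \<in> adj_dom; g' \<in> adj_dom\<rbrakk> \<Longrightarrow> adj (g + g') = adj g + adj g'"
  by (rule adj_eq) (intro adjoint_rel_add adj_domD)

lemma adj_scale: "g \<in> adj_dom \<Longrightarrow> adj (c *\<^sub>C g) = c *\<^sub>C adj g"
  by (rule adj_eq) (intro adjoint_rel_scale adj_domD)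

lemma adj_in: "g \<in> adj_dom \<Longrightarrow> g \<in> hcarrier H" "g \<in> adj_dom \<Longrightarrow> adj g \<in> hcarrier H"
  using adj_domD adjoint_relD by blast+

definition adj_graph :: "('x \<Rightarrow> complex) hilbert" where
  "adj_graph = \<lparr>hcarrier = adj_dom, hinner = (\<lambda>g g'. hinner H g g' + hinner H (adj g) (adj g'))\<rparr>"

lemma adj_graph_simps [simp]:
  "hcarrier adj_graph = adj_dom"
  "hinner adj_graph g g' = hinner H g g' + hinner H (adj g) (adj g')"
  by (simp_all add: adj_graph_def)

lemma adj_graph_norm:
  "g \<in> adj_dom \<Longrightarrow> (hnorm adj_graph g)\<^sup>2 = (hnorm H g)\<^sup>2 + (hnorm H (adj g))\<^sup>2"
  by (simp add: hnorm_def inner_nonneg adj_in)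

lemma adj_graph_norm_ge:
  assumes "g \<in> adj_dom"
  shows "hnorm H g \<le> hnorm adj_graph g" "hnorm H (adj g) \<le> hnorm adj_graph g"
  using assms by (auto simp: hnorm_def inner_nonneg adj_in)

lemma adj_graph_semi_hilbert: "semi_hilbert adj_graph"
proof
  show "complex_vector.subspace (hcarrier adj_graph)"
    by (rule complex_vector.subspaceI) (simp_all only: adj_graph_simps adj_dom_closed)
  show "0 \<le> Re (hinner adj_graph f f)" if "f \<in> hcarrier adj_graph" for f
    using that by (simp add: inner_nonneg adj_in)
  show "hinner adj_graph (f + g) l = hinner adj_graph f l + hinner adj_graph g l"
    if "f \<in> hcarrier adj_graph" "g \<in> hcarrier adj_graph" "l \<in> hcarrier adj_graph" for f g l
    using that by (simp add: adj_add inner_add_left adj_in)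
  show "hinner adj_graph (c *\<^sub>C f) g = c * hinner adj_graph f g"
    if "f \<in> hcarrier adj_graph" "g \<in> hcarrier adj_graph" for f g c
    using that by (simp add: adj_scale inner_scale_left adj_in distrib_left)
  show "hinner adj_graph g f = cnj (hinner adj_graph f g)"
    if "f \<in> hcarrier adj_graph" "g \<in> hcarrier adj_graph" for f g
    using that inner_commute[of f g] inner_commute[of "adj f" "adj g"] by (simp add: adj_in)
qed

lemma adj_graph_hilbert: "hilbert adj_graph"
proof -
  interpret G: semi_hilbert adj_graph by (rule adj_graph_semi_hilbert)
  have diff: "f - g \<in> adj_dom" "adj (f - g) = adj f - adj g" if "f \<in> adj_dom" "g \<in> adj_dom" for f g
  proof -
    show *: "f - g \<in> adj_dom" using G.carrier_closed(3)[of f g] that by simp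
    show "adj (f - g) = adj f - adj g" using adj_add[OF * that(2)] by simp
  qed
  show ?thesis
  proof
    show "f = 0" if f: "f \<in> hcarrier adj_graph" "hinner adj_graph f f = 0" for f
    proof -
      have "(hnorm adj_graph f)\<^sup>2 = 0" using f G.norm_sq[of f] by simp
      then have "hnorm H f = 0" using adj_graph_norm_ge(1)[of f] f norm_nonneg[OF adj_in(1), of f] by simp
      then show "f = 0" using norm_eq_zero f adj_in by auto
    qed
    fix s assume s: "\<And>n::nat. s n \<in> hcarrier adj_graph"
      and c: "\<forall>e>0. \<exists>N. \<forall>m\<ge>N. \<forall>n\<ge>N. hnorm adj_graph (s m - s n) < e"
    have s': "s n \<in> adj_dom" for n using s by simp
    have "\<forall>e>0. \<exists>N. \<forall>m\<ge>N. \<forall>n\<ge>N. hnorm H (s m - s n) < e"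
      using c adj_graph_norm_ge(1)[OF diff(1)[OF s' s']] by (meson le_less_trans)
    then obtain g where g: "g \<in> hcarrier H" "(\<lambda>n. hnorm H (s n - g)) \<longlonglongrightarrow> 0"
      using complete[of s] adj_in(1)[OF s'] by blast
    have "\<forall>e>0. \<exists>N. \<forall>m\<ge>N. \<forall>n\<ge>N. hnorm H (adj (s m) - adj (s n)) < e"
      using c adj_graph_norm_ge(2)[OF diff(1)[OF s' s']] diff(2)[OF s' s'] by (metis le_less_trans)
    then obtain f where f: "f \<in> hcarrier H" "(\<lambda>n. hnorm H (adj (s n) - f)) \<longlonglongrightarrow> 0"
      using complete[of "\<lambda>n. adj (s n)"] adj_in(2)[OF s'] by blast
    have rel: "adjoint_rel h g f" by (rule adjoint_rel_limit[OF adj_domD[OF s'] g f])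
    then have g': "g \<in> adj_dom" and adj_g: "adj g = f" by (auto simp: adj_dom_def adj_eq)
    have "hnorm adj_graph (s n - g) = sqrt ((hnorm H (s n - g))\<^sup>2 + (hnorm H (adj (s n) - f))\<^sup>2)" for n
      using adj_graph_norm[OF diff(1)[OF s'[of n] g']] diff(2)[OF s'[of n] g'] adj_g
        G.norm_nonneg[of "s n - g"] diff(1)[OF s'[of n] g'] by (metis adj_graph_simps(1) real_sqrt_unique)
    moreover have "(\<lambda>n. sqrt ((hnorm H (s n - g))\<^sup>2 + (hnorm H (adj (s n) - f))\<^sup>2)) \<longlonglongrightarrow> sqrt (0\<^sup>2 + 0\<^sup>2)"
      by (intro tendsto_intros g f)
    ultimately have "(\<lambda>n. hnorm adj_graph (s n - g)) \<longlonglongrightarrow> 0" by simp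
    then show "\<exists>l\<in>hcarrier adj_graph. (\<lambda>n. hnorm adj_graph (s n - l)) \<longlonglongrightarrow> 0"
      using g' by auto
  qed
qed

end

section \<open>Partial isometries\<close>

lemma hsum_simps [simp]:
  "hcarrier (hsum H K) = hcarrier H \<times> hcarrier K"
  "hinner (hsum H K) p q = hinner H (fst p) (fst q) + hinner K (snd p) (snd q)"
  by (simp_all add: hsum_def)

lemma hsum_semi_hilbert:
  assumes "semi_hilbert H" "semi_hilbert K"
  shows "semi_hilbert (hsum H K)"
proof -
  interpret H: semi_hilbert H by fact
  interpret K: semi_hilbert K by fact
  show ?thesis
  proof
    show "complex_vector.subspace (hcarrier (hsum H K))"
      by (rule complex_vector.subspaceI) (auto simp: zero_prod_def scaleC_prod_def)
    show "hinner (hsum H K) g f = cnj (hinner (hsum H K) f g)"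
      if "f \<in> hcarrier (hsum H K)" "g \<in> hcarrier (hsum H K)" for f g
      using that H.inner_commute[of "fst f" "fst g"] K.inner_commute[of "snd f" "snd g"] by auto
  qed (auto simp: H.inner_add_left K.inner_add_left H.inner_scale_left K.inner_scale_left
      H.inner_nonneg K.inner_nonneg scaleC_prod_def distrib_left)
qed

lemma hsum_norm_zero:
  assumes "hilbert H" "hilbert K" "p \<in> hcarrier (hsum H K)" "hnorm (hsum H K) p = 0"
  shows "p = 0"
proof -
  interpret H: hilbert H by fact
  interpret K: hilbert K by fact
  have p: "fst p \<in> hcarrier H" "snd p \<in> hcarrier K" using assms(3) by auto
  have "(hnorm H (fst p))\<^sup>2 + (hnorm K (snd p))\<^sup>2 = 0"
    using assms(4) p by (simp add: hnorm_def H.inner_nonneg K.inner_nonneg)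
  then have "hnorm H (fst p) = 0" "hnorm K (snd p) = 0" by (simp_all add: sum_power2_eq_zero_iff)
  then show ?thesis using p by (simp add: H.norm_eq_zero K.norm_eq_zero prod_eq_iff)
qed

text \<open>Norm preservation on \<open>ker_perp H V\<close> gives preservation of inner products
  there by polarisation. A general \<open>f\<close> is reduced to this case by removing its
  component in the kernel of \<open>V\<close>, which affects neither side.\<close>

lemma partial_isometry_inner:
  assumes "hilbert H" "semi_hilbert K" "partial_isometry H K V"
    and definite: "\<And>p. \<lbrakk>p \<in> hcarrier K; hnorm K p = 0\<rbrakk> \<Longrightarrow> p = 0"
    and f: "f \<in> hcarrier H" and g: "g \<in> ker_perp H V"
  shows "hinner K (V f) (V g) = hinner H f g"
proof -
  interpret H: hilbert H by fact
  interpret K: semi_hilbert K by fact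
  have iso: "\<And>f. f \<in> ker_perp H V \<Longrightarrow> hnorm K (V f) = hnorm H f"
    using assms(3) unfolding partial_isometry_def by blast
  obtain C where C: "\<And>f. f \<in> hcarrier H \<Longrightarrow> hnorm K (V f) \<le> C * hnorm H f"
    and V: "\<And>f. f \<in> hcarrier H \<Longrightarrow> V f \<in> hcarrier K"
      "\<And>f f'. \<lbrakk>f \<in> hcarrier H; f' \<in> hcarrier H\<rbrakk> \<Longrightarrow> V (f + f') = V f + V f'"
      "\<And>c f. f \<in> hcarrier H \<Longrightarrow> V (c *\<^sub>C f) = c *\<^sub>C V f"
    using assms(3) unfolding partial_isometry_def bounded_op_def by blast
  have kp: "f \<in> hcarrier H" "\<And>x. \<lbrakk>x \<in> hcarrier H; V x = 0\<rbrakk> \<Longrightarrow> hinner H f x = 0" if "f \<in> ker_perp H V" for f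
    using that by (auto simp: ker_perp_def)
  have kp_add: "f + f' \<in> ker_perp H V" if "f \<in> ker_perp H V" "f' \<in> ker_perp H V" for f f'
    using that by (auto simp: ker_perp_def H.inner_add_left)
  have kp_scale: "c *\<^sub>C f \<in> ker_perp H V" if "f \<in> ker_perp H V" for c f
    using that by (auto simp: ker_perp_def H.inner_scale_left)
  have re: "Re (hinner K (V f) (V g)) = Re (hinner H f g)"
    if f: "f \<in> ker_perp H V" and g: "g \<in> ker_perp H V" for f g
    using iso[OF kp_add[OF f g]] iso[OF f] iso[OF g] H.norm_sq_add[of f g] K.norm_sq_add[of "V f" "V g"]
      kp(1)[OF f] kp(1)[OF g] V by simp
  have pol: "hinner K (V f) (V g) = hinner H f g" if f: "f \<in> ker_perp H V" and g: "g \<in> ker_perp H V" for f g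
  proof (rule complex_eqI)
    show "Im (hinner K (V f) (V g)) = Im (hinner H f g)"
      using re[OF kp_scale[OF f, of "\<i>"] g] kp(1)[OF f] kp(1)[OF g] V
      by (simp add: H.inner_scale_left K.inner_scale_left)
  qed (rule re[OF f g])
  define N where "N = {x \<in> hcarrier H. V x = 0}"
  have V0: "V 0 = 0" using V(2)[of 0 0] by simp
  have N: "complex_vector.subspace N" "N \<subseteq> hcarrier H"
  proof -
    show "complex_vector.subspace N"
      by (rule complex_vector.subspaceI) (auto simp: N_def V V0)
  qed (auto simp: N_def)
  \<comment> \<open>The component of \<open>f\<close> in the kernel. The kernel is closed because
    \<open>V\<close> is bounded and vectors of norm zero in \<open>K\<close> vanish.\<close>
  obtain r where r: "r \<in> N" "\<And>x. x \<in> N \<Longrightarrow> hinner H x r = hinner H x f"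
  proof (rule H.projection[OF N _ f])
    fix s l assume s: "\<And>n. s n \<in> N" and l: "l \<in> hcarrier H" "(\<lambda>n. hnorm H (s n - l)) \<longlonglongrightarrow> 0"
    have sH: "s n \<in> hcarrier H" for n using s N by auto
    have "hnorm K (V l) \<le> C * hnorm H (s n - l)" for n
    proof -
      have "V l = V (l - s n)" using V(2)[of "l - s n" "s n"] l sH s[of n] by (simp add: N_def)
      then show ?thesis using C[of "l - s n"] l sH H.norm_minus_commute[of l "s n"] by simp
    qed
    then have "hnorm K (V l) \<le> C * 0"
      by (intro LIMSEQ_le_const[OF tendsto_mult[OF tendsto_const l(2)]]) auto
    then have "hnorm K (V l) = 0" using K.norm_nonneg[OF V(1)[OF l(1)]] by simp
    then show "l \<in> N" using definite V l by (simp add: N_def)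
  qed blast
  have rH: "r \<in> hcarrier H" "V r = 0" using r by (auto simp: N_def)
  have f1: "f - r \<in> ker_perp H V"
    unfolding ker_perp_def
  proof (intro CollectI conjI ballI impI)
    fix x assume x: "x \<in> hcarrier H" "V x = 0"
    then have "hinner H x (f - r) = 0" using r(2)[of x] f rH by (simp add: N_def H.inner_diff_right)
    then show "hinner H (f - r) x = 0" using H.inner_commute[of x "f - r"] x f rH by simp
  qed (use f rH in simp)
  have "V f = V (f - r)" using V(2)[of "f - r" r] f rH by simp
  then have "hinner K (V f) (V g) = hinner H (f - r) g" by (simp add: pol[OF f1 g])
  also have "hinner H (f - r) g = hinner H f g"
  proof -
    have "hinner H g r = 0" using kp(2)[OF g rH] .
    then have "hinner H r g = 0" using H.inner_commute[of g r] kp(1)[OF g] rH by simp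
    then show ?thesis using f rH kp(1)[OF g] by (simp add: H.inner_diff_left)
  qed
  finally show ?thesis .
qed

lemma hnorm_complex_hilbert: "hnorm complex_hilbert z = cmod z"
  by (simp add: hnorm_def complex_hilbert_def cmod_def power2_eq_square)

lemma complex_hilbert: "hilbert complex_hilbert"
proof (unfold_locales, goal_cases)
  case (7 s)
  then have "Cauchy s" by (intro metric_CauchyI) (simp add: hnorm_complex_hilbert dist_norm)
  then obtain l where "s \<longlonglongrightarrow> l" using Cauchy_convergent convergent_def by blast
  then have "(\<lambda>n. cmod (s n - l)) \<longlonglongrightarrow> 0" by (simp add: LIM_zero tendsto_norm_zero)
  then show ?case
    unfolding hnorm_complex_hilbert by (intro bexI[of _ l]) (simp_all add: complex_hilbert_def)
qed (auto simp: complex_hilbert_def scaleC_complex_def algebra_simps)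

section \<open>The space \<open>H(B)\<close> as the domain of the adjoint\<close>

locale beurling = dense_multiplier k H h
  for k :: "'x \<Rightarrow> 'x \<Rightarrow> complex" and H h +
  fixes E :: "'e::complex_vector hilbert" and HE :: "('x \<Rightarrow> 'e) hilbert"
    and A B :: "'x \<Rightarrow> 'e \<Rightarrow> complex" and HB :: "('x \<Rightarrow> complex) hilbert"
  assumes E: "hilbert_space E" and HE: "tensor_rkhs k E HE"
    and pair: "beurling_pair H E HE h A B"
    and HB: "scalar_rkhs (HB_kernel E k B) HB"
begin

text \<open>With \<open>F\<close> equal to \<open>V*\<close> of the pair consisting of 0 and
  \<open>kernel_at y\<close>, the vector \<open>V F = (p, q)\<close> is the projection of this pair
  onto the graph of T. The remainder, with entries \<open>- p\<close> and
  \<open>kernel_at y - q\<close>, is orthogonal to the graph, which says that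
  \<open>kernel_at y - q\<close> lies in the domain of the adjoint and is sent to \<open>p\<close>.
  Since \<open>q = mult_op h p\<close>, the reproducing property follows.\<close>

lemma beurling_kernel:
  fixes y :: 'x
  defines "\<xi> \<equiv> \<lambda>x. HB_kernel E k B x y"
  obtains p where "adjoint_rel h \<xi> p"
    "\<And>g f. adjoint_rel h g f \<Longrightarrow> hinner H g \<xi> + hinner H f p = g y"
proof -
  interpret E: hilbert E using E by (simp add: hilbert_space_iff)
  interpret HE: hilbert HE
    using HE unfolding tensor_rkhs_def rkhs_def hilbert_space_iff by blast
  define V where "V F = ((\<lambda>x. A x (F x)), (\<lambda>x. B x (F x)))" for F
  have Bop: "bounded_op E complex_hilbert (B x)" for x
    using pair unfolding beurling_pair_def by blast
  have iso: "partial_isometry HE (hsum H H) V" and range: "V ` hcarrier HE = mult_graph H h"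
    using pair unfolding beurling_pair_def Let_def V_def[abs_def] by blast+
  interpret C: hilbert complex_hilbert by (rule complex_hilbert)
  define e where "e = hadjoint E complex_hilbert (B y) 1"
  have e: "e \<in> hcarrier E" "\<And>f. f \<in> hcarrier E \<Longrightarrow> B y f = hinner E f e"
    using hadjoint_bounded[OF E.hilbert_axioms C.hilbert_axioms Bop[of y], of 1]
    by (auto simp: e_def complex_hilbert_def)
  define F where "F x = k x y *\<^sub>C e" for x
  have F: "F \<in> hcarrier HE" "\<And>G. G \<in> hcarrier HE \<Longrightarrow> hinner HE G F = hinner E (G y) e"
    and vals: "\<And>G x. G \<in> hcarrier HE \<Longrightarrow> G x \<in> hcarrier E"
    using HE e(1) unfolding tensor_rkhs_def rkhs_def F_def[abs_def] by blast+
  have VF: "V F \<in> mult_graph H h" using range F(1) by blast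
  define p q where "p = fst (V F)" and "q = snd (V F)"
  have p: "p \<in> mult_dom H h" "q = mult_op h p" using VF by (auto simp: mult_graph_def p_def q_def)
  have pq: "p \<in> hcarrier H" "q \<in> hcarrier H" using p mult_domD by auto
  \<comment> \<open>As a value of the adjoint of \<open>V\<close>, \<open>F\<close> is orthogonal to
    the kernel of \<open>V\<close>; this is what allows \<open>partial_isometry_inner\<close> to be
    used.\<close>
  have "F \<in> ker_perp HE V"
    unfolding ker_perp_def
  proof (intro CollectI conjI F(1) ballI impI)
    fix G assume G: "G \<in> hcarrier HE" "V G = 0"
    then have "B y (G y) = 0" by (auto simp: V_def zero_prod_def fun_eq_iff)
    then have "hinner HE G F = 0" using F(2)[OF G(1)] e(2)[OF vals[OF G(1)], of y] by simp
    then show "hinner HE F G = 0" using HE.inner_commute[OF G(1) F(1)] by simp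
  qed
  then have V_inner: "hinner (hsum H H) (V G) (V F) = hinner HE G F" if "G \<in> hcarrier HE" for G
    using partial_isometry_inner[OF HE.hilbert_axioms
        hsum_semi_hilbert[OF semi_hilbert_axioms semi_hilbert_axioms] iso _ that]
      hsum_norm_zero[OF hilbert_axioms hilbert_axioms] by blast
  have q_eq: "q x = B x e * k x y" for x
    using Bop[of x] e(1) by (simp add: q_def V_def F_def bounded_op_def scaleC_complex_def mult.commute)
  have \<xi>: "\<xi> = kernel_at y - q"
    by (simp add: \<xi>_def HB_kernel_def fun_eq_iff q_eq e_def[symmetric] algebra_simps)
  have "adjoint_rel h \<xi> p"
    unfolding adjoint_rel_def
  proof (intro conjI ballI pq)
    show "\<xi> \<in> hcarrier H" unfolding \<xi> using pq by (intro carrier_closed kernel_in)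
    fix m assume m: "m \<in> mult_dom H h"
    then have "(m, mult_op h m) \<in> V ` hcarrier HE" unfolding range mult_graph_def by blast
    then obtain G where G: "G \<in> hcarrier HE" "V G = (m, mult_op h m)" by auto
    have "mult_op h m = (\<lambda>x. B x (G x))" using G(2) by (simp add: V_def)
    then have "mult_op h m y = hinner E (G y) e" using e(2)[OF vals[OF G(1)], of y] by simp
    also have "\<dots> = hinner (hsum H H) (V G) (V F)"
      by (simp only: V_inner[OF G(1)] F(2)[OF G(1)])
    also have "\<dots> = hinner H m p + hinner H (mult_op h m) q" by (simp add: G p_def q_def)
    finally show "hinner H (mult_op h m) \<xi> = hinner H m p"
      unfolding \<xi> using mult_domD[OF m] pq by (subst inner_diff_right) (auto simp: reproducing)
  qed
  moreover have "hinner H g \<xi> + hinner H f p = g y" if "adjoint_rel h g f" for g f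
  proof -
    have gf: "g \<in> hcarrier H" "f \<in> hcarrier H" using that adjoint_relD by auto
    have "hinner H q g = hinner H p f" using adjoint_relD(3)[OF that p(1)] p(2) by simp
    then have "hinner H g q = hinner H f p"
      using inner_commute[of q g] inner_commute[of p f] gf pq by simp
    then show ?thesis
      unfolding \<xi> using gf pq by (subst inner_diff_right) (auto simp: reproducing)
  qed
  ultimately show thesis by (rule that)
qed

lemma adj_graph_rkhs: "rkh_space (HB_kernel E k B) adj_graph"
proof -
  have "rkhs complex_hilbert (\<lambda>x y c. HB_kernel E k B x y * c) adj_graph"
    unfolding rkhs_def
  proof (intro conjI ballI allI)
    show "hilbert_space adj_graph" by (simp add: hilbert_space_iff adj_graph_hilbert)
    show "F x \<in> hcarrier complex_hilbert" for F x by (simp add: complex_hilbert_def)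
    fix y c
    interpret G: hilbert adj_graph by (rule adj_graph_hilbert)
    obtain p where p: "adjoint_rel h (\<lambda>x. HB_kernel E k B x y) p"
      "\<And>g f. adjoint_rel h g f \<Longrightarrow> hinner H g (\<lambda>x. HB_kernel E k B x y) + hinner H f p = g y"
      by (rule beurling_kernel[of y]) blast
    have eq: "(\<lambda>x. HB_kernel E k B x y * c) = c *\<^sub>C (\<lambda>x. HB_kernel E k B x y)"
      by (simp add: fun_eq_iff scaleC_fun_def scaleC_complex_def)
    have \<xi>: "(\<lambda>x. HB_kernel E k B x y) \<in> adj_dom" using p(1) by (auto simp: adj_dom_def)
    then show "(\<lambda>x. HB_kernel E k B x y * c) \<in> hcarrier adj_graph"
      unfolding eq by (simp add: adj_dom_closed)
    fix F assume F: "F \<in> hcarrier adj_graph"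
    have "hinner adj_graph F (\<lambda>x. HB_kernel E k B x y) = F y"
      using p(2)[OF adj_domD[of F]] F by (simp add: adj_eq[OF p(1)])
    then show "hinner adj_graph F (\<lambda>x. HB_kernel E k B x y * c) = hinner complex_hilbert (F y) c"
      unfolding eq using F \<xi> by (subst G.inner_scale_right) (simp_all add: complex_hilbert_def)
  qed
  then show ?thesis by unfold_locales (simp add: scalar_rkhs_def)
qed

lemma HB_rkhs: "rkh_space (HB_kernel E k B) HB"
  by unfold_locales (rule HB)

lemma HB_carrier: "hcarrier HB = adj_dom"
  using rkh_space_unique(1)[OF adj_graph_rkhs HB_rkhs] rkh_space_unique(1)[OF HB_rkhs adj_graph_rkhs]
  by auto

lemma HB_norm: "g \<in> adj_dom \<Longrightarrow> hnorm HB g = hnorm adj_graph g"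
  using rkh_space_unique(2)[OF adj_graph_rkhs HB_rkhs] rkh_space_unique(2)[OF HB_rkhs adj_graph_rkhs]
  by (metis HB_carrier adj_graph_simps(1) order_antisym)

end

section \<open>The equivalences\<close>

locale cnp_beurling = cnp_space I u H + beurling "cnp_kernel I u" H h E HE A B HB
  for I :: "'i set" and u :: "'x \<Rightarrow> 'i \<Rightarrow> complex" and H :: "('x \<Rightarrow> complex) hilbert"
    and h :: "'x \<Rightarrow> complex" and E :: "'e::complex_vector hilbert" and HE :: "('x \<Rightarrow> 'e) hilbert"
    and A B :: "'x \<Rightarrow> 'e \<Rightarrow> complex" and HB :: "('x \<Rightarrow> complex) hilbert"
begin

sublocale HB: rkh_space "HB_kernel E k B" HB
  by (rule HB_rkhs)

section \<open>Representing pairs and the range of the adjoint of \<open>a\<close>\<close>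

lemma HB_norm_sq: "g \<in> hcarrier HB \<Longrightarrow> (hnorm HB g)\<^sup>2 = (hnorm H g)\<^sup>2 + (hnorm H (adj g))\<^sup>2"
  using HB_norm adj_graph_norm by (simp add: HB_carrier)

lemma HB_in: "g \<in> hcarrier HB \<Longrightarrow> g \<in> hcarrier H" "g \<in> hcarrier HB \<Longrightarrow> adj g \<in> hcarrier H"
  using adj_in by (simp_all add: HB_carrier)

lemma HB_norm_ge:
  assumes "g \<in> hcarrier HB"
  shows "hnorm H g \<le> hnorm HB g" "hnorm H (adj g) \<le> hnorm HB g"
  using adj_graph_norm_ge HB_norm assms by (simp_all add: HB_carrier)

lemma adj_range_space_carrier: "hcarrier (adj_range_space H a) = mult_adj H a ` hcarrier H"
  by (simp add: adj_range_space_def Let_def)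

lemma representing_pairD:
  assumes "representing_pair H h a b"
  shows "a \<in> Mult H" "b \<in> Mult H" "mult_op a (mult_op h m) = mult_op b m"
    "mult_op h (mult_op a m) = mult_op b m"
  using assms by (auto simp: representing_pair_def mult_op_def fun_eq_iff)

lemma adjoint_rel_mult_adj:
  assumes ab: "representing_pair H h a b" and w: "w \<in> hcarrier H"
  shows "adjoint_rel h (mult_adj H a w) (mult_adj H b w)"
  unfolding adjoint_rel_def
proof (intro conjI ballI)
  note R = representing_pairD[OF ab]
  fix m assume m: "m \<in> mult_dom H h"
  have "hinner H (mult_op h m) (mult_adj H a w) = hinner H (mult_op b m) w"
    using mult_adj_inner[OF R(1) w mult_domD(2)[OF m]] by (simp add: R(3))
  also have "\<dots> = hinner H m (mult_adj H b w)"
    using mult_adj_inner[OF R(2) w mult_domD(1)[OF m]] .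
  finally show "hinner H (mult_op h m) (mult_adj H a w) = hinner H m (mult_adj H b w)" .
qed (use assms in \<open>auto intro: mult_adj_in dest: representing_pairD\<close>)

lemma mult_adj_HB:
  assumes ab: "representing_pair H h a b" and w: "w \<in> hcarrier H"
  shows "mult_adj H a w \<in> hcarrier HB"
    "(hnorm HB (mult_adj H a w))\<^sup>2 = (hnorm H (mult_adj H a w))\<^sup>2 + (hnorm H (mult_adj H b w))\<^sup>2"
proof -
  show *: "mult_adj H a w \<in> hcarrier HB"
    using adjoint_rel_mult_adj[OF assms] by (auto simp: HB_carrier adj_dom_def)
  show "(hnorm HB (mult_adj H a w))\<^sup>2 = (hnorm H (mult_adj H a w))\<^sup>2 + (hnorm H (mult_adj H b w))\<^sup>2"
    by (simp add: HB_norm_sq[OF *] adj_eq[OF adjoint_rel_mult_adj[OF assms]])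
qed

text \<open>The preimage of \<open>g\<close> is verified by testing against
  \<open>mult_op a f\<close>: the adjoint of T is removed by noting that
  \<open>mult_op a (mult_op \<psi> f)\<close> lies in the domain of T with image
  \<open>mult_op b (mult_op \<psi> f)\<close>, and the corona identity collects both terms into
  \<open>f\<close>.\<close>

lemma range_eq_of_corona:
  assumes ab: "representing_pair H h a b" and corona: "corona_pair H a b"
  shows "hcarrier HB = mult_adj H a ` hcarrier H"
proof
  note R = representing_pairD[OF ab]
  show "mult_adj H a ` hcarrier H \<subseteq> hcarrier HB" using mult_adj_HB(1)[OF ab] by blast
  obtain \<phi> \<psi> where M: "\<phi> \<in> Mult H" "\<psi> \<in> Mult H" and one: "\<And>x. a x * \<phi> x + b x * \<psi> x = 1"
    using corona unfolding corona_pair_def by blast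
  show "hcarrier HB \<subseteq> mult_adj H a ` hcarrier H"
  proof
    fix g assume g: "g \<in> hcarrier HB"
    let ?w = "mult_adj H \<phi> g + mult_adj H \<psi> (adj g)"
    have rel: "adjoint_rel h g (adj g)" using g by (simp add: HB_carrier adj_domD)
    have w: "?w \<in> hcarrier H" using M HB_in[OF g] by (intro carrier_closed mult_adj_in)
    have "mult_adj H a ?w = g"
    proof (rule mult_adj_eqI)
      fix f assume f: "f \<in> hcarrier H"
      have mem: "mult_op a f \<in> hcarrier H" "mult_op \<psi> f \<in> hcarrier H" "mult_op \<phi> (mult_op a f) \<in> hcarrier H"
        "mult_op b (mult_op \<psi> f) \<in> hcarrier H"
        using f M R by (auto intro: mult_op_in)
      have dom: "mult_op a (mult_op \<psi> f) \<in> mult_dom H h"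
        unfolding mult_dom_def using R mem by (simp add: mult_op_in)
      have "hinner H (mult_op a f) ?w = hinner H (mult_op a f) (mult_adj H \<phi> g) + hinner H (mult_op a f) (mult_adj H \<psi> (adj g))"
        using mem M HB_in[OF g] by (intro inner_add_right mult_adj_in)
      also have "\<dots> = hinner H (mult_op \<phi> (mult_op a f)) g + hinner H (mult_op \<psi> (mult_op a f)) (adj g)"
        using mem M HB_in[OF g] by (simp add: mult_adj_inner)
      also have "mult_op \<psi> (mult_op a f) = mult_op a (mult_op \<psi> f)" by (simp add: mult_op_def mult.left_commute)
      also have "hinner H (mult_op a (mult_op \<psi> f)) (adj g) = hinner H (mult_op b (mult_op \<psi> f)) g"
        using adjoint_relD(3)[OF rel dom] by (simp add: R(4))
      also have "hinner H (mult_op \<phi> (mult_op a f)) g + hinner H (mult_op b (mult_op \<psi> f)) g =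
          hinner H (mult_op \<phi> (mult_op a f) + mult_op b (mult_op \<psi> f)) g"
        using mem HB_in[OF g] by (simp only: inner_add_left)
      also have "mult_op \<phi> (mult_op a f) + mult_op b (mult_op \<psi> f) = f"
      proof
        fix x
        have "\<phi> x * (a x * f x) + b x * (\<psi> x * f x) = (a x * \<phi> x + b x * \<psi> x) * f x"
          by (simp add: algebra_simps)
        then show "(mult_op \<phi> (mult_op a f) + mult_op b (mult_op \<psi> f)) x = f x"
          by (simp add: mult_op_def one)
      qed
      finally show "hinner H (mult_op a f) ?w = hinner H f g" .
    qed (use HB_in[OF g] in simp)
    then show "g \<in> mult_adj H a ` hcarrier H" using w by (metis image_eqI)
  qed
qed

text \<open>Outerness makes the adjoint of \<open>a\<close> injective. Its inverse \<open>T\<close>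
  satisfies \<open>hinner H (T g) (mult_op a p) = hinner H g p\<close>, and the right-hand side is
  bounded in the norm of \<open>HB\<close>.\<close>

lemma lower_bound:
  assumes ab: "representing_pair H h a b" and outer: "outer_mult H a"
    and range: "hcarrier HB = mult_adj H a ` hcarrier H"
  obtains C where "C \<ge> 0" "\<And>w. w \<in> hcarrier H \<Longrightarrow> hnorm H w \<le> C * hnorm HB (mult_adj H a w)"
    "inj_on (mult_adj H a) (hcarrier H)"
proof -
  note R = representing_pairD[OF ab]
  have inj: "inj_on (mult_adj H a) (hcarrier H)"
  proof (rule inj_onI)
    fix v w assume vw: "v \<in> hcarrier H" "w \<in> hcarrier H" "mult_adj H a v = mult_adj H a w"
    have "mult_adj H a (v - w) = 0"
      using mult_adj_add[OF R(1), of "v - w" w] vw by simp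
    then have "v - w = 0"
      using outer outer_iff_adj_injective[OF R(1)] vw by (meson carrier_closed(3))
    then show "v = w" by simp
  qed
  define T where "T = inv_into (hcarrier H) (mult_adj H a)"
  have T: "T g \<in> hcarrier H" "mult_adj H a (T g) = g" if "g \<in> hcarrier HB" for g
    using that unfolding T_def range by (simp_all only: inv_into_into f_inv_into_f)
  have "\<exists>C\<ge>0. \<forall>g\<in>hcarrier HB. hnorm H (T g) \<le> C * hnorm HB g"
  proof (rule bounded_if_adjoint_dense[OF HB.hilbert_axioms hilbert_axioms T(1) outer[unfolded outer_mult_def]])
    fix d assume "d \<in> mult_op a ` hcarrier H"
    then obtain p where p: "p \<in> hcarrier H" "d = mult_op a p" by blast
    \<comment> \<open>Representer with respect to the inner product of \<open>HB\<close>; it exists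
      because the inclusion of \<open>HB\<close> in \<open>H\<close> is contractive.\<close>
    have "\<exists>s\<in>hcarrier HB. \<forall>g\<in>hcarrier HB. hinner H g p = hinner HB g s"
    proof (rule HB.riesz)
      fix g assume g: "g \<in> hcarrier HB"
      have "cmod (hinner H g p) \<le> hnorm H g * hnorm H p" using HB_in[OF g] p by (intro Cauchy_Schwarz)
      also have "\<dots> \<le> hnorm HB g * hnorm H p" using HB_norm_ge[OF g] p by (intro mult_right_mono) auto
      finally show "cmod (hinner H g p) \<le> hnorm H p * hnorm HB g" by (simp add: mult.commute)
    qed (use p HB_in in \<open>simp_all add: inner_add_left inner_scale_left\<close>)
    then obtain s where s: "s \<in> hcarrier HB" "\<And>g. g \<in> hcarrier HB \<Longrightarrow> hinner H g p = hinner HB g s"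
      by blast
    have "hinner H (T g) d = hinner HB g s" if g: "g \<in> hcarrier HB" for g
    proof -
      have "hinner H d (T g) = hinner H p g"
        using mult_adj_inner[OF R(1) T(1)[OF g] p(1)] T(2)[OF g] p(2) by simp
      moreover have "d \<in> hcarrier H" using p R by (simp add: mult_op_in)
      ultimately have "hinner H (T g) d = hinner H g p"
        using inner_commute[of d "T g"] inner_commute[of p g] T(1)[OF g] p HB_in[OF g] by simp
      then show ?thesis using s(2)[OF g] by simp
    qed
    then show "\<exists>s\<in>hcarrier HB. \<forall>g\<in>hcarrier HB. hinner H (T g) d = hinner HB g s" using s(1) by blast
  qed
  then obtain C where C: "C \<ge> 0" "\<And>g. g \<in> hcarrier HB \<Longrightarrow> hnorm H (T g) \<le> C * hnorm HB g" by blast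
  have "hnorm H w \<le> C * hnorm HB (mult_adj H a w)" if w: "w \<in> hcarrier H" for w
  proof -
    have "T (mult_adj H a w) = w" unfolding T_def by (rule inv_into_f_f[OF inj w])
    then show ?thesis using C(2)[of "mult_adj H a w"] w range by auto
  qed
  then show thesis using that C(1) inj by blast
qed

lemma mult_adj_kernel_sum:
  assumes "a \<in> Mult H"
  shows "mult_adj H a (kernel_sum F w) = kernel_sum F (\<lambda>p. w p * a p)"
  using assms
  by (intro mult_adj_eqI) (simp_all add: inner_kernel_sum mult_op_in, simp add: mult_op_def mult.assoc)

text \<open>On kernel sums the adjoints of \<open>a\<close> and \<open>b\<close> merely multiply the
  weights, so the lower bound tested on such sums is the positivity required by
  \<open>toeplitz_corona\<close>.\<close>

lemma corona_of_range_eq: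
  assumes ab: "representing_pair H h a b" and outer: "outer_mult H a"
    and range: "hcarrier HB = mult_adj H a ` hcarrier H"
  shows "corona_pair H a b"
proof -
  note R = representing_pairD[OF ab]
  obtain C where C: "C \<ge> 0" "\<And>w. w \<in> hcarrier H \<Longrightarrow> hnorm H w \<le> C * hnorm HB (mult_adj H a w)"
    by (rule lower_bound[OF assms]) blast
  \<comment> \<open>The summand 1 keeps the quotient positive when \<open>C = 0\<close>.\<close>
  define \<delta> where "\<delta> = 1 / (C + 1)"
  have \<delta>: "\<delta> > 0" "\<delta> * C \<le> 1" using C(1) by (auto simp: \<delta>_def)
  have "psd UNIV (\<lambda>x y. (a x * cnj (a y) + b x * cnj (b y) - of_real (\<delta>\<^sup>2)) * k x y)"
  proof (rule psdI)
    fix F :: "'x set" and w assume F: "finite F" "F \<subseteq> UNIV"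
    let ?x = "kernel_sum F w"
    have norm_sum: "(hnorm H (kernel_sum F v))\<^sup>2 = Re (\<Sum>p\<in>F. \<Sum>q\<in>F. v p * cnj (v q) * k p q)" for v
      by (simp add: norm_sq inner_kernel_sums)
    have "\<delta> * hnorm H ?x \<le> \<delta> * (C * hnorm HB (mult_adj H a ?x))"
      using C(2)[of ?x] \<delta>(1) by (intro mult_left_mono) auto
    also have "\<dots> \<le> 1 * hnorm HB (mult_adj H a ?x)"
      unfolding mult.assoc[symmetric]
      using \<delta>(2) mult_adj_HB(1)[OF ab, of ?x] by (intro mult_right_mono) auto
    finally have "(\<delta> * hnorm H ?x)\<^sup>2 \<le> (hnorm HB (mult_adj H a ?x))\<^sup>2"
      using \<delta>(1) by (intro power_mono) auto
    then have "\<delta>\<^sup>2 * (hnorm H ?x)\<^sup>2 \<le> (hnorm H (mult_adj H a ?x))\<^sup>2 + (hnorm H (mult_adj H b ?x))\<^sup>2"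
      by (simp add: mult_adj_HB(2)[OF ab] power_mult_distrib)
    moreover have "(\<Sum>p\<in>F. \<Sum>q\<in>F. w p * cnj (w q) * ((a p * cnj (a q) + b p * cnj (b q) - of_real (\<delta>\<^sup>2)) * k p q)) =
        (\<Sum>p\<in>F. \<Sum>q\<in>F. (w p * a p) * cnj (w q * a q) * k p q) +
        (\<Sum>p\<in>F. \<Sum>q\<in>F. (w p * b p) * cnj (w q * b q) * k p q) -
        of_real (\<delta>\<^sup>2) * (\<Sum>p\<in>F. \<Sum>q\<in>F. w p * cnj (w q) * k p q)"
      by (simp add: sum_distrib_left algebra_simps flip: sum.distrib sum_subtractf)
    ultimately show "0 \<le> Re (\<Sum>p\<in>F. \<Sum>q\<in>F. w p * cnj (w q) *
        ((a p * cnj (a q) + b p * cnj (b q) - of_real (\<delta>\<^sup>2)) * k p q))"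
      by (simp add: mult_adj_kernel_sum[OF R(1)] mult_adj_kernel_sum[OF R(2)] norm_sum flip: of_real_power)
  qed
  then obtain \<phi> \<psi> where "\<phi> \<in> Mult H" "\<psi> \<in> Mult H" "\<And>x. a x * \<phi> x + b x * \<psi> x = 1"
    using toeplitz_corona[OF \<delta>(1)] by blast
  then show ?thesis unfolding corona_pair_def using R by blast
qed

text \<open>The intertwining relation is just commutativity of adjoints of multipliers; the content
  is that \<open>W\<close> and its inverse are bounded for the norm of \<open>HB\<close>.\<close>

lemma intertwiner_of_range_eq:
  assumes ab: "representing_pair H h a b" and outer: "outer_mult H a"
    and range: "hcarrier HB = mult_adj H a ` hcarrier H"
  defines "W \<equiv> mult_adj H a"
  shows "invertible_op H HB W"
    "\<And>\<phi> f. \<lbrakk>\<phi> \<in> Mult H; f \<in> hcarrier HB\<rbrakk>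
      \<Longrightarrow> mult_adj H \<phi> f = W (mult_adj H \<phi> (inv_into (hcarrier H) W f))"
proof -
  note R = representing_pairD[OF ab]
  obtain C where C: "C \<ge> 0" "\<And>w. w \<in> hcarrier H \<Longrightarrow> hnorm H w \<le> C * hnorm HB (W w)"
    and inj: "inj_on W (hcarrier H)"
    unfolding W_def by (rule lower_bound[OF ab outer range]) blast
  let ?inv = "inv_into (hcarrier H) W"
  have bij: "bij_betw W (hcarrier H) (hcarrier HB)" using inj range by (simp add: bij_betw_def W_def)
  have inv: "?inv g \<in> hcarrier H" "W (?inv g) = g" if "g \<in> hcarrier HB" for g
    using that bij by (auto simp: bij_betw_def inv_into_into f_inv_into_f)
  have W_add: "\<lbrakk>v \<in> hcarrier H; w \<in> hcarrier H\<rbrakk> \<Longrightarrow> W (v + w) = W v + W w"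
    and W_scale: "v \<in> hcarrier H \<Longrightarrow> W (c *\<^sub>C v) = c *\<^sub>C W v" for v w c
    using R(1) by (simp_all add: W_def mult_adj_add mult_adj_scale)
  have "\<exists>K\<ge>0. \<forall>w\<in>hcarrier H. hnorm HB (W w) \<le> K * hnorm H w"
  proof (rule HB.bounded_if_evaluations[OF hilbert_axioms])
    show "W w \<in> hcarrier HB" if "w \<in> hcarrier H" for w using mult_adj_HB(1)[OF ab that] by (simp add: W_def)
    fix y
    have "W w y = hinner H w (mult_op a (kernel_at y))" if w: "w \<in> hcarrier H" for w
    proof -
      have "hinner H (mult_op a (kernel_at y)) w = hinner H (kernel_at y) (W w)"
        unfolding W_def by (rule mult_adj_inner[OF R(1) w kernel_in])
      then show ?thesis
        using w R(1) inner_commute[of "mult_op a (kernel_at y)" w]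
        by (simp add: mult_op_in W_def mult_adj_in reproducing')
    qed
    then show "\<exists>s\<in>hcarrier H. \<forall>w\<in>hcarrier H. W w y = hinner H w s"
      using mult_op_in[OF R(1) kernel_in] by blast
  qed
  then have "bounded_op H HB W"
    unfolding bounded_op_def using W_add W_scale bij by (auto simp: bij_betw_def)
  moreover have "bounded_op HB H ?inv"
    unfolding bounded_op_def
  proof (intro conjI ballI allI)
    fix f g c assume f: "f \<in> hcarrier HB" and g: "g \<in> hcarrier HB"
    have "?inv (W (?inv f + ?inv g)) = ?inv f + ?inv g"
      using inv f g by (intro inv_into_f_f[OF inj]) auto
    then show "?inv (f + g) = ?inv f + ?inv g" using inv f g by (simp add: W_add)
  next
    fix f c assume f: "f \<in> hcarrier HB"
    have "?inv (W (c *\<^sub>C ?inv f)) = c *\<^sub>C ?inv f"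
      using inv f by (intro inv_into_f_f[OF inj]) auto
    then show "?inv (c *\<^sub>C f) = c *\<^sub>C ?inv f" using inv f by (simp add: W_scale)
  next
    show "\<exists>C. \<forall>f\<in>hcarrier HB. hnorm H (?inv f) \<le> C * hnorm HB f"
      using C(2) inv by (intro exI[of _ C] ballI) metis
  qed (use inv in auto)
  ultimately show "invertible_op H HB W" using bij by (simp add: invertible_op_def)
  fix \<phi> f assume \<phi>: "\<phi> \<in> Mult H" and f: "f \<in> hcarrier HB"
  have "mult_adj H \<phi> f = mult_adj H \<phi> (W (?inv f))" using inv f by simp
  also have "\<dots> = W (mult_adj H \<phi> (?inv f))"
    unfolding W_def by (rule mult_adj_commute[OF \<phi> R(1)]) (use inv f in \<open>simp add: W_def\<close>)
  finally show "mult_adj H \<phi> f = W (mult_adj H \<phi> (?inv f))" .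
qed

text \<open>The kernel functions are, up to scalars, the only joint eigenvectors of the adjoints of the
  multipliers, so an intertwiner maps each \<open>k\<^sub>y\<close> to a multiple of itself and is therefore the adjoint of
  a multiplier.\<close>

lemma representing_pair_of_intertwiner:
  assumes inv: "invertible_op H HB W"
    and twine: "\<And>\<phi> f. \<lbrakk>\<phi> \<in> Mult H; f \<in> hcarrier HB\<rbrakk>
      \<Longrightarrow> mult_adj H \<phi> f = W (mult_adj H \<phi> (inv_into (hcarrier H) W f))"
  shows "\<exists>a b. representing_pair H h a b \<and> outer_mult H a \<and> hcarrier HB = mult_adj H a ` hcarrier H"
proof -
  obtain C where C: "\<And>f. f \<in> hcarrier H \<Longrightarrow> hnorm HB (W f) \<le> C * hnorm H f"
    and W: "\<And>f. f \<in> hcarrier H \<Longrightarrow> W f \<in> hcarrier HB"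
      "\<And>f g. \<lbrakk>f \<in> hcarrier H; g \<in> hcarrier H\<rbrakk> \<Longrightarrow> W (f + g) = W f + W g"
      "\<And>c f. f \<in> hcarrier H \<Longrightarrow> W (c *\<^sub>C f) = c *\<^sub>C W f"
    using inv[unfolded invertible_op_def, THEN conjunct1] unfolding bounded_op_def by blast
  have bij: "bij_betw W (hcarrier H) (hcarrier HB)" using inv by (simp add: invertible_op_def)
  have inj: "inj_on W (hcarrier H)" using bij by (simp add: bij_betw_def)
  have "\<exists>c. W (kernel_at y) = c *\<^sub>C kernel_at y" for y
  proof -
    have "mult_adj H \<phi> (W (kernel_at y)) = cnj (\<phi> y) *\<^sub>C W (kernel_at y)" if \<phi>: "\<phi> \<in> Mult H" for \<phi>
      using twine[OF \<phi> W(1)[OF kernel_in]]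
      by (simp only: inv_into_f_f[OF inj kernel_in] mult_adj_kernel[OF \<phi>] W(3)[OF kernel_in])
    then show ?thesis using joint_eigenvector[OF HB_in(1)[OF W(1)[OF kernel_in]]] by metis
  qed
  then obtain c where c: "\<And>y. W (kernel_at y) = c y *\<^sub>C kernel_at y" by metis
  \<comment> \<open>Conjugated because the adjoint of a multiplier has the conjugate value as
    eigenvalue at the kernel function.\<close>
  define \<alpha> where "\<alpha> y = cnj (c y)" for y
  \<comment> \<open>Used for \<open>S = W\<close> and for \<open>S\<close> sending \<open>f\<close>
    to \<open>adj (W f)\<close>; the norm of \<open>HB\<close> dominates both norms in
    \<open>H\<close>, so one constant serves twice. Evaluating the adjoint of \<open>S\<close> at
    \<open>y\<close> shows that it multiplies by \<open>\<gamma>\<close>.\<close>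
  have adj_of: "(\<lambda>y. \<gamma> y) \<in> Mult H \<and> (\<forall>g\<in>hcarrier H. mult_adj H \<gamma> g = S g)"
    if S: "\<And>f. f \<in> hcarrier H \<Longrightarrow> S f \<in> hcarrier H"
      "\<And>f g. \<lbrakk>f \<in> hcarrier H; g \<in> hcarrier H\<rbrakk> \<Longrightarrow> S (f + g) = S f + S g"
      "\<And>c f. f \<in> hcarrier H \<Longrightarrow> S (c *\<^sub>C f) = c *\<^sub>C S f"
      "\<And>f. f \<in> hcarrier H \<Longrightarrow> hnorm H (S f) \<le> C * hnorm H f"
      and ev: "\<And>y. S (kernel_at y) = cnj (\<gamma> y) *\<^sub>C kernel_at y" for S \<gamma>
  proof -
    have main: "mult_op \<gamma> f \<in> hcarrier H \<and> (\<forall>g\<in>hcarrier H. hinner H (S g) f = hinner H g (mult_op \<gamma> f))"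
      if f: "f \<in> hcarrier H" for f
    proof -
      have "\<exists>r\<in>hcarrier H. \<forall>g\<in>hcarrier H. hinner H (S g) f = hinner H g r"
      proof (rule riesz)
        fix g assume g: "g \<in> hcarrier H"
        have "cmod (hinner H (S g) f) \<le> hnorm H (S g) * hnorm H f" using S f g by (intro Cauchy_Schwarz) auto
        also have "\<dots> \<le> C * hnorm H g * hnorm H f" using S(4)[OF g] f by (intro mult_right_mono) auto
        finally show "cmod (hinner H (S g) f) \<le> C * hnorm H f * hnorm H g" by (simp add: mult_ac)
      qed (use S f in \<open>simp_all add: inner_add_left inner_scale_left\<close>)
      then obtain r where r: "r \<in> hcarrier H" "\<And>g. g \<in> hcarrier H \<Longrightarrow> hinner H (S g) f = hinner H g r" by blast
      have "r y = \<gamma> y * f y" for y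
      proof -
        have "cnj (r y) = hinner H (S (kernel_at y)) f" using r by (simp add: reproducing')
        also have "\<dots> = cnj (\<gamma> y * f y)"
          unfolding ev using f by (subst inner_scale_left) (simp_all add: reproducing')
        finally show ?thesis by (simp only: complex_cnj_cancel_iff)
      qed
      then have "r = mult_op \<gamma> f" by (simp add: mult_op_def fun_eq_iff)
      then show ?thesis using r by simp
    qed
    then have "\<gamma> \<in> Mult H" by (simp add: Mult_def)
    moreover have "mult_adj H \<gamma> g = S g" if g: "g \<in> hcarrier H" for g
    proof (rule mult_adj_eqI[OF S(1)[OF g]])
      fix f assume f: "f \<in> hcarrier H"
      show "hinner H (mult_op \<gamma> f) g = hinner H f (S g)"
        using main[OF f] g f S(1)[OF g] inner_commute[of g "mult_op \<gamma> f"] inner_commute[of "S g" f] by simp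
    qed
    ultimately show ?thesis by simp
  qed
  have \<alpha>: "\<alpha> \<in> Mult H" "\<And>g. g \<in> hcarrier H \<Longrightarrow> mult_adj H \<alpha> g = W g"
  proof -
    have "hnorm H (W f) \<le> C * hnorm H f" if "f \<in> hcarrier H" for f
      using C[OF that] HB_norm_ge(1)[OF W(1)[OF that]] by simp
    then have "\<alpha> \<in> Mult H \<and> (\<forall>g\<in>hcarrier H. mult_adj H \<alpha> g = W g)"
      using W HB_in c by (intro adj_of) (simp_all add: \<alpha>_def)
    then show "\<alpha> \<in> Mult H" "\<And>g. g \<in> hcarrier H \<Longrightarrow> mult_adj H \<alpha> g = W g" by auto
  qed
  define \<beta> where "\<beta> x = \<alpha> x * h x" for x
  have W_dom: "W f \<in> adj_dom" if "f \<in> hcarrier H" for f using W(1)[OF that] by (simp add: HB_carrier)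
  have "\<beta> \<in> Mult H \<and> (\<forall>g\<in>hcarrier H. mult_adj H \<beta> g = adj (W g))"
  proof (rule adj_of)
    show "hnorm H (adj (W f)) \<le> C * hnorm H f" if "f \<in> hcarrier H" for f
      using C[OF that] HB_norm_ge(2)[OF W(1)[OF that]] by simp
    show "adj (W (kernel_at y)) = cnj (\<beta> y) *\<^sub>C kernel_at y" for y
    proof (rule adj_eq)
      show "adjoint_rel h (W (kernel_at y)) (cnj (\<beta> y) *\<^sub>C kernel_at y)"
        using adjoint_rel_scale[OF adjoint_rel_kernel[of h y], of "c y"]
        by (simp add: c \<beta>_def \<alpha>_def scaleC_scaleC)
    qed
  qed (use W W_dom adj_in in \<open>simp_all add: adj_add adj_scale\<close>)
  then have \<beta>: "\<beta> \<in> Mult H" by simp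
  obtain C1 where C1: "C1 \<ge> 0" "\<And>f. f \<in> hcarrier H \<Longrightarrow> hnorm H (mult_op \<alpha> f) \<le> C1 * hnorm H f"
    by (rule Mult_bounded[OF \<alpha>(1)]) blast
  obtain C2 where C2: "C2 \<ge> 0" "\<And>f. f \<in> hcarrier H \<Longrightarrow> hnorm H (mult_op \<beta> f) \<le> C2 * hnorm H f"
    by (rule Mult_bounded[OF \<beta>]) blast
  \<comment> \<open>Rescaling makes the column contractive, since its norm is at most
    \<open>e * (C1 + C2)\<close>; the summand 1 avoids a zero denominator.\<close>
  define e where "e = 1 / (1 + C1 + C2)"
  have e: "e > 0" using C1 C2 by (simp add: e_def add_pos_nonneg)
  define a where "a x = of_real e * \<alpha> x" for x
  define b where "b x = of_real e * \<beta> x" for x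
  have a: "a \<in> Mult H" and b: "b \<in> Mult H"
    unfolding a_def[abs_def] b_def[abs_def] using \<alpha> \<beta> Mult_cmult by blast+
  have adj_a: "mult_adj H a g = W (of_real e *\<^sub>C g)" if g: "g \<in> hcarrier H" for g
  proof (rule mult_adj_eqI)
    show "W (of_real e *\<^sub>C g) \<in> hcarrier H" using W HB_in g by auto
    fix f assume f: "f \<in> hcarrier H"
    have "mult_op a f = of_real e *\<^sub>C mult_op \<alpha> f"
      by (simp add: mult_op_def a_def fun_eq_iff scaleC_fun_def scaleC_complex_def)
    then show "hinner H (mult_op a f) g = hinner H f (W (of_real e *\<^sub>C g))"
      using f g \<alpha> W HB_in mult_adj_inner[OF \<alpha>(1) g f]
      by (simp add: inner_scale_left inner_scale_right mult_op_in)
  qed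
  have W0: "W 0 = 0" using W(2)[of 0 0] by simp
  have inj_a: "\<forall>w\<in>hcarrier H. mult_adj H a w = 0 \<longrightarrow> w = 0"
  proof (intro ballI impI)
    fix w assume w: "w \<in> hcarrier H" "mult_adj H a w = 0"
    then have "W (of_real e *\<^sub>C w) = W 0" by (simp add: adj_a W0)
    then have "of_real e *\<^sub>C w = 0" 
      by (rule inj_onD[OF inj _ carrier_closed(4)[OF w(1)] carrier_closed(1)])
    then show "w = 0" using e by simp
  qed
  have range: "hcarrier HB = mult_adj H a ` hcarrier H"
  proof
    show "mult_adj H a ` hcarrier H \<subseteq> hcarrier HB" using W by (auto simp: adj_a)
    show "hcarrier HB \<subseteq> mult_adj H a ` hcarrier H"
    proof
      fix g assume "g \<in> hcarrier HB"
      then obtain f where f: "f \<in> hcarrier H" "W f = g" using bij by (metis bij_betw_imp_surj_on imageE)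
      have "g = mult_adj H a (of_real (1 / e) *\<^sub>C f)"
        using f e by (simp add: adj_a scaleC_scaleC scaleC_one flip: of_real_mult)
      then show "g \<in> mult_adj H a ` hcarrier H" 
        by (rule image_eqI[where f = "mult_adj H a"]) (rule carrier_closed(4)[OF f(1)])
    qed
  qed
  \<comment> \<open>A zero of \<open>a\<close> would put a nonzero kernel function into the kernel
    of its adjoint. That \<open>a\<close> vanishes nowhere also gives \<open>b \<noteq> 0\<close> as
    soon as \<open>h \<noteq> 0\<close>.\<close>
  have a_ne: "a y \<noteq> 0" for y
  proof
    assume "a y = 0"
    then have "mult_adj H a (kernel_at y) = 0" by (simp add: mult_adj_kernel[OF a])
    then have "kernel_at y = 0" using inj_a kernel_in by blast
    then have "k y y = 0" by (metis zero_fun_apply)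
    then show False using k_self_pos[of y] by simp
  qed
  have "representing_pair H h a b"
    unfolding representing_pair_def
  proof (intro conjI impI allI ballI a b)
    show "a \<noteq> 0" using a_ne by (metis zero_fun_apply)
    show "b \<noteq> 0" if "h \<noteq> 0"
    proof -
      have "\<exists>x. h x \<noteq> 0" using that by (simp add: fun_eq_iff)
      then obtain x where "h x \<noteq> 0" ..
      then have "b x \<noteq> 0" using a_ne[of x] e by (simp add: a_def b_def \<beta>_def)
      then show ?thesis by (metis zero_fun_apply)
    qed
    show "b x = a x * h x" for x by (simp add: a_def b_def \<beta>_def)
    fix f assume f: "f \<in> hcarrier H"
    have scaled: "mult_op a f = of_real e *\<^sub>C mult_op \<alpha> f" "mult_op b f = of_real e *\<^sub>C mult_op \<beta> f"
      by (simp_all add: mult_op_def a_def b_def fun_eq_iff scaleC_fun_def scaleC_complex_def)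
    have "hnorm H (mult_op a f) \<le> e * (C1 * hnorm H f)" "hnorm H (mult_op b f) \<le> e * (C2 * hnorm H f)"
      unfolding scaled using f e C1 C2 \<alpha> \<beta> by (simp_all add: norm_scale mult_op_in)
    moreover have "hnorm (hsum H H) (mult_op a f, mult_op b f) \<le> hnorm H (mult_op a f) + hnorm H (mult_op b f)"
      using f a b by (simp add: hnorm_def inner_nonneg mult_op_in sqrt_add_le_add_sqrt)
    ultimately have "hnorm (hsum H H) (mult_op a f, mult_op b f) \<le> (e * (C1 + C2)) * hnorm H f"
      by (simp add: algebra_simps)
    also have "\<dots> \<le> 1 * hnorm H f"
      using C1 C2 f by (intro mult_right_mono) (auto simp: e_def divide_le_eq_1)
    finally show "hnorm (hsum H H) (mult_op a f, mult_op b f) \<le> hnorm H f" by simp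
  qed
  moreover have "outer_mult H a" unfolding outer_iff_adj_injective[OF a] by (rule inj_a)
  ultimately show ?thesis using range by (intro exI conjI)
qed

end

theorem theorem5p2:
  fixes I :: "'i set"
    and u :: "'x \<Rightarrow> 'i \<Rightarrow> complex"
    and H HB :: "('x \<Rightarrow> complex) hilbert"
    and E :: "'e::complex_vector hilbert"
    and HE :: "('x \<Rightarrow> 'e) hilbert"
    and h :: "'x \<Rightarrow> complex"
    and A B :: "'x \<Rightarrow> 'e \<Rightarrow> complex"
  defines "k \<equiv> cnp_kernel I u"
    and "stmt1 \<equiv> \<exists>W. invertible_op H HB W \<and>
           (\<forall>\<phi>\<in>Mult H. \<forall>f\<in>hcarrier HB.
              mult_adj H \<phi> f = W (mult_adj H \<phi> (inv_into (hcarrier H) W f)))"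
    and "stmt2 \<equiv> \<exists>a b. representing_pair H h a b \<and> outer_mult H a \<and>
           hcarrier HB = hcarrier (adj_range_space H a)"
    and "stmt3 \<equiv> \<exists>a b. representing_pair H h a b \<and> outer_mult H a \<and> corona_pair H a b"
  assumes "cnp_map I u"
    and "scalar_rkhs k H"
    and "densely_defined_multiplier H h"
    and "hilbert_space E"
    and "tensor_rkhs k E HE"
    and "beurling_pair H E HE h A B"
    and "scalar_rkhs (HB_kernel E k B) HB"
  shows "(stmt1 \<longleftrightarrow> stmt2) \<and> (stmt2 \<longleftrightarrow> stmt3)"
proof -
  interpret cnp_beurling I u H h E HE A B HB
    using assms by unfold_locales (simp_all add: k_def)
  have "stmt1 \<Longrightarrow> stmt2"
    unfolding stmt1_def stmt2_def adj_range_space_carrier using representing_pair_of_intertwiner by blast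
  moreover have "stmt2 \<Longrightarrow> stmt1"
    unfolding stmt1_def stmt2_def adj_range_space_carrier using intertwiner_of_range_eq by blast
  moreover have "stmt2 \<Longrightarrow> stmt3"
    unfolding stmt2_def stmt3_def adj_range_space_carrier using corona_of_range_eq by blast
  moreover have "stmt3 \<Longrightarrow> stmt2"
    unfolding stmt2_def stmt3_def adj_range_space_carrier using range_eq_of_corona by blast
  ultimately show ?thesis by blast
qed

end
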